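(* The $gl(m|n)$-highest weight vectors of $S(S^2\mathbb{C}^{m|n})$ form an abelian semigroup generated by $\Gamma(2),\Gamma(4),\ldots,\Gamma(2[\frac n2])$ and $\Delta_1,\ldots,\Delta_m$, where $[\frac n2]$ denotes the largest integer not exceeding $\frac n2$. Furthermore this semigroup is free if and only if $n=0,1$. More precisely, a highest weight vector associated to an even partition $\lambda=(\lambda_1,\ldots,\lambda_l)$ (all $\lambda_i$ even) with $\lambda_{m+1}\le n$ is given by $$(\det X)^{-\frac12\sum_{i=m+2}^l\lambda_i}\;\prod_{i=m+1}^l\Gamma(\lambda_i)\;\prod_{j=r+1}^{\lambda_1}(\Delta_{\lambda'_j})^{\frac12},$$ where the non-negative integer $r$ is defined by $\lambda'_r>m$ and $\lambda'_{r+1}\le m$.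
   Context: Let $x_1,\ldots,x_m$ (even) and $\xi_1,\ldots,\xi_n$ (odd) be the standard basis of the complex superspace $\mathbb{C}^{m|n}$; the general linear Lie superalgebra $gl(m|n)$ is spanned by the first-order operators $u\frac{\partial}{\partial v}$ with $u,v\in\{x_i,\xi_j\}$. The symmetric square $S^2\mathbb{C}^{m|n}$ (in the super sense) is spanned by $x_{ij}=x_{ji}=x_ix_j$, $y_{kl}=-y_{lk}=\xi_k\xi_l$ (even) and $\eta_{ki}=\xi_kx_i$ (odd). $S(S^2\mathbb{C}^{m|n})$, its supersymmetric algebra, is the polynomial superalgebra over $\mathbb{C}$ in the even variables $x_{ij}$ ($1\le i\le j\le m$), $y_{kl}$ ($1\le k<l\le n$) and the odd variables $\eta_{ki}$, with the induced action of $gl(m|n)$. The Cartan subalgebra is spanned by $x_i\frac{\partial}{\partial x_i}$, $\xi_j\frac{\partial}{\partial\xi_j}$; the simple root vectors are $x_i\frac{\partial}{\partial x_{i+1}}$ ($1\le i\le m-1$), $\xi_j\frac{\partial}{\partial\xi_{j+1}}$ ($1\le j\le n-1$), $x_m\frac{\partial}{\partial\xi_1}$. A highest weight vector is a nonzero weight vector annihilated by the simple root vectors; it is associated to a partition $\lambda$ with $\lambda_{m+1}\le n$ if its weight is $(\lambda_1,\ldots,\lambda_m;\langle\lambda'_1-m\rangle,\ldots,\langle\lambda'_n-m\rangle)$, where $\lambda'$ is the transpose of $\lambda$ and $\langle a\rangle=\max(a,0)$. $X=(x_{ij})$ is the symmetric $m\times m$ matrix of variables, and $\Delta_r$ is its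 leading $r\times r$ minor ($1\le r\le m$), so $\Delta_m=\det X$ (with $\det X=1$ if $m=0$). $X_i(\xi_j)$ is obtained from $X$ by replacing its $i$-th row by $(\eta_{j1},\ldots,\eta_{jm})$. The determinant of a matrix $(a_{ij})$ with possibly odd entries means $\sum_{\tau}\mathrm{sgn}(\tau)\,a_{1\tau(1)}a_{2\tau(2)}\cdots$. Put $$\Delta(\xi_k,\xi_l)=-(\det X)\,y_{kl}+\sum_{i=1}^m(\det X_i(\xi_k))\,\eta_{li}.$$ For $2\le2l\le n$, $$\Gamma(2l)=\sum_\sigma\epsilon_\sigma\,\Delta(\xi_{i_1},\xi_{i_2})\Delta(\xi_{i_3},\xi_{i_4})\cdots\Delta(\xi_{i_{2l-1}},\xi_{i_{2l}}),$$ summed over all partitions $\sigma=\{(i_1,i_2),\ldots,(i_{2l-1},i_{2l})\}$ of $\{1,\ldots,2l\}$ into pairs written with $i_1<i_2,\ldots,i_{2l-1}<i_{2l}$, where $\epsilon_\sigma$ is the sign of the permutation $k\mapsto i_k$. For even $\lambda$ one has $\lambda'_{2i-1}=\lambda'_{2i}$ and $r$ is even, so $\prod_{j=r+1}^{\lambda_1}(\Delta_{\lambda'_j})^{1/2}$ means $\prod_{i=r/2+1}^{\lambda_1/2}\Delta_{\lambda'_{2i}}$. A negative power of $\det X$ means division by the corresponding positive power. Empty products are $1$ and empty sums are $0$.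
   Formalization: "Free if and only if n=0,1" is for m≥1 (for m=0 the semigroup is free for every n); "generated" allows division by powers of det X when the result is in the algebra (Γ(2)²/Δ₁ for m=1, n=2 is no product of generators); vectors are taken up to nonzero scalars. *)

theory Defs
  imports
    Complex_Main
    "HOL-Library.Poly_Mapping"
    "HOL-Library.Product_Lexorder"
    "HOL-Library.Multiset"
    "HOL-Combinatorics.Permutations"
begin

section \<open>Exterior algebras over a commutative ring\<close>

text \<open>
  The exterior algebra on generators indexed by a linearly ordered type, with coefficients in a
  commutative ring: an element is the finitely supported family of its coefficients with respect
  to the basis of increasing products of generators, one for each finite set of indices.
\<close>

typedef (overloaded) ('o, 'r::zero) ext_alg =
    "{f :: 'o set \<Rightarrow> 'r. finite {S. f S \<noteq> 0} \<and> (\<forall>S. f S \<noteq> 0 \<longrightarrow> finite S)}"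
  morphisms ext_coeff Abs_ext_alg
  by (rule exI[of _ "\<lambda>_. 0"]) simp

setup_lifting type_definition_ext_alg

lemma ext_alg_eqI: "(\<And>S. finite S \<Longrightarrow> ext_coeff a S = ext_coeff b S) \<Longrightarrow> a = b"
  by transfer (rule ext, metis)

lemma finite_supp_ext [simp]: "finite {S. ext_coeff a S \<noteq> 0}"
  by transfer simp

lemma ext_coeff_infinite [simp]: "infinite S \<Longrightarrow> ext_coeff a S = 0"
  by transfer blast

lift_definition ext_monom :: "'o set \<Rightarrow> 'r::zero \<Rightarrow> ('o, 'r) ext_alg"
  is "\<lambda>S r T. if T = S \<and> finite S then r else 0"
  by (rule conjI, rule finite_subset[of _ "{_}"]) auto

text \<open>
  The sign with which the product of the increasing products over disjoint sets \<open>S\<close> and \<open>T\<close> is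
  the increasing product over their union.
\<close>

definition shuffle_sign :: "'o::linorder set \<Rightarrow> 'o set \<Rightarrow> 'r::comm_ring_1" where
  "shuffle_sign S T = (- 1) ^ card {(s, t). s \<in> S \<and> t \<in> T \<and> t < s}"

instantiation ext_alg :: (type, comm_ring_1) ab_group_add
begin

lift_definition zero_ext_alg :: "('a, 'b) ext_alg" is "\<lambda>_. 0" by simp

lift_definition plus_ext_alg :: "('a, 'b) ext_alg \<Rightarrow> ('a, 'b) ext_alg \<Rightarrow> ('a, 'b) ext_alg"
  is "\<lambda>f g S. f S + g S"
proof -
  fix f g :: "'a set \<Rightarrow> 'b"
  assume f: "finite {S. f S \<noteq> 0} \<and> (\<forall>S. f S \<noteq> 0 \<longrightarrow> finite S)"
    and g: "finite {S. g S \<noteq> 0} \<and> (\<forall>S. g S \<noteq> 0 \<longrightarrow> finite S)"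
  have "{S. f S + g S \<noteq> 0} \<subseteq> {S. f S \<noteq> 0} \<union> {S. g S \<noteq> 0}" by auto
  then show "finite {S. f S + g S \<noteq> 0} \<and> (\<forall>S. f S + g S \<noteq> 0 \<longrightarrow> finite S)"
    using f g by (auto intro: finite_subset)
qed

lift_definition uminus_ext_alg :: "('a, 'b) ext_alg \<Rightarrow> ('a, 'b) ext_alg"
  is "\<lambda>f S. - f S" by simp

definition minus_ext_alg :: "('a, 'b) ext_alg \<Rightarrow> ('a, 'b) ext_alg \<Rightarrow> ('a, 'b) ext_alg" where
  "minus_ext_alg a b = a + - b"

lemma ext_coeff_zero [simp]: "ext_coeff 0 S = 0" by transfer simp
lemma ext_coeff_add [simp]: "ext_coeff (a + b) S = ext_coeff a S + ext_coeff b S" by transfer simp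
lemma ext_coeff_uminus [simp]: "ext_coeff (- a) S = - ext_coeff a S" by transfer simp

instance
proof
  fix a b c :: "('a, 'b) ext_alg"
  show "a + b + c = a + (b + c)" by (rule ext_alg_eqI) (simp add: add.assoc)
  show "a + b = b + a" by (rule ext_alg_eqI) (simp add: add.commute)
  show "0 + a = a" by (rule ext_alg_eqI) simp
  show "- a + a = 0" by (rule ext_alg_eqI) simp
  show "a - b = a + - b" by (rule minus_ext_alg_def)
qed

end

lemma ext_coeff_diff [simp]: "ext_coeff (a - b) S = ext_coeff a S - ext_coeff b S"
  unfolding minus_ext_alg_def ext_coeff_add ext_coeff_uminus by (rule diff_conv_add_uminus[symmetric])
lemma ext_coeff_sum [simp]: "ext_coeff (sum f A) S = (\<Sum>x\<in>A. ext_coeff (f x) S)"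
  by (induction A rule: infinite_finite_induct) auto
lemma ext_coeff_monom: "ext_coeff (ext_monom S r) T = (if T = S \<and> finite S then r else 0)"
  by transfer simp

lemma ext_monom_zero [simp]: "ext_monom S 0 = 0"
  by (rule ext_alg_eqI) (simp add: ext_coeff_monom)

lemma shuffle_sign_Un_left:
  assumes "finite S" "finite T" "finite U" "S \<inter> T = {}"
  shows "shuffle_sign (S \<union> T) U = shuffle_sign S U * shuffle_sign T U"
proof -
  let ?c = "\<lambda>A B. {(s, t). s \<in> A \<and> t \<in> B \<and> t < s}"
  have un: "?c (S \<union> T) U = ?c S U \<union> ?c T U" by blast
  have dj: "?c S U \<inter> ?c T U = {}" using assms(4) by blast
  have f1: "finite (?c S U)"
    by (rule finite_subset[of _ "S \<times> U"]) (blast, use assms in \<open>intro finite_cartesian_product\<close>)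
  have f2: "finite (?c T U)"
    by (rule finite_subset[of _ "T \<times> U"]) (blast, use assms in \<open>intro finite_cartesian_product\<close>)
  show ?thesis
    unfolding shuffle_sign_def un card_Un_disjoint[OF f1 f2 dj] by (rule power_add)
qed

lemma shuffle_sign_Un_right:
  assumes "finite S" "finite T" "finite U" "T \<inter> U = {}"
  shows "shuffle_sign S (T \<union> U) = shuffle_sign S T * shuffle_sign S U"
proof -
  let ?c = "\<lambda>A B. {(s, t). s \<in> A \<and> t \<in> B \<and> t < s}"
  have un: "?c S (T \<union> U) = ?c S T \<union> ?c S U" by blast
  have dj: "?c S T \<inter> ?c S U = {}" using assms(4) by blast
  have f1: "finite (?c S T)"
    by (rule finite_subset[of _ "S \<times> T"]) (blast, use assms in \<open>intro finite_cartesian_product\<close>)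
  have f2: "finite (?c S U)"
    by (rule finite_subset[of _ "S \<times> U"]) (blast, use assms in \<open>intro finite_cartesian_product\<close>)
  show ?thesis
    unfolding shuffle_sign_def un card_Un_disjoint[OF f1 f2 dj] by (rule power_add)
qed

lemma shuffle_sign_empty [simp]: "shuffle_sign {} T = 1" "shuffle_sign S {} = 1"
proof -
  have "{(s, t). s \<in> {} \<and> t \<in> T \<and> t < s} = {}" "{(s, t). s \<in> S \<and> t \<in> {} \<and> t < s} = {}"
    by blast+
  then show "shuffle_sign {} T = 1" "shuffle_sign S {} = 1"
    unfolding shuffle_sign_def by (metis card.empty power_0)+
qed

instantiation ext_alg :: (linorder, comm_ring_1) ring_1
begin

lift_definition times_ext_alg :: "('a, 'b) ext_alg \<Rightarrow> ('a, 'b) ext_alg \<Rightarrow> ('a, 'b) ext_alg"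
  is "\<lambda>f g U. \<Sum>S\<in>Pow U. shuffle_sign S (U - S) * f S * g (U - S)"
proof -
  fix f g :: "'a set \<Rightarrow> 'b"
  assume f: "finite {S. f S \<noteq> 0} \<and> (\<forall>S. f S \<noteq> 0 \<longrightarrow> finite S)"
    and g: "finite {S. g S \<noteq> 0} \<and> (\<forall>S. g S \<noteq> 0 \<longrightarrow> finite S)"
  let ?h = "\<lambda>U. \<Sum>S\<in>Pow U. shuffle_sign S (U - S) * f S * g (U - S)"
  have fin: "finite U" if "?h U \<noteq> 0" for U
    using that by (meson finite_Pow_iff sum.infinite)
  have "{U. ?h U \<noteq> 0} \<subseteq> (\<lambda>(S, T). S \<union> T) ` ({S. f S \<noteq> 0} \<times> {S. g S \<noteq> 0})"
  proof
    fix U assume "U \<in> {U. ?h U \<noteq> 0}"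
    then obtain S where S: "S \<subseteq> U" "shuffle_sign S (U - S) * f S * g (U - S) \<noteq> 0"
      by (auto elim: sum.not_neutral_contains_not_neutral)
    then have "f S \<noteq> 0" "g (U - S) \<noteq> 0" by auto
    then show "U \<in> (\<lambda>(S, T). S \<union> T) ` ({S. f S \<noteq> 0} \<times> {S. g S \<noteq> 0})"
      using S(1) by (intro image_eqI[of _ _ "(S, U - S)"]) auto
  qed
  then show "finite {U. ?h U \<noteq> 0} \<and> (\<forall>U. ?h U \<noteq> 0 \<longrightarrow> finite U)"
    using f g fin by (auto intro: finite_subset)
qed

definition one_ext_alg :: "('a, 'b) ext_alg" where
  "one_ext_alg = ext_monom {} 1"

lemma ext_coeff_mult:
  "ext_coeff (a * b) U = (\<Sum>S\<in>Pow U. shuffle_sign S (U - S) * ext_coeff a S * ext_coeff b (U - S))"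
  by transfer simp

instance
proof
  fix a b c :: "('a, 'b) ext_alg"
  show "a * b * c = a * (b * c)"
  proof (rule ext_alg_eqI)
    fix U :: "'a set" assume U: "finite U"
    let ?A = "ext_coeff a" and ?B = "ext_coeff b" and ?C = "ext_coeff c"
    let ?f = "\<lambda>(S, R). shuffle_sign S (U - S) * (shuffle_sign R (S - R) * ?A R * ?B (S - R)) * ?C (U - S)"
    let ?g = "\<lambda>(R, T). shuffle_sign R (U - R) * ?A R * (shuffle_sign T (U - R - T) * ?B T * ?C (U - R - T))"
    have fS: "finite S" if "S \<subseteq> U" for S using that U finite_subset by blast
    have "ext_coeff (a * b * c) U = (\<Sum>p\<in>(SIGMA S:Pow U. Pow S). ?f p)"
      using U fS by (simp add: ext_coeff_mult sum_distrib_left sum_distrib_right sum.Sigma)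
    also have "\<dots> = (\<Sum>p\<in>(SIGMA R:Pow U. Pow (U - R)). ?g p)"
    proof (rule sum.reindex_bij_witness[where i = "\<lambda>(R, T). (R \<union> T, R)" and j = "\<lambda>(S, R). (R, S - R)"])
      fix p assume "p \<in> (SIGMA S:Pow U. Pow S)"
      then obtain S R where p: "p = (S, R)" "R \<subseteq> S" "S \<subseteq> U" by auto
      have fin: "finite R" "finite (S - R)" "finite (U - S)" using p U fS by auto
      have e: "U - R - (S - R) = U - S" "R \<union> (S - R) = S" "(S - R) \<union> (U - S) = U - R" using p by auto
      have "shuffle_sign (R \<union> (S - R)) (U - S) = shuffle_sign R (U - S) * (shuffle_sign (S - R) (U - S) :: 'b)"
        by (rule shuffle_sign_Un_left) (use fin in auto)
      then have 1: "shuffle_sign S (U - S) = shuffle_sign R (U - S) * (shuffle_sign (S - R) (U - S) :: 'b)"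
        by (simp only: e)
      have "shuffle_sign R ((S - R) \<union> (U - S)) = shuffle_sign R (S - R) * (shuffle_sign R (U - S) :: 'b)"
        by (rule shuffle_sign_Un_right) (use fin in auto)
      then have 2: "shuffle_sign R (U - R) = shuffle_sign R (S - R) * (shuffle_sign R (U - S) :: 'b)"
        by (simp only: e)
      show "?g (case p of (S, R) \<Rightarrow> (R, S - R)) = ?f p"
        by (simp add: p(1) e(1) 1 2 mult_ac)
    qed auto
    also have "\<dots> = ext_coeff (a * (b * c)) U"
      using U fS by (simp add: ext_coeff_mult sum_distrib_left sum_distrib_right sum.Sigma mult.assoc)
    finally show "ext_coeff (a * b * c) U = ext_coeff (a * (b * c)) U" .
  qed
  show "(a + b) * c = a * c + b * c"
    by (rule ext_alg_eqI) (simp add: ext_coeff_mult algebra_simps sum.distrib)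
  show "a * (b + c) = a * b + a * c"
    by (rule ext_alg_eqI) (simp add: ext_coeff_mult algebra_simps sum.distrib)
  show "1 * a = a"
  proof (rule ext_alg_eqI)
    fix U :: "'a set" assume U: "finite U"
    have "ext_coeff (1 * a) U = (\<Sum>S\<in>{{}}. shuffle_sign S (U - S) * ext_coeff 1 S * ext_coeff a (U - S))"
      unfolding ext_coeff_mult
      by (rule sum.mono_neutral_right) (use U in \<open>auto simp: one_ext_alg_def ext_coeff_monom\<close>)
    then show "ext_coeff (1 * a) U = ext_coeff a U" by (simp add: one_ext_alg_def ext_coeff_monom)
  qed
  show "a * 1 = a"
  proof (rule ext_alg_eqI)
    fix U :: "'a set" assume U: "finite U"
    have "ext_coeff (a * 1) U = (\<Sum>S\<in>{U}. shuffle_sign S (U - S) * ext_coeff a S * ext_coeff 1 (U - S))"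
      unfolding ext_coeff_mult
      by (rule sum.mono_neutral_right) (use U in \<open>auto simp: one_ext_alg_def ext_coeff_monom\<close>)
    then show "ext_coeff (a * 1) U = ext_coeff a U" by (simp add: one_ext_alg_def ext_coeff_monom)
  qed
  show "(0::('a, 'b) ext_alg) \<noteq> 1"
  proof
    assume "(0::('a, 'b) ext_alg) = 1"
    then have "ext_coeff (0::('a, 'b) ext_alg) {} = ext_coeff 1 {}" by simp
    then show False by (simp add: one_ext_alg_def ext_coeff_monom)
  qed
qed

end

text \<open>
  Left partial derivative with respect to an odd generator: the sign comes from moving that
  generator to the left end of the increasing product.
\<close>

definition odd_deriv :: "'o::linorder \<Rightarrow> ('o, 'r::comm_ring_1) ext_alg \<Rightarrow> ('o, 'r) ext_alg" where
  "odd_deriv q a =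
     (\<Sum>S | ext_coeff a S \<noteq> 0 \<and> q \<in> S. ext_monom (S - {q}) ((- 1) ^ card {s \<in> S. s < q} * ext_coeff a S))"


section \<open>The supersymmetric algebra of the symmetric square\<close>

text \<open>
  Indices of basis vectors run from 1.  \<open>XX i j\<close> names the variable \<open>x\<^sub>i\<^sub>j\<close> for \<open>i \<le> j\<close>, \<open>YY k l\<close> the
  variable \<open>y\<^sub>k\<^sub>l\<close> for \<open>k < l\<close>, and the pair \<open>(k, i)\<close> names the odd variable \<open>\<eta>\<^sub>k\<^sub>i\<close>.
\<close>

datatype evar = XX nat nat | YY nat nat

type_synonym ovar = "nat \<times> nat"

type_synonym even_poly = "(evar \<Rightarrow>\<^sub>0 nat) \<Rightarrow>\<^sub>0 complex"

type_synonym superpoly = "(ovar, even_poly) ext_alg"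

definition evars :: "nat \<Rightarrow> nat \<Rightarrow> evar set" where
  "evars m n = {XX i j | i j. 1 \<le> i \<and> i \<le> j \<and> j \<le> m} \<union> {YY k l | k l. 1 \<le> k \<and> k < l \<and> l \<le> n}"

definition ovars :: "nat \<Rightarrow> nat \<Rightarrow> ovar set" where
  "ovars m n = {1..n} \<times> {1..m}"

text \<open>
  The type \<^typ>\<open>superpoly\<close> has variables for all \<open>m\<close>, \<open>n\<close> at once; the algebra belonging to a given
  pair consists of the elements that involve only its own variables.
\<close>

definition SS :: "nat \<Rightarrow> nat \<Rightarrow> superpoly set" where
  "SS m n = {f. \<forall>S. ext_coeff f S \<noteq> 0 \<longrightarrow> S \<subseteq> ovars m n \<and>
                   (\<forall>\<alpha> \<in> Poly_Mapping.keys (ext_coeff f S). Poly_Mapping.keys \<alpha> \<subseteq> evars m n)}"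

definition const :: "complex \<Rightarrow> superpoly" where
  "const c = ext_monom {} (Poly_Mapping.single 0 c)"

definition even_var :: "evar \<Rightarrow> superpoly" where
  "even_var e = ext_monom {} (Poly_Mapping.single (Poly_Mapping.single e 1) 1)"

definition xvar :: "nat \<Rightarrow> nat \<Rightarrow> superpoly" where
  "xvar i j = even_var (XX (min i j) (max i j))"

definition yvar :: "nat \<Rightarrow> nat \<Rightarrow> superpoly" where
  "yvar k l = (if k < l then even_var (YY k l) else if l < k then - even_var (YY l k) else 0)"

definition odd_var :: "nat \<Rightarrow> nat \<Rightarrow> superpoly" where
  "odd_var k i = ext_monom {(k, i)} 1"

definition poly_deriv :: "evar \<Rightarrow> even_poly \<Rightarrow> even_poly" where
  "poly_deriv e p = (\<Sum>\<alpha> | \<alpha> \<in> Poly_Mapping.keys p \<and> Poly_Mapping.lookup \<alpha> e > 0.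
     Poly_Mapping.single (\<alpha> - Poly_Mapping.single e 1)
       (of_nat (Poly_Mapping.lookup \<alpha> e) * Poly_Mapping.lookup p \<alpha>))"

definition even_deriv :: "evar \<Rightarrow> superpoly \<Rightarrow> superpoly" where
  "even_deriv e f = (\<Sum>S | ext_coeff f S \<noteq> 0. ext_monom S (poly_deriv e (ext_coeff f S)))"


section \<open>The action of the general linear Lie superalgebra\<close>

datatype bvec = Bx nat | Bxi nat

fun parity :: "bvec \<Rightarrow> nat" where
  "parity (Bx i) = 0"
| "parity (Bxi j) = 1"

text \<open>The product of two basis vectors in the symmetric square.\<close>

fun sq :: "bvec \<Rightarrow> bvec \<Rightarrow> superpoly" where
  "sq (Bx i) (Bx j) = xvar i j"
| "sq (Bxi k) (Bx i) = odd_var k i"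
| "sq (Bx i) (Bxi k) = odd_var k i"
| "sq (Bxi k) (Bxi l) = yvar k l"

text \<open>
  The operator \<open>u \<partial>/\<partial>v\<close> on \<open>a b\<close>, for basis vectors \<open>a\<close>, \<open>b\<close>: it sends \<open>v\<close> to \<open>u\<close>, kills the other
  basis vectors, and passes \<open>a\<close> with the usual sign.
\<close>

definition act_sq :: "bvec \<Rightarrow> bvec \<Rightarrow> bvec \<Rightarrow> bvec \<Rightarrow> superpoly" where
  "act_sq u v a b =
     (if a = v then sq u b else 0)
     + (if b = v then (- 1) ^ ((parity u + parity v) * parity a) * sq a u else 0)"

fun act_evar :: "bvec \<Rightarrow> bvec \<Rightarrow> evar \<Rightarrow> superpoly" where
  "act_evar u v (XX i j) = act_sq u v (Bx i) (Bx j)"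
| "act_evar u v (YY k l) = act_sq u v (Bxi k) (Bxi l)"

fun act_ovar :: "bvec \<Rightarrow> bvec \<Rightarrow> ovar \<Rightarrow> superpoly" where
  "act_ovar u v (k, i) = act_sq u v (Bxi k) (Bx i)"

text \<open>
  The superderivation \<open>D = u \<partial>/\<partial>v\<close> of the whole algebra with these values on the variables,
  written as \<open>\<Sum>z. D(z) \<partial>/\<partial>z\<close> with left derivatives.
\<close>

definition gl_act :: "nat \<Rightarrow> nat \<Rightarrow> bvec \<Rightarrow> bvec \<Rightarrow> superpoly \<Rightarrow> superpoly" where
  "gl_act m n u v f =
     (\<Sum>e\<in>evars m n. act_evar u v e * even_deriv e f)
     + (\<Sum>q\<in>ovars m n. act_ovar u v q * odd_deriv q f)"

lemma gl_act_even_var: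
  assumes "e \<in> evars m n"
  shows "gl_act m n u v (even_var e) = act_evar u v e"
proof -
  have fe: "finite (evars m n)"
    by (rule finite_subset[of _ "case_prod XX ` ({..m} \<times> {..m}) \<union> case_prod YY ` ({..n} \<times> {..n})"])
       (auto simp: evars_def)
  have supp: "{S. ext_coeff (even_var e) S \<noteq> 0} = {{}}"
  proof -
    have "Poly_Mapping.single (Poly_Mapping.single e 1) 1 \<noteq> (0 :: even_poly)"
      by (metis keys_zero keys_single insert_not_empty zero_neq_one)
    then show ?thesis by (auto simp: even_var_def ext_coeff_monom)
  qed
  have "even_deriv e' (even_var e) = (if e' = e then 1 else 0)" for e'
  proof -
    have pd: "poly_deriv e' (Poly_Mapping.single (Poly_Mapping.single e 1) 1) = (if e' = e then 1 else 0)"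
    proof (cases "e' = e")
      case True
      have "{\<alpha>. \<alpha> = Poly_Mapping.single e (Suc 0) \<and> 0 < Poly_Mapping.lookup \<alpha> e} = {Poly_Mapping.single e (Suc 0)}"
        by auto
      with True show ?thesis by (simp add: poly_deriv_def)
    next
      case False
      then have "{\<alpha>. \<alpha> = Poly_Mapping.single e (Suc 0) \<and> 0 < Poly_Mapping.lookup \<alpha> e'} = {}"
        by (auto simp: lookup_single when_def)
      with False show ?thesis by (simp add: poly_deriv_def)
    qed
    show ?thesis
      unfolding even_deriv_def supp by (simp add: even_var_def ext_coeff_monom pd[simplified] one_ext_alg_def ext_monom_zero)
  qed
  moreover have "odd_deriv q (even_var e) = 0" for q
  proof -
    have "{S. ext_coeff (even_var e) S \<noteq> 0 \<and> q \<in> S} = {}" using supp by auto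
    then show ?thesis unfolding odd_deriv_def by (simp only: sum.empty)
  qed
  ultimately show ?thesis
    using fe assms by (simp add: gl_act_def if_distrib[where f = "(*) _"] cong: if_cong)
qed

lemma gl_act_odd_var:
  assumes "(k, i) \<in> ovars m n"
  shows "gl_act m n u v (odd_var k i) = act_ovar u v (k, i)"
proof -
  have fo: "finite (ovars m n)" by (simp add: ovars_def)
  have supp: "{S. ext_coeff (odd_var k i) S \<noteq> 0} = {{(k, i)}}"
    by (auto simp: odd_var_def ext_coeff_monom)
  have "odd_deriv q (odd_var k i) = (if q = (k, i) then 1 else 0)" for q
  proof (cases "q = (k, i)")
    case True
    then have "{S. ext_coeff (odd_var k i) S \<noteq> 0 \<and> q \<in> S} = {{(k, i)}}" using supp by auto
    then have "odd_deriv q (odd_var k i) = ext_monom ({(k, i)} - {q})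
        ((- 1) ^ card {s \<in> {(k, i)}. s < q} * ext_coeff (odd_var k i) {(k, i)})"
      unfolding odd_deriv_def by simp
    moreover have "{s \<in> {(k, i)}. s < q} = {}" using True by blast
    ultimately show ?thesis
      using True by (simp only: card.empty) (simp add: odd_var_def ext_coeff_monom one_ext_alg_def)
  next
    case False
    then have "{S. ext_coeff (odd_var k i) S \<noteq> 0 \<and> q \<in> S} = {}" using supp by auto
    with False show ?thesis unfolding odd_deriv_def by (simp only: sum.empty if_False)
  qed
  moreover have "even_deriv e (odd_var k i) = 0" for e
  proof -
    have "{\<alpha> :: evar \<Rightarrow>\<^sub>0 nat. \<alpha> = 0 \<and> 0 < Poly_Mapping.lookup \<alpha> e} = {}" by auto
    then have "poly_deriv e 1 = 0" by (simp add: poly_deriv_def)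
    then show ?thesis unfolding even_deriv_def supp by (simp add: odd_var_def ext_coeff_monom ext_monom_zero)
  qed
  ultimately show ?thesis
    using fo assms by (simp add: gl_act_def if_distrib[where f = "(*) _"] cong: if_cong)
qed

definition has_weight ::
    "nat \<Rightarrow> nat \<Rightarrow> (nat \<Rightarrow> complex) \<Rightarrow> (nat \<Rightarrow> complex) \<Rightarrow> superpoly \<Rightarrow> bool" where
  "has_weight m n a b f \<longleftrightarrow>
     (\<forall>i\<in>{1..m}. gl_act m n (Bx i) (Bx i) f = const (a i) * f) \<and>
     (\<forall>j\<in>{1..n}. gl_act m n (Bxi j) (Bxi j) f = const (b j) * f)"

definition singular :: "nat \<Rightarrow> nat \<Rightarrow> superpoly \<Rightarrow> bool" where
  "singular m n f \<longleftrightarrow>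
     (\<forall>i. 1 \<le> i \<and> i < m \<longrightarrow> gl_act m n (Bx i) (Bx (i + 1)) f = 0) \<and>
     (\<forall>j. 1 \<le> j \<and> j < n \<longrightarrow> gl_act m n (Bxi j) (Bxi (j + 1)) f = 0) \<and>
     (1 \<le> m \<and> 1 \<le> n \<longrightarrow> gl_act m n (Bx m) (Bxi 1) f = 0)"

definition HW :: "nat \<Rightarrow> nat \<Rightarrow> superpoly set" where
  "HW m n = {f \<in> SS m n. f \<noteq> 0 \<and> (\<exists>a b. has_weight m n a b f) \<and> singular m n f}"


section \<open>Partitions\<close>

definition is_partition :: "nat list \<Rightarrow> bool" where
  "is_partition la \<longleftrightarrow> sorted_wrt (\<ge>) la \<and> 0 \<notin> set la"

text \<open>Parts and columns are numbered from 1.\<close>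

definition part :: "nat list \<Rightarrow> nat \<Rightarrow> nat" where
  "part la i = (if 1 \<le> i \<and> i \<le> length la then la ! (i - 1) else 0)"

definition conj_part :: "nat list \<Rightarrow> nat \<Rightarrow> nat" where
  "conj_part la j = card {i \<in> {1..length la}. j \<le> part la i}"

text \<open>Truncated subtraction on \<^typ>\<open>nat\<close> is the bracket \<open>\<langle>\<lambda>'\<^sub>j - m\<rangle>\<close>.\<close>

definition HW_assoc :: "nat \<Rightarrow> nat \<Rightarrow> nat list \<Rightarrow> superpoly set" where
  "HW_assoc m n la = {f \<in> HW m n.
     has_weight m n (\<lambda>i. of_nat (part la i)) (\<lambda>j. of_nat (conj_part la j - m)) f}"


section \<open>The vectors \<open>\<Delta>\<^sub>r\<close> and \<open>\<Gamma>(2l)\<close>\<close>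

definition sdet :: "nat \<Rightarrow> (nat \<Rightarrow> nat \<Rightarrow> superpoly) \<Rightarrow> superpoly" where
  "sdet r A = (\<Sum>\<tau> | \<tau> permutes {1..r}. of_int (sign \<tau>) * (\<Prod>i\<leftarrow>[1..<r + 1]. A i (\<tau> i)))"

definition Delta :: "nat \<Rightarrow> superpoly" where
  "Delta r = sdet r xvar"

definition detX_row :: "nat \<Rightarrow> nat \<Rightarrow> nat \<Rightarrow> superpoly" where
  "detX_row m i k = sdet m (\<lambda>p q. if p = i then odd_var k q else xvar p q)"

definition Delta_xi :: "nat \<Rightarrow> nat \<Rightarrow> nat \<Rightarrow> superpoly" where
  "Delta_xi m k l = - (Delta m * yvar k l) + (\<Sum>i = 1..m. detX_row m i k * odd_var l i)"

text \<open>
  A partition of \<open>{1..2l}\<close> into pairs is encoded by the permutation \<open>k \<mapsto> i\<^sub>k\<close> that lists its pairs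
  in the order of their smaller elements.
\<close>

definition pairings :: "nat \<Rightarrow> (nat \<Rightarrow> nat) set" where
  "pairings l = {p. p permutes {1..2 * l} \<and>
     (\<forall>k\<in>{1..l}. p (2 * k - 1) < p (2 * k)) \<and>
     (\<forall>k. 1 \<le> k \<and> k < l \<longrightarrow> p (2 * k - 1) < p (2 * k + 1))}"

text \<open>The argument of \<open>Gamma\<close> is the even number \<open>N = 2l\<close>.\<close>

definition Gamma :: "nat \<Rightarrow> nat \<Rightarrow> superpoly" where
  "Gamma m N = (\<Sum>p\<in>pairings (N div 2).
     of_int (sign p) * (\<Prod>k\<leftarrow>[1..<N div 2 + 1]. Delta_xi m (p (2 * k - 1)) (p (2 * k))))"

definition hw_generators :: "nat \<Rightarrow> nat \<Rightarrow> superpoly set" where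
  "hw_generators m n = (\<lambda>l. Gamma m (2 * l)) ` {1..n div 2} \<union> Delta ` {1..m}"


section \<open>Semigroups of highest weight vectors\<close>

text \<open>
  Highest weight vectors matter up to nonzero scalars.  As in the explicit formula for them,
  negative powers of \<open>det X\<close> are allowed in the products of generators, provided that the result
  lies in the algebra: already for \<open>m = 1\<close>, \<open>n = 2\<close> the highest weight vector
  \<open>\<Gamma>(2)\<^sup>2 / \<Delta>\<^sub>1\<close> is not a product of \<open>\<Gamma>(2)\<close>'s and \<open>\<Delta>\<^sub>1\<close>'s.
\<close>

definition generated_semigroup :: "nat \<Rightarrow> nat \<Rightarrow> superpoly set \<Rightarrow> superpoly set" where
  "generated_semigroup m n G = {f \<in> SS m n.
     \<exists>c k gs. c \<noteq> 0 \<and> set gs \<subseteq> G \<and> Delta m ^ k * f = const c * prod_list gs}"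

text \<open>
  \<open>B\<close> is a basis of the abelian semigroup \<open>H\<close> taken modulo nonzero scalars, that is, \<open>H\<close> modulo
  nonzero scalars is the free abelian semigroup with unit on \<open>B\<close>.
\<close>

definition free_basis :: "superpoly set \<Rightarrow> superpoly set \<Rightarrow> bool" where
  "free_basis H B \<longleftrightarrow> B \<subseteq> H \<and>
     (\<forall>f\<in>H. \<exists>!M. set_mset M \<subseteq> B \<and> (\<exists>bs c. mset bs = M \<and> c \<noteq> 0 \<and> f = const c * prod_list bs))"

definition free_semigroup :: "superpoly set \<Rightarrow> bool" where
  "free_semigroup H \<longleftrightarrow> (\<exists>B. free_basis H B)"

text \<open>
  \<open>v\<close> is \<open>(det X)\<^sup>-\<^sup>k \<Prod>\<Gamma>(\<lambda>\<^sub>i) \<Prod>\<Delta>\<close> with \<open>k\<close> half the sum of the parts from \<open>m + 2\<close> on; the second product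
  has one factor for each pair of equal columns \<open>2i - 1, 2i\<close> with \<open>r < 2i \<le> \<lambda>\<^sub>1\<close>.
\<close>

definition is_hw_formula :: "nat \<Rightarrow> nat list \<Rightarrow> nat \<Rightarrow> superpoly \<Rightarrow> bool" where
  "is_hw_formula m la r v \<longleftrightarrow>
     Delta m ^ ((\<Sum>i = m + 2..length la. part la i) div 2) * v =
       (\<Prod>i\<leftarrow>[m + 1..<length la + 1]. Gamma m (part la i)) *
       (\<Prod>i\<leftarrow>[r div 2 + 1..<part la 1 div 2 + 1]. Delta (conj_part la (2 * i)))"

end

theory Submission
  imports Defs
begin

text \<open>
  Call the variables \<open>x\<^sub>i\<^sub>i\<close> and \<open>y\<^sub>1\<^sub>2, y\<^sub>3\<^sub>4, \<dots>\<close> diagonal.  For every other variable \<open>v\<close>, even or odd, there is a positive root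
  vector that equals \<open>d \<partial>/\<partial>v\<close> with a diagonal variable \<open>d\<close>, up to sign and up to terms that do not lower the number of
  nondiagonal factors of a monomial.  The lowest component of a singular vector, with respect to that number,
  is therefore killed by all derivatives \<open>\<partial>/\<partial>v\<close>, and a singular vector without diagonal monomials vanishes
  (\<open>singular_eq_0\<close>).  Since a diagonal monomial is determined by its weight, a highest weight vector contains exactly one of
  them, and highest weight vectors of the same weight are proportional (\<open>hwv_proportional\<close>).  For the same reason they commute, and
  their products do not vanish.  Identities between them up to scalars become comparisons of weights.

  The minors \<open>\<Delta>\<^sub>r\<close> are highest weight vectors since a determinant with two equal rows vanishes (\<open>hwv_Delta\<close>).
  Up to the factor \<open>- det X\<close>, \<open>\<Delta>(\<xi>\<^sub>k, \<xi>\<^sub>l)\<close> is the entry of the Schur complement \<open>y - \<eta> X\<^sup>-\<^sup>1 \<eta>\<^sup>T\<close>.  It is killed by all \<open>x\<^sub>i \<partial>/\<partial>\<xi>\<^sub>j\<close>, and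
  \<open>gl\<^sub>n\<close> acts on it as on an alternating form, so that the Pfaffians \<open>\<Gamma>(2l)\<close> of the leading blocks are highest weight vectors
  (\<open>hwv_Gamma\<close>).  Conversely, the weight of a highest weight vector is dominant by \<open>sl\<^sub>2\<close>-theory (\<open>hwv_dominant\<close>).  The dominant
  weights of diagonal monomials are the weights of products of the generators, up to powers of \<open>det X\<close>, and
  proportionality shows that the generators generate (\<open>HW_generated\<close>).

  The formula for the vector of an even partition \<open>\<lambda>\<close> then only requires a weight computation, provided
  that \<open>\<Prod> \<Gamma>(\<lambda>\<^sub>i)\<close> is divisible by the given power of \<open>det X\<close> (\<open>Gamma_product_divisible\<close>).  Where \<open>det X\<close> vanishes, the adjugate
  of \<open>X\<close> has rank one.  Hence, with \<open>a = \<Delta>\<^sub>m\<^sub>-\<^sub>1\<close> and suitable odd \<open>\<theta>\<^sub>k\<close>, one has \<open>a \<Delta>(\<xi>\<^sub>k, \<xi>\<^sub>l) = \<theta>\<^sub>k \<theta>\<^sub>l\<close> modulo \<open>det X\<close>.  In a product of \<open>p\<close> such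
  factors with indices up to \<open>N\<close>, at most \<open>N/2\<close> of them can contribute \<open>\<theta>\<^sub>k \<theta>\<^sub>l\<close>, because \<open>\<theta>\<^sub>k \<theta>\<^sub>k = 0\<close>.  So \<open>a\<^sup>p\<close> times the
  product is divisible by \<open>(det X)\<^sup>q\<close> with \<open>q = p - N/2\<close>, and \<open>a\<close> can be cancelled, as consecutive leading minors are
  coprime (\<open>minors_coprime\<close>).

  For \<open>n \<le> 1\<close> the generators are the minors, whose weights are linearly independent (\<open>free_basis_small\<close>).  For \<open>n \<ge> 2\<close>
  all quotients \<open>\<Gamma>(2)\<^sup>k / (det X)\<^sup>k\<^sup>-\<^sup>1\<close> are highest weight vectors.  In a free semigroup, the factorisation of
  \<open>\<Gamma>(2)\<close> would then contain the one of \<open>det X\<close>, which does not divide \<open>\<Gamma>(2)\<close> (\<open>not_free\<close>).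
\<close>

section \<open>Coefficients in the polynomial superalgebra\<close>

abbreviation (input) "lookup \<equiv> Poly_Mapping.lookup"
abbreviation (input) "single \<equiv> Poly_Mapping.single"
abbreviation (input) "keys \<equiv> Poly_Mapping.keys"

text \<open>Any linear order on the variables makes the polynomials an integral domain by comparison of leading terms.\<close>

instantiation evar :: linorder
begin

fun evar_key :: "evar \<Rightarrow> nat \<times> nat \<times> nat" where
  "evar_key (XX i j) = (0, i, j)"
| "evar_key (YY k l) = (1, k, l)"

definition less_eq_evar :: "evar \<Rightarrow> evar \<Rightarrow> bool" where
  "e \<le> f \<longleftrightarrow> evar_key e \<le> evar_key f"

definition less_evar :: "evar \<Rightarrow> evar \<Rightarrow> bool" where
  "e < f \<longleftrightarrow> evar_key e < evar_key f"

instance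
proof
  fix e f :: evar
  assume "e \<le> f" "f \<le> e"
  then have "evar_key e = evar_key f" by (simp add: less_eq_evar_def)
  then show "e = f" by (cases e; cases f) auto
qed (auto simp: less_eq_evar_def less_evar_def)

end

subsection \<open>The exterior algebra\<close>

lemma ext_alg_eqI': "(\<And>S. ext_coeff a S = ext_coeff b S) \<Longrightarrow> a = b"
  by (rule ext_alg_eqI) simp

lemma ext_coeff_scalar_mult: "ext_coeff (ext_monom {} p * f) S = p * ext_coeff f S"
proof (cases "finite S")
  case True
  have "ext_coeff (ext_monom {} p * f) S
      = (\<Sum>T\<in>{{}}. shuffle_sign T (S - T) * ext_coeff (ext_monom {} p) T * ext_coeff f (S - T))"
    unfolding ext_coeff_mult
    by (rule sum.mono_neutral_right) (use True in \<open>auto simp: ext_coeff_monom\<close>)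
  then show ?thesis by (simp add: ext_coeff_monom)
qed simp

lemma ext_coeff_mult_scalar: "ext_coeff (f * ext_monom {} p) S = ext_coeff f S * p"
proof (cases "finite S")
  case True
  have "ext_coeff (f * ext_monom {} p) S
      = (\<Sum>T\<in>{S}. shuffle_sign T (S - T) * ext_coeff f T * ext_coeff (ext_monom {} p) (S - T))"
    unfolding ext_coeff_mult
    by (rule sum.mono_neutral_right) (use True in \<open>auto simp: ext_coeff_monom\<close>)
  then show ?thesis by (simp add: ext_coeff_monom)
qed simp

lemma ext_monom_scalar_central: "f * ext_monom {} p = ext_monom {} p * f"
  by (rule ext_alg_eqI) (simp add: ext_coeff_scalar_mult ext_coeff_mult_scalar mult.commute)

lemma shuffle_sign_singleton_left:
  "shuffle_sign {q} T = (- 1) ^ card {t \<in> T. t < q}"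
proof -
  have "{(s, t). s \<in> {q} \<and> t \<in> T \<and> t < s} = Pair q ` {t \<in> T. t < q}" by auto
  then show ?thesis unfolding shuffle_sign_def
    by (simp add: card_image inj_on_def)
qed

lemma shuffle_sign_singleton_right:
  "shuffle_sign S {q} = (- 1) ^ card {s \<in> S. q < s}"
proof -
  have "{(s, t). s \<in> S \<and> t \<in> {q} \<and> t < s} = (\<lambda>s. (s, q)) ` {s \<in> S. q < s}" by auto
  then show ?thesis unfolding shuffle_sign_def
    by (simp add: card_image inj_on_def)
qed

lemma ext_coeff_odd_mult:
  "ext_coeff (ext_monom {q} 1 * f) S =
     (if q \<in> S then (- 1) ^ card {s \<in> S. s < q} * ext_coeff f (S - {q}) else 0)"
proof (cases "finite S")
  case True
  have "ext_coeff (ext_monom {q} 1 * f) S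
      = (\<Sum>T\<in>{{q}} \<inter> Pow S. shuffle_sign T (S - T) * ext_coeff (ext_monom {q} 1) T * ext_coeff f (S - T))"
    unfolding ext_coeff_mult
    by (rule sum.mono_neutral_right) (use True in \<open>auto simp: ext_coeff_monom\<close>)
  also have "\<dots> = (if q \<in> S then shuffle_sign {q} (S - {q}) * ext_coeff f (S - {q}) else 0)"
    by (simp add: ext_coeff_monom)
  finally have e: "ext_coeff (ext_monom {q} 1 * f) S
      = (if q \<in> S then shuffle_sign {q} (S - {q}) * ext_coeff f (S - {q}) else 0)" .
  have "{t \<in> S - {q}. t < q} = {t \<in> S. t < q}" by auto
  then show ?thesis unfolding e shuffle_sign_singleton_left by simp
qed simp

lemma ext_coeff_mult_odd:
  "ext_coeff (f * ext_monom {q} 1) S =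
     (if q \<in> S then (- 1) ^ card {s \<in> S. q < s} * ext_coeff f (S - {q}) else 0)"
proof (cases "finite S")
  case True
  have "ext_coeff (f * ext_monom {q} 1) S
      = (\<Sum>T\<in>{S - {q}} \<inter> {T. q \<in> S}. shuffle_sign T (S - T) * ext_coeff f T * ext_coeff (ext_monom {q} 1) (S - T))"
    unfolding ext_coeff_mult
    by (rule sum.mono_neutral_right) (use True in \<open>auto simp: ext_coeff_monom double_diff\<close>)
  also have "\<dots> = (if q \<in> S then shuffle_sign (S - {q}) {q} * ext_coeff f (S - {q}) else 0)"
    by (auto simp: ext_coeff_monom double_diff)
  finally have e: "ext_coeff (f * ext_monom {q} 1) S
      = (if q \<in> S then shuffle_sign (S - {q}) {q} * ext_coeff f (S - {q}) else 0)" .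
  have "{t \<in> S - {q}. q < t} = {t \<in> S. q < t}" by auto
  then show ?thesis unfolding e shuffle_sign_singleton_right by simp
qed simp

lemma ext_coeff_odd_deriv:
  "ext_coeff (odd_deriv q f) S =
     (if q \<in> S then 0 else (- 1) ^ card {s \<in> S. s < q} * ext_coeff f (insert q S))"
proof -
  let ?A = "{T. ext_coeff f T \<noteq> 0 \<and> q \<in> T}"
  have fin: "finite ?A" by (rule finite_subset[OF _ finite_supp_ext[of f]]) auto
  have "ext_coeff (odd_deriv q f) S = (\<Sum>T\<in>?A. if S = T - {q} \<and> finite (T - {q})
      then (- 1) ^ card {s \<in> T. s < q} * ext_coeff f T else 0)"
    by (simp add: odd_deriv_def ext_coeff_monom)
  also have "\<dots> = (\<Sum>T\<in>?A. if T = insert q S \<and> q \<notin> S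
      then (- 1) ^ card {s \<in> T. s < q} * ext_coeff f T else 0)"
  proof (rule sum.cong)
    fix T assume T: "T \<in> ?A"
    then have "finite T" using ext_coeff_infinite by blast
    with T have "S = T - {q} \<and> finite (T - {q}) \<longleftrightarrow> T = insert q S \<and> q \<notin> S" by auto
    then show "(if S = T - {q} \<and> finite (T - {q}) then (- 1) ^ card {s \<in> T. s < q} * ext_coeff f T else 0)
        = (if T = insert q S \<and> q \<notin> S then (- 1) ^ card {s \<in> T. s < q} * ext_coeff f T else 0)"
      by (rule if_cong) (rule refl)+
  qed simp
  also have "\<dots> = (if q \<in> S then 0 else (- 1) ^ card {s \<in> insert q S. s < q} * ext_coeff f (insert q S))"
    using fin by (cases "q \<in> S"; cases "ext_coeff f (insert q S) = 0") (auto simp: sum.delta cong: if_cong)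
  also have "{s \<in> insert q S. s < q} = {s \<in> S. s < q}" by auto
  finally show ?thesis .
qed

subsection \<open>Polynomials in the even variables\<close>

lemma poly_mapping_sum_singles:
  "p = (\<Sum>k\<in>keys p. single k (lookup p k))"
proof (rule poly_mapping_eqI)
  fix k
  have "lookup (\<Sum>k\<in>keys p. single k (lookup p k)) k
     = (\<Sum>j\<in>keys p. if j = k then lookup p j else 0)"
    by (simp add: lookup_sum lookup_single when_def)
  also have "\<dots> = lookup p k" by (simp add: in_keys_iff)
  finally show "lookup p k = lookup
      (\<Sum>k\<in>keys p. single k (lookup p k)) k" by simp
qed

lemma poly_mapping_single_induct:
  assumes "\<And>k c. P (single k c)" "\<And>p q. P p \<Longrightarrow> P q \<Longrightarrow> P (p + q)"
  shows "P (p :: 'a \<Rightarrow>\<^sub>0 'b::comm_monoid_add)"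
proof -
  have "P (\<Sum>k\<in>K. single k (lookup p k))" if "finite K" for K
    using that
  proof induction
    case empty
    show ?case using assms(1)[of undefined 0] by simp
  qed (simp add: assms)
  from this[of "keys p"] show ?thesis by (simp flip: poly_mapping_sum_singles)
qed

lemma lookup_var_mult:
  "lookup (single (single e 1) 1 * (p :: even_poly)) \<alpha> =
     (if lookup \<alpha> e > 0 then lookup p (\<alpha> - single e 1) else 0)"
proof (induction p rule: poly_mapping_single_induct)
  case (1 k c)
  have "single e 1 + k = \<alpha> \<longleftrightarrow> lookup \<alpha> e > 0 \<and> k = \<alpha> - single e 1"
    by (auto simp: poly_mapping_eq_iff fun_eq_iff lookup_add lookup_minus lookup_single when_def)
  then show ?case by (auto simp: mult_single lookup_single when_def)
qed (auto simp: distrib_left lookup_add)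

lemma lookup_poly_deriv:
  "lookup (poly_deriv e p) \<alpha> =
     of_nat (lookup \<alpha> e + 1) * lookup p (\<alpha> + single e 1)"
proof -
  let ?s = "single e (1::nat)"
  let ?A = "{\<beta>. \<beta> \<in> keys p \<and> lookup \<beta> e > 0}"
  have eq: "\<beta> - ?s = \<alpha> \<longleftrightarrow> \<beta> = \<alpha> + ?s" if "lookup \<beta> e > 0" for \<beta>
    using that by (auto simp: poly_mapping_eq_iff fun_eq_iff lookup_add lookup_minus lookup_single when_def)
  have "lookup (poly_deriv e p) \<alpha>
      = (\<Sum>\<beta>\<in>?A. if \<beta> = \<alpha> + ?s then of_nat (lookup \<beta> e) * lookup p \<beta> else 0)"
    unfolding poly_deriv_def lookup_sum
  proof (rule sum.cong)
    fix \<beta> assume "\<beta> \<in> ?A"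
    then have "\<beta> - ?s = \<alpha> \<longleftrightarrow> \<beta> = \<alpha> + ?s" by (intro eq) blast
    then show "lookup (single (\<beta> - ?s) (of_nat (lookup \<beta> e) * lookup p \<beta>)) \<alpha>
        = (if \<beta> = \<alpha> + ?s then of_nat (lookup \<beta> e) * lookup p \<beta> else 0)"
      unfolding lookup_single when_def by (rule if_cong) (rule refl)+
  qed simp
  also have "\<dots> = (if \<alpha> + ?s \<in> ?A then of_nat (lookup (\<alpha> + ?s) e) * lookup p (\<alpha> + ?s) else 0)"
    by (simp add: sum.delta')
  also have "\<dots> = of_nat (lookup \<alpha> e + 1) * lookup p (\<alpha> + ?s)"
    by (auto simp: lookup_add in_keys_iff)
  finally show ?thesis .
qed

definition monom_weight :: "(evar \<Rightarrow> nat) \<Rightarrow> (evar \<Rightarrow>\<^sub>0 nat) \<Rightarrow> nat" where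
  "monom_weight w \<alpha> = (\<Sum>e\<in>keys \<alpha>. w e * lookup \<alpha> e)"

lemma monom_weight_superset:
  "finite A \<Longrightarrow> keys \<alpha> \<subseteq> A \<Longrightarrow> monom_weight w \<alpha> = (\<Sum>e\<in>A. w e * lookup \<alpha> e)"
  unfolding monom_weight_def by (rule sum.mono_neutral_left) (auto simp: in_keys_iff)

lemma monom_weight_add: "monom_weight w (\<alpha> + \<beta>) = monom_weight w \<alpha> + monom_weight w \<beta>"
proof -
  let ?A = "keys \<alpha> \<union> keys \<beta>"
  have "keys (\<alpha> + \<beta>) \<subseteq> ?A" by (rule keys_add)
  then show ?thesis
    by (simp add: monom_weight_superset[of ?A] lookup_add algebra_simps sum.distrib)
qed

lemma monom_weight_single [simp]: "monom_weight w (single e k) = w e * k"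
  by (simp add: monom_weight_def)

lemma monomial_split:
  "lookup \<alpha> e > 0 \<Longrightarrow> \<alpha> = (\<alpha> - single e 1) + single e (1::nat)"
  by (auto simp: poly_mapping_eq_iff fun_eq_iff lookup_add lookup_minus lookup_single when_def)

lemma monomial_induct [case_names zero add]:
  assumes "P 0" "\<And>\<alpha> e. P \<alpha> \<Longrightarrow> P (single e 1 + \<alpha>)"
  shows "P (\<alpha> :: evar \<Rightarrow>\<^sub>0 nat)"
proof (induction "monom_weight (\<lambda>_. 1) \<alpha>" arbitrary: \<alpha>)
  case 0
  then have "lookup \<alpha> e = 0" for e by (auto simp: monom_weight_def in_keys_iff)
  then have "\<alpha> = 0" by (intro poly_mapping_eqI) simp
  then show ?case using assms(1) by simp
next
  case (Suc k)
  have "\<exists>e. lookup \<alpha> e > 0"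
  proof (rule ccontr)
    assume "\<nexists>e. lookup \<alpha> e > 0"
    then have "monom_weight (\<lambda>_. 1) \<alpha> = 0" by (simp add: monom_weight_def)
    with Suc(2) show False by simp
  qed
  then obtain e where "lookup \<alpha> e > 0" by blast
  note e = monomial_split[OF this]
  have "k = monom_weight (\<lambda>_. 1) (\<alpha> - single e 1)"
    using Suc(2) by (subst (asm) e) (simp add: monom_weight_add)
  from Suc(1)[OF this] assms(2) show ?case by (subst e) (metis add.commute)
qed

subsection \<open>Generators of the superalgebra\<close>

abbreviation emb :: "even_poly \<Rightarrow> superpoly" where
  "emb p \<equiv> ext_monom {} p"

abbreviation pvar :: "evar \<Rightarrow> even_poly" where
  "pvar e \<equiv> single (single e 1) 1"

lemma emb_add: "emb (p + q) = emb p + emb q"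
  by (rule ext_alg_eqI) (simp add: ext_coeff_monom)
lemma emb_uminus: "emb (- p) = - emb p"
  by (rule ext_alg_eqI) (simp add: ext_coeff_monom)
lemma emb_diff: "emb (p - q) = emb p - emb q"
  by (rule ext_alg_eqI) (simp add: ext_coeff_monom)
lemma emb_mult: "emb (p * q) = emb p * emb q"
  by (rule ext_alg_eqI) (simp add: ext_coeff_scalar_mult, simp add: ext_coeff_monom)
lemma emb_one [simp]: "emb 1 = 1"
  by (simp add: one_ext_alg_def)
lemma emb_sum: "emb (sum f A) = (\<Sum>x\<in>A. emb (f x))"
  by (induction A rule: infinite_finite_induct) (simp_all add: emb_add)
lemma emb_prod_list: "emb (prod_list (map f xs)) = (\<Prod>x\<leftarrow>xs. emb (f x))"
  by (induction xs) (simp_all add: emb_mult)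
lemma emb_power: "emb (p ^ k) = emb p ^ k"
  by (induction k) (simp_all add: emb_mult)
lemma emb_of_int: "emb (of_int k) = of_int k"
  by (induction k rule: int_induct[where k = 0]) (simp_all add: emb_add emb_diff)
lemma emb_eq_iff [simp]: "emb p = emb q \<longleftrightarrow> p = q"
  by (metis ext_coeff_monom finite.emptyI)
lemma emb_eq_0_iff [simp]: "emb p = 0 \<longleftrightarrow> p = 0"
  by (metis emb_eq_iff ext_monom_zero)
lemma emb_central: "f * emb p = emb p * f"
  by (rule ext_monom_scalar_central)

lemma const_eq_emb: "const c = emb (single 0 c)"
  by (simp add: const_def)
lemma even_var_eq_emb: "even_var e = emb (pvar e)"
  by (simp add: even_var_def)

lemma const_add: "const (a + b) = const a + const b"
  by (simp add: const_eq_emb single_add emb_add)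
lemma const_mult: "const (a * b) = const a * const b"
  by (simp add: const_eq_emb mult_single flip: emb_mult)
lemma const_one [simp]: "const 1 = 1"
  by (simp add: const_eq_emb)
lemma const_zero [simp]: "const 0 = 0"
  by (simp add: const_eq_emb)
lemma const_uminus: "const (- a) = - const a"
  by (simp add: const_eq_emb single_uminus emb_uminus)
lemma const_diff: "const (a - b) = const a - const b"
  by (simp add: const_eq_emb single_diff emb_diff)
lemma const_central: "f * const c = const c * f"
  by (simp add: const_eq_emb emb_central)
lemma even_var_central: "f * even_var e = even_var e * f"
  by (simp add: even_var_eq_emb emb_central)
lemma const_left_commute: "f * (const c * g) = const c * (f * g)"
  by (metis const_central mult.assoc)
lemma even_var_left_commute: "f * (even_var e * g) = even_var e * (f * g)"
  by (metis even_var_central mult.assoc)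
lemma emb_left_commute: "f * (emb p * g) = emb p * (f * g)"
  by (metis emb_central mult.assoc)
lemma const_of_nat: "const (of_nat k) = of_nat k"
  by (induction k) (simp_all add: const_add)

text \<open>
  Multiplication by a variable and differentiation shift the index of a coefficient and multiply it by
  a number, so identities that involve only these operations can be checked coefficient by coefficient.
\<close>

definition cf :: "superpoly \<Rightarrow> ovar set \<Rightarrow> (evar \<Rightarrow>\<^sub>0 nat) \<Rightarrow> complex" where
  "cf f S \<alpha> = lookup (ext_coeff f S) \<alpha>"

lemma superpoly_eqI: "(\<And>S \<alpha>. cf f S \<alpha> = cf g S \<alpha>) \<Longrightarrow> f = g"
  by (auto intro!: ext_alg_eqI' poly_mapping_eqI simp: cf_def)

lemma cf_zero [simp]: "cf 0 S \<alpha> = 0" by (simp add: cf_def)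
lemma cf_add [simp]: "cf (f + g) S \<alpha> = cf f S \<alpha> + cf g S \<alpha>" by (simp add: cf_def lookup_add)
lemma cf_uminus [simp]: "cf (- f) S \<alpha> = - cf f S \<alpha>" by (simp add: cf_def)
lemma cf_diff [simp]: "cf (f - g) S \<alpha> = cf f S \<alpha> - cf g S \<alpha>" by (simp add: cf_def lookup_minus)
lemma cf_sum [simp]: "cf (sum f A) S \<alpha> = (\<Sum>x\<in>A. cf (f x) S \<alpha>)"
  by (induction A rule: infinite_finite_induct) auto
lemma cf_infinite: "infinite S \<Longrightarrow> cf f S \<alpha> = 0" by (simp add: cf_def)

lemma lookup_const_mult: "lookup (single 0 c * (p :: even_poly)) \<alpha> = c * lookup p \<alpha>"
proof (induction p rule: poly_mapping_single_induct)
  case (1 k d)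
  then show ?case by (simp add: mult_single lookup_single when_def)
qed (simp add: distrib_left lookup_add)

lemma cf_const_mult [simp]: "cf (const c * f) S \<alpha> = c * cf f S \<alpha>"
  by (simp add: cf_def const_eq_emb ext_coeff_scalar_mult lookup_const_mult)

lemma cf_even_var_mult:
  "cf (even_var e * f) S \<alpha> =
     (if lookup \<alpha> e > 0 then cf f S (\<alpha> - single e 1) else 0)"
  by (simp only: cf_def even_var_eq_emb ext_coeff_scalar_mult lookup_var_mult)

lemma minus_one_power_poly: "((- 1) ^ k :: even_poly) = single 0 ((- 1) ^ k)"
  by (induction k) (simp_all add: single_uminus)

lemma cf_odd_var_mult:
  "cf (odd_var k i * f) S \<alpha> =
     (if (k, i) \<in> S then (- 1) ^ card {s \<in> S. s < (k, i)} * cf f (S - {(k, i)}) \<alpha> else 0)"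
  by (auto simp: cf_def odd_var_def ext_coeff_odd_mult minus_one_power_poly lookup_const_mult)

lemma cf_mult_odd_var:
  "cf (f * odd_var k i) S \<alpha> =
     (if (k, i) \<in> S then (- 1) ^ card {s \<in> S. (k, i) < s} * cf f (S - {(k, i)}) \<alpha> else 0)"
  by (auto simp: cf_def odd_var_def ext_coeff_mult_odd minus_one_power_poly lookup_const_mult)

lemma ext_coeff_even_deriv: "ext_coeff (even_deriv e f) S = poly_deriv e (ext_coeff f S)"
proof -
  have pd0: "poly_deriv e 0 = 0" by (simp add: poly_deriv_def)
  have "ext_coeff (even_deriv e f) S
      = (\<Sum>T | ext_coeff f T \<noteq> 0. if T = S then poly_deriv e (ext_coeff f T) else 0)"
    unfolding even_deriv_def ext_coeff_sum
    by (rule sum.cong) (auto simp: ext_coeff_monom)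
  then show ?thesis by (auto simp: sum.delta' pd0)
qed

lemma cf_even_deriv:
  "cf (even_deriv e f) S \<alpha> = of_nat (lookup \<alpha> e + 1) * cf f S (\<alpha> + single e 1)"
  by (simp only: cf_def ext_coeff_even_deriv lookup_poly_deriv)

lemma cf_odd_deriv:
  "cf (odd_deriv q f) S \<alpha> =
     (if q \<in> S then 0 else (- 1) ^ card {s \<in> S. s < q} * cf f (insert q S) \<alpha>)"
  by (auto simp: cf_def ext_coeff_odd_deriv minus_one_power_poly lookup_const_mult)

lemma cf_const: "cf (const c) S \<alpha> = (if S = {} \<and> \<alpha> = 0 then c else 0)"
  by (auto simp: cf_def const_eq_emb ext_coeff_monom lookup_single when_def)

text \<open>
  Every element is built from constants by sums and by left multiplication with variables.  Identities between
  superderivations therefore only have to be checked on variables.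
\<close>

lemma superpoly_induct [case_names const add even odd]:
  fixes f :: superpoly
  assumes "\<And>c. P (const c)" "\<And>f g. P f \<Longrightarrow> P g \<Longrightarrow> P (f + g)"
    and "\<And>e f. P f \<Longrightarrow> P (even_var e * f)" "\<And>k i f. P f \<Longrightarrow> P (odd_var k i * f)"
  shows "P f"
proof -
  have mono: "P (emb (single \<alpha> c))" for \<alpha> c
  proof (induction \<alpha> rule: monomial_induct)
    case zero
    then show ?case using assms(1) by (simp add: const_eq_emb)
  next
    case (add \<alpha> e)
    have "emb (single (single e 1 + \<alpha>) c)
        = even_var e * emb (single \<alpha> c)"
      by (simp add: even_var_eq_emb mult_single flip: emb_mult)
    then show ?case using add assms(3) by simp
  qed
  have scal: "P (emb p)" for p
    by (induction p rule: poly_mapping_single_induct) (auto simp: mono emb_add assms(2))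
  have ext: "P (ext_monom S p)" if "finite S" for S p
    using that
  proof (induction S arbitrary: p)
    case (insert q S)
    obtain k i where q: "q = (k, i)" by (cases q)
    have "ext_monom (insert q S) p = odd_var k i * ext_monom S ((- 1) ^ card {s \<in> S. s < q} * p)"
    proof (rule ext_alg_eqI)
      fix T :: "ovar set"
      have eq: "{s \<in> insert q S. s < q} = {s \<in> S. s < q}" by auto
      have "(- 1) ^ j * ((- 1) ^ j * p) = p" for j
        by (simp flip: mult.assoc power_add mult_2 add: power_mult)
      moreover have "T - {q} = S \<longleftrightarrow> T = insert q S" if "q \<in> T" using insert that by auto
      ultimately show "ext_coeff (ext_monom (insert q S) p) T
          = ext_coeff (odd_var k i * ext_monom S ((- 1) ^ card {s \<in> S. s < q} * p)) T"
        unfolding odd_var_def q[symmetric] ext_coeff_odd_mult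
        using insert eq by (auto simp: ext_coeff_monom)
    qed
    then show ?case using insert assms(4) by simp
  qed (use scal in simp)
  have fin: "finite S" if "ext_coeff f S \<noteq> 0" for S using that ext_coeff_infinite by blast
  have "P (\<Sum>S\<in>K. ext_monom S (ext_coeff f S))" if "finite K" "K \<subseteq> {S. ext_coeff f S \<noteq> 0}" for K
    using that
  proof induction
    case empty
    show ?case using assms(1)[of 0] by simp
  qed (auto intro!: assms(2) ext fin)
  from this[of "{S. ext_coeff f S \<noteq> 0}"] have "P (\<Sum>S | ext_coeff f S \<noteq> 0. ext_monom S (ext_coeff f S))"
    by simp
  also have "(\<Sum>S | ext_coeff f S \<noteq> 0. ext_monom S (ext_coeff f S)) = f"
  proof (rule ext_alg_eqI)
    fix S :: "ovar set" assume "finite S"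
    have "ext_coeff (\<Sum>S | ext_coeff f S \<noteq> 0. ext_monom S (ext_coeff f S)) S
        = (\<Sum>T | ext_coeff f T \<noteq> 0. if T = S then ext_coeff f T else 0)"
      unfolding ext_coeff_sum by (rule sum.cong) (auto simp: ext_coeff_monom)
    also have "\<dots> = ext_coeff f S" by (auto simp: sum.delta')
    finally show "ext_coeff (\<Sum>S | ext_coeff f S \<noteq> 0. ext_monom S (ext_coeff f S)) S = ext_coeff f S" .
  qed
  finally show ?thesis .
qed

section \<open>Superderivations\<close>

lemma even_deriv_add: "even_deriv e (f + g) = even_deriv e f + even_deriv e g"
  by (rule superpoly_eqI) (simp only: cf_even_deriv cf_add distrib_left)
lemma odd_deriv_add: "odd_deriv q (f + g :: superpoly) = odd_deriv q f + odd_deriv q g"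
  by (rule superpoly_eqI) (simp add: cf_odd_deriv distrib_left)
lemma even_deriv_const_mult: "even_deriv e (const c * f) = const c * even_deriv e f"
  by (rule superpoly_eqI) (simp add: cf_even_deriv)
lemma odd_deriv_const_mult: "odd_deriv q (const c * f) = const c * odd_deriv q f"
  by (rule superpoly_eqI) (simp add: cf_odd_deriv)
lemma even_deriv_const [simp]: "even_deriv e (const c) = 0"
proof (rule superpoly_eqI)
  fix S \<alpha>
  have "\<alpha> + single e (1::nat) \<noteq> 0"
  proof
    assume "\<alpha> + single e (1::nat) = 0"
    from arg_cong[OF this, of "\<lambda>x. lookup x e"] show False by (simp add: lookup_add)
  qed
  then show "cf (even_deriv e (const c)) S \<alpha> = cf 0 S \<alpha>"
    by (simp only: cf_even_deriv cf_const) simp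
qed
lemma odd_deriv_const [simp]: "odd_deriv q (const c) = 0"
  by (rule superpoly_eqI) (auto simp: cf_odd_deriv cf_const)

lemma even_deriv_even_var_mult:
  "even_deriv e (even_var e' * f) = (if e = e' then f else 0) + even_var e' * even_deriv e f"
proof (rule superpoly_eqI)
  fix S \<alpha>
  show "cf (even_deriv e (even_var e' * f)) S \<alpha>
      = cf ((if e = e' then f else 0) + even_var e' * even_deriv e f) S \<alpha>"
  proof (cases "e = e'")
    case True
    have 1: "\<alpha> + single e' 1 - single e' 1 = \<alpha>" by simp
    have 2: "\<alpha> - single e' 1 + single e' 1 = \<alpha>"
      if "lookup \<alpha> e' > 0" using monomial_split[OF that] by simp
    show ?thesis
    proof (cases "lookup \<alpha> e' > 0")
      case T: True
      show ?thesis using True T 1 2[OF T]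
        by (simp only: cf_even_deriv cf_even_var_mult cf_add lookup_add lookup_minus lookup_single_eq)
          (simp add: algebra_simps of_nat_diff)
    next
      case F: False
      then show ?thesis using True 1
        by (simp only: cf_even_deriv cf_even_var_mult cf_add lookup_add lookup_minus lookup_single_eq) simp
    qed
  next
    case False
    have 1: "\<alpha> + single e 1 - single e' 1
        = \<alpha> - single e' 1 + single e (1::nat)"
      using False by (intro poly_mapping_eqI) (auto simp: lookup_add lookup_minus lookup_single when_def)
    show ?thesis using False 1
      by (simp only: cf_even_deriv cf_even_var_mult cf_add lookup_add lookup_minus) (simp add: lookup_single when_def)
  qed
qed

lemma ext_coeff_odd_deriv_scalar: "odd_deriv q (emb p * f) = emb p * odd_deriv q f"
  by (rule ext_alg_eqI') (simp add: ext_coeff_odd_deriv ext_coeff_scalar_mult mult.left_commute)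

lemma odd_deriv_even_var_mult: "odd_deriv q (even_var e * f) = even_var e * odd_deriv q f"
  by (simp add: even_var_eq_emb ext_coeff_odd_deriv_scalar)

lemma even_deriv_odd_var_mult: "even_deriv e (odd_var k i * f) = odd_var k i * even_deriv e f"
  by (rule superpoly_eqI) (simp add: cf_even_deriv cf_odd_var_mult)

lemma odd_deriv_odd_var_mult:
  "odd_deriv q (odd_var k i * f) = (if q = (k, i) then f else 0) - odd_var k i * odd_deriv q f"
proof (rule superpoly_eqI)
  fix S \<alpha>
  define p where "p = (k, i)"
  note c = cf_odd_var_mult[of k i, folded p_def]
  show "cf (odd_deriv q (odd_var k i * f)) S \<alpha>
      = cf ((if q = (k, i) then f else 0) - odd_var k i * odd_deriv q f) S \<alpha>"
  proof (cases "finite S")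
    case fin: True
    show ?thesis unfolding p_def[symmetric]
    proof (cases "q = p")
      case True
      have 1: "{s \<in> insert p S. s < p} = {s \<in> S. s < p}" "{s \<in> S - {p}. s < p} = {s \<in> S. s < p}" by auto
      show "cf (odd_deriv q (odd_var k i * f)) S \<alpha> = cf ((if q = p then f else 0) - odd_var k i * odd_deriv q f) S \<alpha>"
        using True 1 by (cases "p \<in> S") (auto simp: cf_odd_deriv c insert_absorb simp flip: mult.assoc power_add mult_2)
    next
      case False
      show "cf (odd_deriv q (odd_var k i * f)) S \<alpha> = cf ((if q = p then f else 0) - odd_var k i * odd_deriv q f) S \<alpha>"
      proof (cases "q \<notin> S \<and> p \<in> S")
        case T: True
        have e: "insert q S - {p} = insert q (S - {p})" using False by auto
        have sg: "(- 1 :: complex) ^ card {s \<in> S. s < q} * (- 1) ^ card {s \<in> insert q S. s < p}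
            = - ((- 1) ^ card {s \<in> S. s < p} * (- 1) ^ card {s \<in> S - {p}. s < q})"
        proof (cases "p < q")
          case True
          have a: "{s \<in> S. s < q} = insert p {s \<in> S - {p}. s < q}" using True T by auto
          have b: "{s \<in> insert q S. s < p} = {s \<in> S. s < p}" using True by auto
          show ?thesis unfolding b unfolding a using fin by simp
        next
          case F: False
          have a: "{s \<in> S - {p}. s < q} = {s \<in> S. s < q}" using F by auto
          have b: "{s \<in> insert q S. s < p} = insert q {s \<in> S. s < p}" using F False by auto
          show ?thesis unfolding b a using fin T by simp
        qed
        show ?thesis using T False sg
          by (simp add: cf_odd_deriv c e flip: mult.assoc)
      qed (use False in \<open>auto simp: cf_odd_deriv c\<close>)
    qed
  qed (simp add: cf_infinite)
qed

text \<open>The parity involution: it records the signs that arise when an odd operator passes an element.\<close>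

lift_definition twist :: "('o, 'r::comm_ring_1) ext_alg \<Rightarrow> ('o, 'r) ext_alg" is "\<lambda>f S. (- 1) ^ card S * f S"
proof -
  fix f :: "'o set \<Rightarrow> 'r"
  assume "finite {S. f S \<noteq> 0} \<and> (\<forall>S. f S \<noteq> 0 \<longrightarrow> finite S)"
  then show "finite {S. (- 1) ^ card S * f S \<noteq> 0} \<and> (\<forall>S. (- 1) ^ card S * f S \<noteq> 0 \<longrightarrow> finite S)"
    by (auto intro: rev_finite_subset)
qed

lemma cf_twist: "cf (twist f) S \<alpha> = (- 1) ^ card S * cf f S \<alpha>"
proof -
  have "ext_coeff (twist f) S = (- 1) ^ card S * ext_coeff f S" by transfer simp
  then show ?thesis by (simp add: cf_def minus_one_power_poly lookup_const_mult)
qed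

lemma twist_add: "twist (f + g :: superpoly) = twist f + twist g"
  by (rule superpoly_eqI) (simp add: cf_twist algebra_simps)
lemma twist_uminus: "twist (- f :: superpoly) = - twist f"
  by (rule superpoly_eqI) (simp add: cf_twist)
lemma twist_zero [simp]: "twist (0 :: superpoly) = 0"
  by (rule superpoly_eqI) (simp add: cf_twist)
lemma twist_const [simp]: "twist (const c) = const c"
  by (rule superpoly_eqI) (auto simp: cf_twist cf_const)
lemma twist_even_var_mult: "twist (even_var e * f) = even_var e * twist f"
  by (rule superpoly_eqI) (simp add: cf_twist cf_even_var_mult)
lemma twist_odd_var_mult: "twist (odd_var k i * f) = - (odd_var k i * twist f)"
proof (rule superpoly_eqI)
  fix S \<alpha>
  show "cf (twist (odd_var k i * f)) S \<alpha> = cf (- (odd_var k i * twist f)) S \<alpha>"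
  proof (cases "finite S \<and> (k, i) \<in> S")
    case True
    then have "card S = Suc (card (S - {(k, i)}))" by (metis card_Suc_Diff1)
    then have "(- 1 :: complex) ^ card S = - ((- 1) ^ card (S - {(k, i)}))" by (simp only: power_Suc) simp
    with True show ?thesis by (simp add: cf_twist cf_odd_var_mult)
  qed (auto simp: cf_twist cf_odd_var_mult cf_infinite)
qed
lemma twist_even_var [simp]: "twist (even_var e) = even_var e"
  using twist_even_var_mult[of e "const 1"] twist_const[of 1] by (simp only: const_one mult_1_right)
lemma twist_odd_var [simp]: "twist (odd_var k i) = - odd_var k i"
  using twist_odd_var_mult[of k i "const 1"] twist_const[of 1] by (simp only: const_one mult_1_right)

text \<open>
  Moving an odd variable to the left past an element of parity \<open>p\<close> costs the sign \<open>(-1)\<^sup>p\<close>.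
\<close>

lemma odd_var_commute: "f * odd_var k i = odd_var k i * twist f"
proof (rule superpoly_eqI)
  fix S \<alpha>
  define p where "p = (k, i)"
  show "cf (f * odd_var k i) S \<alpha> = cf (odd_var k i * twist f) S \<alpha>"
  proof (cases "finite S \<and> p \<in> S")
    case True
    have "S - {p} = {s \<in> S. s < p} \<union> {s \<in> S. p < s}" by auto
    then have "card (S - {p}) = card ({s \<in> S. s < p} \<union> {s \<in> S. p < s})" by simp
    also have "\<dots> = card {s \<in> S. s < p} + card {s \<in> S. p < s}"
      using True by (intro card_Un_disjoint) auto
    finally have "card (S - {p}) = card {s \<in> S. s < p} + card {s \<in> S. p < s}" .
    with True show ?thesis
      by (simp add: cf_mult_odd_var cf_odd_var_mult cf_twist power_add p_def flip: mult.assoc)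
  qed (auto simp: cf_mult_odd_var cf_odd_var_mult cf_infinite p_def)
qed

lemma twist_mult: "twist (f * g :: superpoly) = twist f * twist g"
proof (induction f rule: superpoly_induct)
  case (const c)
  show ?case by (rule superpoly_eqI) (simp add: cf_twist)
next
  case (odd k i f)
  then show ?case by (simp add: twist_odd_var_mult mult.assoc)
qed (simp_all add: twist_add distrib_right mult.assoc twist_even_var_mult)

lemma odd_var_anticommute: "odd_var k i * odd_var l j = - (odd_var l j * odd_var k i)"
  using odd_var_commute[of "odd_var k i" l j] by simp

subsection \<open>Products of two basis vectors\<close>

lemma xvar_commute: "xvar i j = xvar j i"
  by (simp add: xvar_def min.commute max.commute)
lemma yvar_anticommute: "yvar k l = - yvar l k"
  by (auto simp: yvar_def)
lemma yvar_same [simp]: "yvar k k = 0"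
  by (simp add: yvar_def)

lemma twist_sq: "twist (sq a b) = (if parity a = parity b then sq a b else - sq a b)"
  by (cases a; cases b) (auto simp: xvar_def yvar_def twist_uminus)

lemma sq_swap: "sq b a = (if parity a = 1 \<and> parity b = 1 then - sq a b else sq a b)"
  by (cases a; cases b) (auto simp: xvar_commute intro: yvar_anticommute)

lemma parity_cases: "parity a = 0 \<or> parity a = Suc 0"
  by (cases a) auto

lemma act_sq_swap:
  "act_sq u v b a = (if parity a = 1 \<and> parity b = 1 then - act_sq u v a b else act_sq u v a b)"
  using parity_cases[of a] parity_cases[of b] parity_cases[of u] sq_swap[of a u] sq_swap[of b u]
  by (auto simp: act_sq_def)

lemma act_sq_odd_same: "parity a = 1 \<Longrightarrow> act_sq u v a a = 0"
  using parity_cases[of u] sq_swap[of u a] by (auto simp: act_sq_def)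

lemma twist_act_sq:
  "twist (act_sq u v a b) =
     (if (parity u = parity v) = (parity a = parity b) then act_sq u v a b else - act_sq u v a b)"
  using parity_cases[of a] parity_cases[of b] parity_cases[of u]
  by (auto simp: act_sq_def twist_add twist_uminus twist_sq)

definition bvecs :: "nat \<Rightarrow> nat \<Rightarrow> bvec set" where
  "bvecs m n = Bx ` {1..m} \<union> Bxi ` {1..n}"

lemma bvecs_simps [simp]:
  "Bx i \<in> bvecs m n \<longleftrightarrow> 1 \<le> i \<and> i \<le> m" "Bxi j \<in> bvecs m n \<longleftrightarrow> 1 \<le> j \<and> j \<le> n"
  by (auto simp: bvecs_def)

lemma finite_evars [simp]: "finite (evars m n)"
  by (rule finite_subset[of _ "case_prod XX ` ({..m} \<times> {..m}) \<union> case_prod YY ` ({..n} \<times> {..n})"])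
     (auto simp: evars_def)

lemma finite_ovars [simp]: "finite (ovars m n)"
  by (simp add: ovars_def)

subsection \<open>The Leibniz rule\<close>

lemma gl_act_add: "gl_act m n u v (f + g) = gl_act m n u v f + gl_act m n u v g"
  by (simp add: gl_act_def even_deriv_add odd_deriv_add distrib_left sum.distrib)
lemma gl_act_const_mult: "gl_act m n u v (const c * f) = const c * gl_act m n u v f"
  by (simp add: gl_act_def even_deriv_const_mult odd_deriv_const_mult const_left_commute
      sum_distrib_left distrib_left)
lemma gl_act_const [simp]: "gl_act m n u v (const c) = 0"
  by (simp add: gl_act_def)
lemma gl_act_zero [simp]: "gl_act m n u v 0 = 0"
  using gl_act_const[of m n u v 0] by simp
lemma gl_act_one [simp]: "gl_act m n u v 1 = 0"
  using gl_act_const[of m n u v 1] by simp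
lemma gl_act_uminus: "gl_act m n u v (- f) = - gl_act m n u v f"
  using gl_act_const_mult[of m n u v "-1" f] by (simp add: const_uminus)
lemma gl_act_diff: "gl_act m n u v (f - g) = gl_act m n u v f - gl_act m n u v g"
  using gl_act_add[of m n u v f "- g"] by (simp add: gl_act_uminus)
lemma gl_act_sum: "gl_act m n u v (sum f A) = (\<Sum>x\<in>A. gl_act m n u v (f x))"
  by (induction A rule: infinite_finite_induct) (auto simp: gl_act_add)

lemma twist_act_evar: "twist (act_evar u v e) = (if parity u = parity v then act_evar u v e else - act_evar u v e)"
  by (cases e) (auto simp: twist_act_sq)
lemma twist_act_ovar: "twist (act_ovar u v q) = (if parity u = parity v then - act_ovar u v q else act_ovar u v q)"
  by (cases q) (auto simp: twist_act_sq)

lemma gl_act_even_var_mult':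
  "gl_act m n u v (even_var e * f) =
     (if e \<in> evars m n then act_evar u v e else 0) * f + even_var e * gl_act m n u v f"
proof -
  have "gl_act m n u v (even_var e * f)
      = (\<Sum>e'\<in>evars m n. (if e' = e then act_evar u v e' * f else 0) + even_var e * (act_evar u v e' * even_deriv e' f))
        + (\<Sum>q\<in>ovars m n. even_var e * (act_ovar u v q * odd_deriv q f))"
    unfolding gl_act_def even_deriv_even_var_mult odd_deriv_even_var_mult
    by (intro arg_cong2[of _ _ _ _ "(+)"] sum.cong) (auto simp: distrib_left even_var_left_commute)
  then show ?thesis
    by (simp add: sum.distrib gl_act_def distrib_left sum_distrib_left add.assoc)
qed

lemma gl_act_odd_var_mult':
  "gl_act m n u v (odd_var k i * f) =
     (if (k, i) \<in> ovars m n then act_ovar u v (k, i) else 0) * f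
     + (if parity u = parity v then odd_var k i else - odd_var k i) * gl_act m n u v f"
proof -
  let ?s = "if parity u = parity v then odd_var k i else - odd_var k i"
  have 1: "act_evar u v e * (odd_var k i * g) = ?s * (act_evar u v e * g)" for e g
    by (simp add: odd_var_commute twist_act_evar flip: mult.assoc)
  have 2: "act_ovar u v q * (odd_var k i * g) = - (?s * (act_ovar u v q * g))" for q g
    by (simp add: odd_var_commute twist_act_ovar flip: mult.assoc)
  have "gl_act m n u v (odd_var k i * f)
      = (\<Sum>e\<in>evars m n. ?s * (act_evar u v e * even_deriv e f))
        + (\<Sum>q\<in>ovars m n. (if q = (k, i) then act_ovar u v q * f else 0) + ?s * (act_ovar u v q * odd_deriv q f))"
    unfolding gl_act_def even_deriv_odd_var_mult odd_deriv_odd_var_mult 1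
    by (intro arg_cong2[of _ _ _ _ "(+)"] sum.cong refl) (auto simp only: right_diff_distrib 2 split: if_splits, simp_all)
  then show ?thesis
    by (simp add: sum.distrib gl_act_def distrib_left sum_distrib_left add_ac sum_negf)
qed

lemma gl_act_even_var': "gl_act m n u v (even_var e) = (if e \<in> evars m n then act_evar u v e else 0)"
  using gl_act_even_var_mult'[of m n u v e 1] by simp
lemma gl_act_odd_var': "gl_act m n u v (odd_var k i) = (if (k, i) \<in> ovars m n then act_ovar u v (k, i) else 0)"
  using gl_act_odd_var_mult'[of m n u v k i 1] by simp

lemmas gl_act_even_var_mult = gl_act_even_var_mult'[folded gl_act_even_var']
lemmas gl_act_odd_var_mult = gl_act_odd_var_mult'[folded gl_act_odd_var']

text \<open>
  The general left factor is reduced to single variables, where moving the coefficient of the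
  operator past the variable gives exactly the sign of the super Leibniz rule.
\<close>

theorem gl_act_mult:
  "gl_act m n u v (f * g) =
     gl_act m n u v f * g + (if parity u = parity v then f else twist f) * gl_act m n u v g"
proof (induction f rule: superpoly_induct)
  case (const c)
  show ?case by (simp add: gl_act_const_mult)
next
  case (add f g)
  then show ?case by (simp add: gl_act_add twist_add distrib_right distrib_left)
next
  case (even e f)
  then show ?case
    by (simp add: mult.assoc gl_act_even_var_mult twist_even_var_mult distrib_left distrib_right)
next
  case (odd k i f)
  then show ?case
    by (simp add: mult.assoc gl_act_odd_var_mult twist_odd_var_mult distrib_left distrib_right)
qed

lemma gl_act_mult_even:
  "parity u = parity v \<Longrightarrow> gl_act m n u v (f * g) = gl_act m n u v f * g + f * gl_act m n u v g"
  by (simp add: gl_act_mult)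

lemma gl_act_sq:
  assumes "a \<in> bvecs m n" "b \<in> bvecs m n"
  shows "gl_act m n u v (sq a b) = act_sq u v a b"
proof (cases a; cases b)
  fix i j assume ab: "a = Bx i" "b = Bx j"
  show ?thesis
  proof (cases "i \<le> j")
    case True
    with ab assms show ?thesis by (simp add: xvar_def gl_act_even_var' evars_def min_def max_def)
  next
    case False
    with ab assms show ?thesis
      using act_sq_swap[of u v a b] by (simp add: xvar_def gl_act_even_var' evars_def min_def max_def)
  qed
next
  fix k l assume ab: "a = Bxi k" "b = Bxi l"
  consider "k < l" | "l < k" | "k = l" by linarith
  then show ?thesis
  proof cases
    case 1
    with ab assms show ?thesis by (simp add: yvar_def gl_act_even_var' evars_def)
  next
    case 2
    with ab assms show ?thesis
      using act_sq_swap[of u v b a] by (simp add: yvar_def gl_act_even_var' gl_act_uminus evars_def)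
  next
    case 3
    with ab show ?thesis using act_sq_odd_same[of a] by simp
  qed
next
  fix i k assume ab: "a = Bx i" "b = Bxi k"
  with assms show ?thesis
    using act_sq_swap[of u v a b] by (simp add: gl_act_odd_var' ovars_def)
next
  fix i k assume ab: "a = Bxi k" "b = Bx i"
  with assms show ?thesis by (simp add: gl_act_odd_var' ovars_def)
qed

subsection \<open>Commutators\<close>

lemma gl_act_act_sq_comm:
  assumes p: "parity u = parity v"
    and r: "u \<in> bvecs m n" "v \<in> bvecs m n" "u' \<in> bvecs m n" "v' \<in> bvecs m n" "a \<in> bvecs m n" "b \<in> bvecs m n"
  shows "gl_act m n u v (act_sq u' v' a b) - gl_act m n u' v' (act_sq u v a b)
    = (if v = u' then act_sq u v' a b else 0) - (if v' = u then act_sq u' v a b else 0)"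
proof -
  have if0: "gl_act m n x y (if P then z else 0) = (if P then gl_act m n x y z else 0)" for x y P z by simp
  have sg: "gl_act m n x y ((- 1) ^ k * z) = (- 1) ^ k * gl_act m n x y z" for x y k z
    by (induction k) (simp_all add: gl_act_uminus)
  have pp: "(- 1 :: superpoly) ^ ((parity v + parity v) * k) = 1" for k
    by (simp add: power_mult flip: mult_2)
  have L1: "act_sq u v x y = (if x = v then sq u y else 0) + (if y = v then sq x u else 0)" for x y
    by (simp add: act_sq_def p pp)
  define t :: "bvec \<Rightarrow> superpoly" where "t x = (- 1) ^ ((parity u' + parity v') * parity x)" for x
  have t: "t u = t v" by (simp add: t_def p)
  have gt: "gl_act m n x y (t w * z) = t w * gl_act m n x y z" for x y z w by (simp add: t_def sg)
  have L2: "act_sq u' v' x y = (if x = v' then sq u' y else 0) + t x * (if y = v' then sq x u' else 0)" for x y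
    by (simp add: act_sq_def t_def)
  have A1: "gl_act m n u v (act_sq u' v' a b)
      = (if a = v' then act_sq u v u' b else 0) + t a * (if b = v' then act_sq u v a u' else 0)"
    unfolding L2 gl_act_add if0 gt using r by (simp add: gl_act_sq)
  have A2: "gl_act m n u' v' (act_sq u v a b)
      = (if a = v then act_sq u' v' u b else 0) + (if b = v then act_sq u' v' a u else 0)"
    unfolding L1 gl_act_add if0 using r by (simp add: gl_act_sq)
  have R1: "(if v = u' then act_sq u v' a b else 0)
      = (if v = u' \<and> a = v' then sq u b else 0) + t a * (if v = u' \<and> b = v' then sq a u else 0)"
    by (simp add: act_sq_def t_def p)
  have R2: "(if v' = u then act_sq u' v a b else 0)
      = (if v' = u \<and> a = v then sq u' b else 0) + t a * (if v' = u \<and> b = v then sq a u' else 0)"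
    by (simp add: act_sq_def t_def p)
  show ?thesis
    unfolding A1 A2 R1 R2 unfolding L1 L2 using t
    by (cases "a = v"; cases "b = v"; cases "a = v'"; cases "b = v'"; cases "v = u'"; cases "v' = u";
        simp add: distrib_left)
qed

text \<open>
  With an even first operator, the superbracket is the ordinary commutator.  Both sides are superderivations of
  the same parity, so they agree because they agree on products of two basis vectors.
\<close>

theorem gl_act_commutator:
  assumes p: "parity u = parity v"
    and r: "u \<in> bvecs m n" "v \<in> bvecs m n" "u' \<in> bvecs m n" "v' \<in> bvecs m n"
  shows "gl_act m n u v (gl_act m n u' v' f) - gl_act m n u' v' (gl_act m n u v f)
    = (if v = u' then gl_act m n u v' f else 0) - (if v' = u then gl_act m n u' v f else 0)"
    (is "?L f = ?R f")
proof (induction f rule: superpoly_induct)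
  case (const c)
  show ?case by simp
next
  case (add f g)
  have "?L (f + g) = ?L f + ?L g" by (simp add: gl_act_add algebra_simps)
  also have "\<dots> = ?R f + ?R g" unfolding add.IH ..
  also have "\<dots> = ?R (f + g)" by (simp add: gl_act_add algebra_simps)
  finally show ?case .
next
  case (even e f)
  have v: "?L (even_var e) = ?R (even_var e)"
  proof (cases "e \<in> evars m n")
    case True
    obtain a b where ab: "a \<in> bvecs m n" "b \<in> bvecs m n" "\<And>x y. act_evar x y e = act_sq x y a b"
    proof (cases e)
      case (XX i j)
      with True show ?thesis by (intro that[of "Bx i" "Bx j"]) (auto simp: evars_def)
    next
      case (YY k l)
      with True show ?thesis by (intro that[of "Bxi k" "Bxi l"]) (auto simp: evars_def)
    qed
    with gl_act_act_sq_comm[OF p r ab(1,2)] True show ?thesis by (simp add: gl_act_even_var')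
  qed (simp add: gl_act_even_var')
  have tw: "twist (gl_act m n u v (even_var e)) = gl_act m n u v (even_var e)"
    using p by (simp add: gl_act_even_var' twist_act_evar)
  have "?L (even_var e * f) = ?L (even_var e) * f + even_var e * ?L f"
    by (simp add: gl_act_even_var_mult gl_act_add gl_act_mult p tw algebra_simps)
  also have "\<dots> = ?R (even_var e) * f + even_var e * ?R f" unfolding v even.IH ..
  also have "\<dots> = ?R (even_var e * f)" by (simp add: gl_act_even_var_mult algebra_simps)
  finally show ?case .
next
  case (odd k i f)
  have v: "?L (odd_var k i) = ?R (odd_var k i)"
  proof (cases "(k, i) \<in> ovars m n")
    case True
    then have ab: "Bxi k \<in> bvecs m n" "Bx i \<in> bvecs m n" by (auto simp: ovars_def)
    with gl_act_act_sq_comm[OF p r ab(1,2)] True show ?thesis by (simp add: gl_act_odd_var')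
  qed (simp add: gl_act_odd_var')
  have tw: "twist (gl_act m n u v (odd_var k i)) = - gl_act m n u v (odd_var k i)"
    using p by (simp add: gl_act_odd_var' twist_act_ovar del: act_ovar.simps)
  let ?s = "if parity u' = parity v' then odd_var k i else - odd_var k i"
  have "?L (odd_var k i * f) = ?L (odd_var k i) * f + ?s * ?L f"
    by (simp add: gl_act_odd_var_mult gl_act_add gl_act_uminus gl_act_mult p tw algebra_simps)
  also have "\<dots> = ?R (odd_var k i) * f + ?s * ?R f" unfolding v odd.IH ..
  also have "\<dots> = ?R (odd_var k i * f)"
    using p by (simp add: gl_act_odd_var_mult algebra_simps)
  finally show ?case .
qed

section \<open>Subalgebras and division\<close>

lemma even_deriv_mult: "even_deriv e (f * g) = even_deriv e f * g + f * even_deriv e g"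
proof (induction f rule: superpoly_induct)
  case (even e' f)
  then show ?case by (simp add: mult.assoc even_deriv_even_var_mult distrib_left distrib_right)
next
  case (odd k i f)
  then show ?case by (simp add: mult.assoc even_deriv_odd_var_mult distrib_left)
qed (simp_all add: even_deriv_const_mult even_deriv_add distrib_left distrib_right)

lemma odd_deriv_mult: "odd_deriv q (f * g :: superpoly) = odd_deriv q f * g + twist f * odd_deriv q g"
proof (induction f rule: superpoly_induct)
  case (even e' f)
  then show ?case by (simp add: mult.assoc odd_deriv_even_var_mult twist_even_var_mult distrib_left)
next
  case (odd k i f)
  then show ?case by (simp add: mult.assoc odd_deriv_odd_var_mult twist_odd_var_mult distrib_left distrib_right left_diff_distrib)
qed (simp_all add: odd_deriv_const_mult odd_deriv_add twist_add distrib_left distrib_right)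

lemma SS_iff_cf:
  "f \<in> SS m n \<longleftrightarrow> (\<forall>S \<alpha>. cf f S \<alpha> \<noteq> 0 \<longrightarrow> S \<subseteq> ovars m n \<and> keys \<alpha> \<subseteq> evars m n)"
proof -
  have nz: "ext_coeff f S \<noteq> 0 \<longleftrightarrow> (\<exists>\<alpha>. cf f S \<alpha> \<noteq> 0)" for S
    unfolding cf_def by (metis lookup_zero poly_mapping_eqI)
  show ?thesis unfolding SS_def mem_Collect_eq nz cf_def lookup_not_eq_zero_eq_in_keys by blast
qed

text \<open>
  In characteristic zero, not containing a variable means having derivative zero with respect to it.  This form of the
  definition is stable under products and under division.
\<close>

lemma SS_iff_deriv:
  "f \<in> SS m n \<longleftrightarrow> (\<forall>e. e \<notin> evars m n \<longrightarrow> even_deriv e f = 0) \<and> (\<forall>q. q \<notin> ovars m n \<longrightarrow> odd_deriv q f = 0)"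
proof
  assume f: "f \<in> SS m n"
  have "even_deriv e f = 0" if e: "e \<notin> evars m n" for e
  proof (rule superpoly_eqI)
    fix S \<alpha>
    have "e \<in> keys (\<alpha> + single e (1::nat))" by (simp add: in_keys_iff lookup_add)
    then have "cf f S (\<alpha> + single e 1) = 0" using f e unfolding SS_iff_cf by blast
    then show "cf (even_deriv e f) S \<alpha> = cf 0 S \<alpha>" by (simp only: cf_even_deriv cf_zero) simp
  qed
  moreover have "odd_deriv q f = 0" if q: "q \<notin> ovars m n" for q
  proof (rule superpoly_eqI)
    fix S \<alpha>
    have "cf f (insert q S) \<alpha> = 0" using f q unfolding SS_iff_cf by blast
    then show "cf (odd_deriv q f) S \<alpha> = cf 0 S \<alpha>" by (simp add: cf_odd_deriv)
  qed
  ultimately show "(\<forall>e. e \<notin> evars m n \<longrightarrow> even_deriv e f = 0) \<and> (\<forall>q. q \<notin> ovars m n \<longrightarrow> odd_deriv q f = 0)"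
    by blast
next
  assume a: "(\<forall>e. e \<notin> evars m n \<longrightarrow> even_deriv e f = 0) \<and> (\<forall>q. q \<notin> ovars m n \<longrightarrow> odd_deriv q f = 0)"
  show "f \<in> SS m n" unfolding SS_iff_cf
  proof (intro allI impI conjI subsetI)
    fix S \<alpha> q assume nz: "cf f S \<alpha> \<noteq> 0" and q: "q \<in> S"
    have "cf (odd_deriv q f) (S - {q}) \<alpha> \<noteq> 0" using nz q by (simp add: cf_odd_deriv insert_absorb)
    then show "q \<in> ovars m n" using a by fastforce
  next
    fix S \<alpha> e assume nz: "cf f S \<alpha> \<noteq> 0" and e: "e \<in> keys \<alpha>"
    then have "lookup \<alpha> e > 0" by (simp add: in_keys_iff)
    note sp = monomial_split[OF this]
    have "cf (even_deriv e f) S (\<alpha> - single e 1) \<noteq> 0"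
      unfolding cf_even_deriv sp[symmetric] using nz by (simp del: of_nat_add of_nat_Suc)
    then show "e \<in> evars m n" using a by fastforce
  qed
qed

lemma SS_const [simp]: "const c \<in> SS m n" by (simp add: SS_iff_deriv)
lemma SS_zero [simp]: "0 \<in> SS m n" using SS_const[of 0] by simp
lemma SS_one [simp]: "1 \<in> SS m n" using SS_const[of 1] by simp
lemma SS_add: "f \<in> SS m n \<Longrightarrow> g \<in> SS m n \<Longrightarrow> f + g \<in> SS m n"
  by (simp add: SS_iff_deriv even_deriv_add odd_deriv_add)
lemma SS_mult: "f \<in> SS m n \<Longrightarrow> g \<in> SS m n \<Longrightarrow> f * g \<in> SS m n"
  by (simp add: SS_iff_deriv even_deriv_mult odd_deriv_mult)
lemma SS_uminus: "f \<in> SS m n \<Longrightarrow> - f \<in> SS m n"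
  using SS_mult[OF SS_const[of "- 1"], of f] by (simp add: const_uminus)
lemma SS_diff: "f \<in> SS m n \<Longrightarrow> g \<in> SS m n \<Longrightarrow> f - g \<in> SS m n"
  using SS_add[of f m n "- g"] SS_uminus[of g] by simp
lemma SS_sum: "(\<And>x. x \<in> A \<Longrightarrow> f x \<in> SS m n) \<Longrightarrow> sum f A \<in> SS m n"
  by (induction A rule: infinite_finite_induct) (auto intro: SS_add)
lemma SS_prod_list: "(\<And>x. x \<in> set xs \<Longrightarrow> f x \<in> SS m n) \<Longrightarrow> (\<Prod>x\<leftarrow>xs. f x) \<in> SS m n"
  by (induction xs) (auto intro: SS_mult)
lemma SS_of_int: "of_int k \<in> SS m n"
  by (metis SS_const const_eq_emb emb_of_int single_of_int)
lemma SS_even_var: "e \<in> evars m n \<Longrightarrow> even_var e \<in> SS m n"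
  using even_deriv_even_var_mult[of _ e "const 1"] odd_deriv_even_var_mult[of _ e "const 1"]
  by (auto simp: SS_iff_deriv simp del: const_one) (auto simp: mult_1_right)
lemma SS_odd_var: "(k, i) \<in> ovars m n \<Longrightarrow> odd_var k i \<in> SS m n"
  using even_deriv_odd_var_mult[of _ k i "const 1"] odd_deriv_odd_var_mult[of _ k i "const 1"]
  by (auto simp: SS_iff_deriv simp del: const_one) (auto simp: mult_1_right)
lemma SS_sq: "a \<in> bvecs m n \<Longrightarrow> b \<in> bvecs m n \<Longrightarrow> sq a b \<in> SS m n"
  by (cases a; cases b) (auto simp: xvar_def yvar_def evars_def ovars_def min_def max_def
      intro!: SS_even_var SS_odd_var SS_uminus)

lemma emb_mult_eq_0: "emb p * f = 0 \<longleftrightarrow> p = 0 \<or> f = 0"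
proof
  assume a: "emb p * f = 0"
  have "p * ext_coeff f S = 0" for S using arg_cong[OF a, of "\<lambda>x. ext_coeff x S"] by (simp add: ext_coeff_scalar_mult)
  then have "p = 0 \<or> (\<forall>S. ext_coeff f S = 0)" by (metis mult_eq_0_iff)
  then show "p = 0 \<or> f = 0" by (auto intro: ext_alg_eqI)
qed auto

text \<open>
  Multiplication by an even polynomial acts on each exterior coefficient separately, so nonzero
  even polynomials can be cancelled although the superalgebra has zero divisors.
\<close>

lemma emb_mult_cancel: "p \<noteq> 0 \<Longrightarrow> emb p * f = emb p * g \<Longrightarrow> f = g"
  using emb_mult_eq_0[of p "f - g"] by (simp add: right_diff_distrib)

lemma twist_emb [simp]: "twist (emb p) = emb p"
  by (rule superpoly_eqI) (auto simp: cf_twist, auto simp: cf_def ext_coeff_monom)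

text \<open>Dividing by an even polynomial does not introduce new variables, because the derivative with
  respect to a variable commutes with the division.\<close>

lemma SS_cancel:
  assumes "p \<noteq> 0" "emb p \<in> SS m n" "emb p * f \<in> SS m n"
  shows "f \<in> SS m n"
  unfolding SS_iff_deriv
proof (intro conjI allI impI)
  fix e assume "e \<notin> evars m n"
  then have "emb p * even_deriv e f = 0"
    using assms(2,3) unfolding SS_iff_deriv even_deriv_mult by simp
  then show "even_deriv e f = 0" using assms(1) by (simp add: emb_mult_eq_0)
next
  fix q assume "q \<notin> ovars m n"
  then have "emb p * odd_deriv q f = 0"
    using assms(2,3) unfolding SS_iff_deriv odd_deriv_mult by (cases q) simp
  then show "odd_deriv q f = 0" using assms(1) by (simp add: emb_mult_eq_0)
qed

section \<open>Singular vectors are determined by their diagonal part\<close>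

text \<open>
  Every positive root vector is an iterated commutator of simple ones, in such a way that one of the two operators is even
  at each step.
\<close>

lemma gl_act_comm_zero:
  assumes "parity u = parity v" "u \<in> bvecs m n" "v \<in> bvecs m n" "w \<in> bvecs m n" "u \<noteq> w"
    and "gl_act m n u v f = 0" "gl_act m n v w f = 0"
  shows "gl_act m n u w f = 0"
  using gl_act_commutator[of u v m n v w f] assms by simp

lemma gl_act_comm_zero':
  assumes "parity u = parity v" "u \<in> bvecs m n" "v \<in> bvecs m n" "w \<in> bvecs m n" "v \<noteq> w"
    and "gl_act m n u v f = 0" "gl_act m n w u f = 0"
  shows "gl_act m n w v f = 0"
  using gl_act_commutator[of u v m n w u f] assms by simp

lemma singular_xx:
  assumes "singular m n f" "1 \<le> i" "i < j" "j \<le> m"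
  shows "gl_act m n (Bx i) (Bx j) f = 0"
  using assms(3,4)
proof (induction j rule: less_induct)
  case (less j)
  show ?case
  proof (cases "j = i + 1")
    case True
    with less assms show ?thesis by (simp add: singular_def)
  next
    case False
    have k: "j = (j - 1) + 1" "i < j - 1" using less.prems False by auto
    then obtain k where k: "j = k + 1" "i < k" by blast
    have 1: "gl_act m n (Bx i) (Bx k) f = 0" by (rule less.IH) (use k less.prems in auto)
    have 2: "gl_act m n (Bx k) (Bx j) f = 0" using less.prems k(2) assms unfolding k(1) by (simp add: singular_def)
    show ?thesis
      by (rule gl_act_comm_zero[OF _ _ _ _ _ 1 2]) (use less.prems k(2) assms(2) in \<open>auto simp: k(1)\<close>)
  qed
qed

lemma singular_xixi:
  assumes "singular m n f" "1 \<le> i" "i < j" "j \<le> n"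
  shows "gl_act m n (Bxi i) (Bxi j) f = 0"
  using assms(3,4)
proof (induction j rule: less_induct)
  case (less j)
  show ?case
  proof (cases "j = i + 1")
    case True
    with less assms show ?thesis by (simp add: singular_def)
  next
    case False
    have k: "j = (j - 1) + 1" "i < j - 1" using less.prems False by auto
    then obtain k where k: "j = k + 1" "i < k" by blast
    have 1: "gl_act m n (Bxi i) (Bxi k) f = 0" by (rule less.IH) (use k less.prems in auto)
    have 2: "gl_act m n (Bxi k) (Bxi j) f = 0" using less.prems k(2) assms unfolding k(1) by (simp add: singular_def)
    show ?thesis
      by (rule gl_act_comm_zero[OF _ _ _ _ _ 1 2]) (use less.prems k(2) assms(2) in \<open>auto simp: k(1)\<close>)
  qed
qed

lemma singular_xxi:
  assumes "singular m n f" "1 \<le> i" "i \<le> m" "1 \<le> k" "k \<le> n"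
  shows "gl_act m n (Bx i) (Bxi k) f = 0"
proof -
  have 1: "gl_act m n (Bx m) (Bxi 1) f = 0" using assms by (simp add: singular_def)
  have 2: "gl_act m n (Bx i) (Bxi 1) f = 0"
  proof (cases "i = m")
    case False
    then have 0: "gl_act m n (Bx i) (Bx m) f = 0" using assms by (intro singular_xx) auto
    show ?thesis by (rule gl_act_comm_zero[OF _ _ _ _ _ 0 1]) (use assms in auto)
  qed (use 1 in simp)
  show ?thesis
  proof (cases "k = 1")
    case False
    then have 0: "gl_act m n (Bxi 1) (Bxi k) f = 0" using assms by (intro singular_xixi) auto
    show ?thesis by (rule gl_act_comm_zero'[OF _ _ _ _ _ 0 2]) (use assms False in auto)
  qed (use 2 in simp)
qed

text \<open>
  The diagonal variables are the \<open>x\<^sub>i\<^sub>i\<close> and the \<open>y\<close>'s of the standard symplectic pairs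
  \<open>(1, 2), (3, 4), \<dots>\<close>.  The filtration counts the other variables, even or odd.
\<close>

fun diag :: "evar \<Rightarrow> bool" where
  "diag (XX i j) \<longleftrightarrow> i = j"
| "diag (YY k l) \<longleftrightarrow> odd k \<and> l = Suc k"

definition ndeg :: "ovar set \<Rightarrow> (evar \<Rightarrow>\<^sub>0 nat) \<Rightarrow> nat" where
  "ndeg S \<alpha> = card S + monom_weight (\<lambda>e. if diag e then 0 else 1) \<alpha>"

definition fil :: "nat \<Rightarrow> superpoly \<Rightarrow> bool" where
  "fil d f \<longleftrightarrow> (\<forall>S \<alpha>. cf f S \<alpha> \<noteq> 0 \<longrightarrow> d \<le> ndeg S \<alpha>)"

definition raises :: "nat \<Rightarrow> superpoly \<Rightarrow> bool" where
  "raises j g \<longleftrightarrow> (\<forall>d f. fil d f \<longrightarrow> fil (d + j) (g * f))"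

lemma fil_zero [simp]: "fil d 0" by (simp add: fil_def)
lemma fil_add: "fil d f \<Longrightarrow> fil d g \<Longrightarrow> fil d (f + g)"
  unfolding fil_def by (metis add.right_neutral add_0 cf_add)
lemma fil_uminus [simp]: "fil d (- f) \<longleftrightarrow> fil d f" by (simp add: fil_def)
lemma fil_sum: "(\<And>x. x \<in> A \<Longrightarrow> fil d (f x)) \<Longrightarrow> fil d (sum f A)"
  by (induction A rule: infinite_finite_induct) (auto intro: fil_add)
lemma fil_mono: "fil d f \<Longrightarrow> d' \<le> d \<Longrightarrow> fil d' f"
  unfolding fil_def using le_trans by blast

lemma raises_zero [simp]: "raises j 0" by (simp add: raises_def)
lemma raises_uminus: "raises j g \<Longrightarrow> raises j (- g)" by (simp add: raises_def)
lemma raises_add: "raises j g \<Longrightarrow> raises j h \<Longrightarrow> raises j (g + h)"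
  by (simp add: raises_def distrib_right fil_add)
lemma raises_mono: "raises j g \<Longrightarrow> i \<le> j \<Longrightarrow> raises i g"
  unfolding raises_def using fil_mono add_left_mono by blast

lemma raises_even_var: "raises (if diag e then 0 else 1) (even_var e)"
  unfolding raises_def fil_def
proof (intro allI impI)
  fix d f S \<alpha> assume f: "\<forall>S \<alpha>. cf f S \<alpha> \<noteq> 0 \<longrightarrow> d \<le> ndeg S \<alpha>" and nz: "cf (even_var e * f) S \<alpha> \<noteq> 0"
  then have a: "lookup \<alpha> e > 0" "cf f S (\<alpha> - single e 1) \<noteq> 0"
    by (auto simp: cf_even_var_mult split: if_splits)
  let ?w = "\<lambda>e. if diag e then 0 else 1"
  have "monom_weight ?w \<alpha> = monom_weight ?w (\<alpha> - single e 1) + ?w e"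
    by (subst monomial_split[OF a(1)]) (simp only: monom_weight_add monom_weight_single mult_1_right)
  then have "ndeg S \<alpha> = ndeg S (\<alpha> - single e 1) + ?w e"
    unfolding ndeg_def by simp
  moreover have "d \<le> ndeg S (\<alpha> - single e 1)" using f a(2) by blast
  ultimately show "d + ?w e \<le> ndeg S \<alpha>" by simp
qed

lemma raises_odd_var: "raises 1 (odd_var k i)"
  unfolding raises_def fil_def
proof (intro allI impI)
  fix d f S \<alpha> assume f: "\<forall>S \<alpha>. cf f S \<alpha> \<noteq> 0 \<longrightarrow> d \<le> ndeg S \<alpha>" and nz: "cf (odd_var k i * f) S \<alpha> \<noteq> 0"
  then have a: "(k, i) \<in> S" "cf f (S - {(k, i)}) \<alpha> \<noteq> 0"
    by (auto simp: cf_odd_var_mult split: if_splits)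
  have "finite S" by (rule ccontr) (use a(2) cf_infinite[of "S - {(k, i)}" f \<alpha>] in auto)
  then have "card S = Suc (card (S - {(k, i)}))" using a(1) by (metis card_Suc_Diff1)
  then have "ndeg S \<alpha> = ndeg (S - {(k, i)}) \<alpha> + 1" by (simp only: ndeg_def)
  moreover have "d \<le> ndeg (S - {(k, i)}) \<alpha>" using f a(2) by blast
  ultimately show "d + 1 \<le> ndeg S \<alpha>" by simp
qed

lemma raises_sq_0: "raises 0 (sq a b)"
proof -
  have "raises 0 (even_var e)" for e using raises_even_var raises_mono by blast
  moreover have "raises 0 (odd_var k i)" for k i using raises_odd_var raises_mono by blast
  ultimately show ?thesis by (cases a; cases b) (auto simp: xvar_def yvar_def intro: raises_uminus)
qed

lemma raises_xvar: "i \<noteq> j \<Longrightarrow> raises 1 (xvar i j)"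
  using raises_even_var[of "XX (min i j) (max i j)"] by (simp add: xvar_def min_def max_def split: if_splits)

lemma raises_yvar: "\<not> (odd k \<and> l = Suc k) \<Longrightarrow> \<not> (odd l \<and> k = Suc l) \<Longrightarrow> raises 1 (yvar k l)"
  using raises_even_var[of "YY k l"] raises_even_var[of "YY l k"]
  by (auto simp: yvar_def intro: raises_uminus split: if_splits)

lemma raises_act_0: "raises 0 (act_evar u v e)" "raises 0 (act_ovar u v q)"
proof -
  have "raises 0 (act_sq u v a b)" for a b
  proof -
    have "raises 0 ((- 1) ^ k * sq a b)" for k a b
      by (induction k) (auto simp: raises_sq_0 intro: raises_uminus)
    then show ?thesis unfolding act_sq_def by (auto intro!: raises_add raises_sq_0)
  qed
  then show "raises 0 (act_evar u v e)" "raises 0 (act_ovar u v q)" by (cases e; cases q; simp)+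
qed

lemma fil_even_deriv: "fil d f \<Longrightarrow> fil (d - (if diag e then 0 else 1)) (even_deriv e f)"
  unfolding fil_def
proof (intro allI impI)
  fix S \<alpha> assume f: "\<forall>S \<alpha>. cf f S \<alpha> \<noteq> 0 \<longrightarrow> d \<le> ndeg S \<alpha>" and nz: "cf (even_deriv e f) S \<alpha> \<noteq> 0"
  have "cf f S (\<alpha> + single e 1) \<noteq> 0"
    using nz by (auto simp only: cf_even_deriv mult_eq_0_iff)
  then have "d \<le> ndeg S (\<alpha> + single e 1)" using f by blast
  also have "\<dots> = ndeg S \<alpha> + (if diag e then 0 else 1)"
    unfolding ndeg_def monom_weight_add monom_weight_single by simp
  finally show "d - (if diag e then 0 else 1) \<le> ndeg S \<alpha>" by simp
qed

lemma fil_odd_deriv: "fil d f \<Longrightarrow> fil (d - 1) (odd_deriv q f)"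
  unfolding fil_def
proof (intro allI impI)
  fix S \<alpha> assume f: "\<forall>S \<alpha>. cf f S \<alpha> \<noteq> 0 \<longrightarrow> d \<le> ndeg S \<alpha>" and nz: "cf (odd_deriv q f) S \<alpha> \<noteq> 0"
  have a: "q \<notin> S" "cf f (insert q S) \<alpha> \<noteq> 0"
    using nz by (auto simp: cf_odd_deriv split: if_splits)
  then have "finite S" using cf_infinite[of "insert q S" f \<alpha>] by auto
  have "d \<le> ndeg (insert q S) \<alpha>" using f a(2) by blast
  also have "\<dots> = ndeg S \<alpha> + 1" using \<open>finite S\<close> a(1) unfolding ndeg_def by simp
  finally show "d - 1 \<le> ndeg S \<alpha>" by simp
qed

lemma fil_even_var_cancel: "diag e \<Longrightarrow> fil d (even_var e * f) \<Longrightarrow> fil d f"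
  unfolding fil_def
proof (intro allI impI)
  fix S \<alpha> assume e: "diag e" and f: "\<forall>S \<alpha>. cf (even_var e * f) S \<alpha> \<noteq> 0 \<longrightarrow> d \<le> ndeg S \<alpha>" and nz: "cf f S \<alpha> \<noteq> 0"
  have "cf (even_var e * f) S (\<alpha> + single e 1) \<noteq> 0"
    using nz by (simp only: cf_even_var_mult lookup_add lookup_single_eq) simp
  then have "d \<le> ndeg S (\<alpha> + single e 1)" using f by blast
  also have "\<dots> = ndeg S \<alpha>" using e unfolding ndeg_def monom_weight_add by simp
  finally show "d \<le> ndeg S \<alpha>" .
qed

lemma fil_term_even:
  assumes "fil d f" "diag e \<or> raises 1 (act_evar u w e)"
  shows "fil d (act_evar u w e * even_deriv e f)"
proof (cases "diag e")
  case True
  then show ?thesis using fil_even_deriv[OF assms(1), of e] raises_act_0(1)[of u w e] by (auto simp: raises_def)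
next
  case False
  then have "fil (d - 1) (even_deriv e f)" using fil_even_deriv[OF assms(1), of e] by simp
  then have "fil (d - 1 + 1) (act_evar u w e * even_deriv e f)" using assms(2) False unfolding raises_def by blast
  then show ?thesis by (rule fil_mono) simp
qed

lemma fil_term_odd:
  assumes "fil d f" "raises 1 (act_ovar u w q)"
  shows "fil d (act_ovar u w q * odd_deriv q f)"
proof -
  have "fil (d - 1 + 1) (act_ovar u w q * odd_deriv q f)"
    using fil_odd_deriv[OF assms(1), of q] assms(2) unfolding raises_def by blast
  then show ?thesis by (rule fil_mono) simp
qed

text \<open>
  Of the terms of \<open>D f = 0\<close>, the one of a nondiagonal variable that \<open>D\<close> sends to a diagonal variable is
  known only to lie in step \<open>d - 1\<close> of the filtration.  As all other terms lie in step \<open>d\<close>, it does so too.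
\<close>

lemma fil_leading_even:
  assumes f: "fil d f" "gl_act m n u w f = 0" and e0: "e0 \<in> evars m n"
    and ev: "\<And>e. e \<in> evars m n \<Longrightarrow> e \<noteq> e0 \<Longrightarrow> diag e \<or> raises 1 (act_evar u w e)"
    and od: "\<And>q. q \<in> ovars m n \<Longrightarrow> raises 1 (act_ovar u w q)"
    and g: "act_evar u w e0 = even_var g \<or> act_evar u w e0 = - even_var g" "diag g"
  shows "fil d (even_deriv e0 f)"
proof -
  have "fil d (\<Sum>e\<in>evars m n - {e0}. act_evar u w e * even_deriv e f)"
    by (rule fil_sum, rule fil_term_even[OF f(1)]) (use ev in auto)
  moreover have "fil d (\<Sum>q\<in>ovars m n. act_ovar u w q * odd_deriv q f)"
    by (rule fil_sum, rule fil_term_odd[OF f(1)]) (use od in auto)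
  moreover have "act_evar u w e0 * even_deriv e0 f =
      - ((\<Sum>e\<in>evars m n - {e0}. act_evar u w e * even_deriv e f)
         + (\<Sum>q\<in>ovars m n. act_ovar u w q * odd_deriv q f))"
    by (rule eq_neg_iff_add_eq_0[THEN iffD2])
      (use f(2) e0 in \<open>simp add: gl_act_def sum.remove[of "evars m n" e0] add.assoc\<close>)
  ultimately have "fil d (act_evar u w e0 * even_deriv e0 f)" by (simp only: fil_uminus fil_add)
  then have "fil d (even_var g * even_deriv e0 f)" using g(1) by auto
  then show ?thesis by (rule fil_even_var_cancel[OF g(2)])
qed

lemma fil_leading_odd:
  assumes f: "fil d f" "gl_act m n u w f = 0" and q0: "q0 \<in> ovars m n"
    and ev: "\<And>e. e \<in> evars m n \<Longrightarrow> diag e \<or> raises 1 (act_evar u w e)"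
    and od: "\<And>q. q \<in> ovars m n \<Longrightarrow> q \<noteq> q0 \<Longrightarrow> raises 1 (act_ovar u w q)"
    and g: "act_ovar u w q0 = even_var g" "diag g"
  shows "fil d (odd_deriv q0 f)"
proof -
  have "fil d (\<Sum>e\<in>evars m n. act_evar u w e * even_deriv e f)"
    by (rule fil_sum, rule fil_term_even[OF f(1)]) (use ev in auto)
  moreover have "fil d (\<Sum>q\<in>ovars m n - {q0}. act_ovar u w q * odd_deriv q f)"
    by (rule fil_sum, rule fil_term_odd[OF f(1)]) (use od in auto)
  moreover have "act_ovar u w q0 * odd_deriv q0 f =
      - ((\<Sum>e\<in>evars m n. act_evar u w e * even_deriv e f)
         + (\<Sum>q\<in>ovars m n - {q0}. act_ovar u w q * odd_deriv q f))"
    by (rule eq_neg_iff_add_eq_0[THEN iffD2])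
      (use f(2) q0 in \<open>simp add: gl_act_def sum.remove[of "ovars m n" q0] add_ac\<close>)
  ultimately have "fil d (act_ovar u w q0 * odd_deriv q0 f)" by (simp only: fil_uminus fil_add)
  then have "fil d (even_var g * odd_deriv q0 f)" using g(1) by auto
  then show ?thesis by (rule fil_even_var_cancel[OF g(2)])
qed

text \<open>
  For \<open>x\<^sub>i\<^sub>j\<close> with \<open>i < j\<close>, the operator \<open>x\<^sub>i \<partial>/\<partial>x\<^sub>j\<close> sends \<open>x\<^sub>i\<^sub>j\<close> to \<open>x\<^sub>i\<^sub>i\<close> and no other variable off the diagonal to a diagonal one.
  For \<open>y\<^sub>k\<^sub>l\<close> off the diagonal, the same is true of \<open>\<xi>\<^sub>p \<partial>/\<partial>\<xi>\<^sub>l\<close>, where \<open>p\<close> is the partner of \<open>k\<close> in the standard symplectic pairs.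
\<close>

lemma singular_fil_even_deriv:
  assumes f: "singular m n f" "fil d f" and e0: "e0 \<in> evars m n" "\<not> diag e0"
  shows "fil d (even_deriv e0 f)"
proof (cases e0)
  case (XX i j)
  then have ij: "1 \<le> i" "i < j" "j \<le> m" using e0 by (auto simp: evars_def)
  show ?thesis
  proof (rule fil_leading_even[OF f(2) singular_xx[OF f(1) ij] e0(1)])
    fix e assume e: "e \<in> evars m n" "e \<noteq> e0"
    show "diag e \<or> raises 1 (act_evar (Bx i) (Bx j) e)"
    proof (cases e)
      case e': (XX p q)
      then show ?thesis using e ij XX
        by (auto simp: act_sq_def evars_def intro!: raises_add raises_xvar[unfolded One_nat_def])
    qed (simp add: act_sq_def)
  next
    fix q assume "q \<in> ovars m n"
    then show "raises 1 (act_ovar (Bx i) (Bx j) q)"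
      by (cases q) (use raises_odd_var in \<open>simp add: act_sq_def\<close>)
  next
    show "act_evar (Bx i) (Bx j) e0 = even_var (XX i i) \<or> act_evar (Bx i) (Bx j) e0 = - even_var (XX i i)"
      using XX ij by (simp add: act_sq_def xvar_def)
  qed simp
next
  case (YY k l)
  define p where "p = (if odd k then Suc k else k - 1)"
  have kl: "1 \<le> k" "k < l" "l \<le> n" "\<not> (odd k \<and> l = Suc k)" using e0 YY by (auto simp: evars_def)
  have p: "1 \<le> p" "p < l" using kl by (auto simp: p_def elim!: evenE)
  have kp: "yvar k p = even_var (YY k p) \<and> diag (YY k p) \<or> yvar k p = - even_var (YY p k) \<and> diag (YY p k)"
    using kl by (auto simp: p_def yvar_def)
  have pb: "raises 1 (yvar p b)" if "b \<noteq> k" "1 \<le> b" for b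
  proof (cases "odd k")
    case True
    then have "p = Suc k" by (simp add: p_def)
    then show ?thesis using True that by (intro raises_yvar) auto
  next
    case False
    then obtain c where "k = Suc c" "p = c" using kl(1) by (cases k) (auto simp: p_def)
    then show ?thesis using False that by (intro raises_yvar) auto
  qed
  have bp: "raises 1 (yvar b p)" if "b \<noteq> k" "1 \<le> b" for b
    using raises_uminus[OF pb[OF that]] yvar_anticommute[of b p] by simp
  show ?thesis
  proof (rule fil_leading_even[OF f(2) singular_xixi[OF f(1) p(1,2) kl(3)] e0(1)])
    fix e assume e: "e \<in> evars m n" "e \<noteq> e0"
    show "diag e \<or> raises 1 (act_evar (Bxi p) (Bxi l) e)"
    proof (cases e)
      case e': (YY a b)
      then show ?thesis using e kl YY
        by (auto simp: act_sq_def evars_def intro!: raises_add pb[unfolded One_nat_def] bp[unfolded One_nat_def])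
    qed (simp add: act_sq_def)
  next
    fix q assume "q \<in> ovars m n"
    then show "raises 1 (act_ovar (Bxi p) (Bxi l) q)"
      by (cases q) (use raises_odd_var in \<open>simp add: act_sq_def\<close>)
  next
    let ?g = "if odd k then YY k p else YY p k"
    show "diag ?g" using kl by (auto simp: p_def)
    show "act_evar (Bxi p) (Bxi l) e0 = even_var ?g \<or> act_evar (Bxi p) (Bxi l) e0 = - even_var ?g"
      using YY kl kp by (auto simp: act_sq_def yvar_def p_def)
  qed
qed

text \<open>
  Here \<open>x\<^sub>i \<partial>/\<partial>\<xi>\<^sub>k\<close> sends \<open>\<eta>\<^sub>k\<^sub>i\<close> to \<open>x\<^sub>i\<^sub>i\<close>, and no other variable to a diagonal one.
\<close>

lemma singular_fil_odd_deriv: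
  assumes f: "singular m n f" "fil d f" and q0: "q0 \<in> ovars m n"
  shows "fil d (odd_deriv q0 f)"
proof -
  obtain k i where q: "q0 = (k, i)" by (cases q0)
  then have ki: "1 \<le> i" "i \<le> m" "1 \<le> k" "k \<le> n" using q0 by (auto simp: ovars_def)
  have od: "raises 1 (odd_var a b)" for a b by (rule raises_odd_var)
  show ?thesis
  proof (rule fil_leading_odd[OF f(2) singular_xxi[OF f(1) ki] q0])
    fix e assume "e \<in> evars m n"
    then show "diag e \<or> raises 1 (act_evar (Bx i) (Bxi k) e)"
      by (cases e) (auto simp: act_sq_def evars_def intro!: raises_add raises_uminus od[unfolded One_nat_def])
  next
    fix q' assume "q' \<in> ovars m n" "q' \<noteq> q0"
    then show "raises 1 (act_ovar (Bx i) (Bxi k) q')"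
      using q by (cases q') (auto simp: act_sq_def intro!: raises_xvar[unfolded One_nat_def])
  next
    show "act_ovar (Bx i) (Bxi k) q0 = even_var (XX i i)"
      using q by (simp add: act_sq_def xvar_def)
  qed simp
qed

text \<open>
  Suppose that all monomials of \<open>f\<close> have at least \<open>d\<close> nondiagonal factors.  The derivative of \<open>f\<close> with respect to a nondiagonal variable
  then has the same property, though one factor has been removed; so no monomial has exactly \<open>d\<close> of them, unless
  \<open>d = 0\<close>, where the monomials in question are diagonal and absent by assumption.  Hence \<open>d\<close> can be increased forever.
\<close>

theorem singular_eq_0:
  assumes SS: "f \<in> SS m n" and sing: "singular m n f"
    and d0: "\<And>\<alpha>. keys \<alpha> \<subseteq> Collect diag \<Longrightarrow> cf f {} \<alpha> = 0"
  shows "f = 0"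
proof -
  have fil: "fil d f" for d
  proof (induction d)
    case 0
    show ?case by (simp add: fil_def)
  next
    case (Suc d)
    show ?case unfolding fil_def
    proof (intro allI impI, rule ccontr)
      fix S \<alpha> assume nz: "cf f S \<alpha> \<noteq> 0" and "\<not> Suc d \<le> ndeg S \<alpha>"
      then have eq: "ndeg S \<alpha> = d" using Suc unfolding fil_def by (metis le_antisym not_less_eq_eq)
      have fS: "finite S" using nz cf_infinite by blast
      have sub: "S \<subseteq> ovars m n" "keys \<alpha> \<subseteq> evars m n" using SS nz unfolding SS_iff_cf by blast+
      show False
      proof (cases "S = {} \<and> keys \<alpha> \<subseteq> Collect diag")
        case True
        then show False using d0 nz by blast
      next
        case False
        then consider q where "q \<in> S" | e where "e \<in> keys \<alpha>" "\<not> diag e" by blast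
        then show False
        proof cases
          case (1 q)
          have "cf (odd_deriv q f) (S - {q}) \<alpha> \<noteq> 0" using nz 1 by (simp add: cf_odd_deriv insert_absorb)
          moreover have "fil d (odd_deriv q f)" using singular_fil_odd_deriv[OF sing Suc] sub 1 by blast
          ultimately have "d \<le> ndeg (S - {q}) \<alpha>" unfolding fil_def by blast
          moreover have "card S = Suc (card (S - {q}))" using fS 1 by (metis card_Suc_Diff1)
          ultimately show False using eq unfolding ndeg_def by linarith
        next
          case (2 e)
          then have "lookup \<alpha> e > 0" by (simp add: in_keys_iff)
          note sp = monomial_split[OF this]
          have "cf (even_deriv e f) S (\<alpha> - single e 1) \<noteq> 0"
            unfolding cf_even_deriv sp[symmetric] using nz by (simp del: of_nat_add of_nat_Suc)
          moreover have "fil d (even_deriv e f)" using singular_fil_even_deriv[OF sing Suc] sub 2 by blast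
          ultimately have "d \<le> ndeg S (\<alpha> - single e 1)" unfolding fil_def by blast
          moreover have "ndeg S \<alpha> = ndeg S (\<alpha> - single e 1) + 1"
            using 2 by (subst sp) (simp add: ndeg_def monom_weight_add)
          ultimately show False using eq by linarith
        qed
      qed
    qed
  qed
  show ?thesis
  proof (rule superpoly_eqI)
    fix S \<alpha>
    show "cf f S \<alpha> = cf 0 S \<alpha>" using fil[of "Suc (ndeg S \<alpha>)"] unfolding fil_def by fastforce
  qed
qed

section \<open>Weights\<close>

text \<open>
  The eigenvalue of a Cartan operator \<open>b \<partial>/\<partial>b\<close> on a monomial is the number of times \<open>b\<close> occurs
  in it.  Weights of polynomials are therefore natural numbers.
\<close>

fun evar_mult :: "bvec \<Rightarrow> evar \<Rightarrow> nat" where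
  "evar_mult b (XX i j) = of_bool (b = Bx i) + of_bool (b = Bx j)"
| "evar_mult b (YY k l) = of_bool (b = Bxi k) + of_bool (b = Bxi l)"

fun ovar_mult :: "bvec \<Rightarrow> ovar \<Rightarrow> nat" where
  "ovar_mult b (k, i) = of_bool (b = Bxi k) + of_bool (b = Bx i)"

definition mono_mult :: "nat \<Rightarrow> nat \<Rightarrow> bvec \<Rightarrow> ovar set \<Rightarrow> (evar \<Rightarrow>\<^sub>0 nat) \<Rightarrow> nat" where
  "mono_mult m n b S \<alpha> =
     (\<Sum>e\<in>evars m n. evar_mult b e * lookup \<alpha> e) + (\<Sum>q\<in>ovars m n \<inter> S. ovar_mult b q)"

lemma const_two: "const 2 = 2"
  using const_of_nat[of 2] by simp

lemma const_eq_0_iff [simp]: "const c = 0 \<longleftrightarrow> c = 0"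
  using cf_const[of c "{}" 0] by auto

lemma act_evar_self: "e \<in> evars m n \<Longrightarrow> act_evar b b e = const (of_nat (evar_mult b e)) * even_var e"
  by (cases e; cases b) (auto simp: act_sq_def evars_def xvar_def yvar_def const_of_nat const_two min_def max_def power_mult
      simp flip: mult_2)

lemma act_ovar_self: "act_ovar b b (k, i) = const (of_nat (ovar_mult b (k, i))) * odd_var k i"
  by (cases b) (auto simp: act_sq_def const_of_nat)

lemma cf_euler_even: "cf (even_var e * even_deriv e f) S \<alpha> = of_nat (lookup \<alpha> e) * cf f S \<alpha>"
proof (cases "lookup \<alpha> e > 0")
  case True
  then show ?thesis using monomial_split[OF True]
    by (simp only: cf_even_var_mult cf_even_deriv if_True flip: monomial_split[OF True])
      (simp add: lookup_minus)
qed (simp add: cf_even_var_mult)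

lemma cf_euler_odd: "cf (odd_var k i * odd_deriv (k, i) f) S \<alpha> = (if (k, i) \<in> S then cf f S \<alpha> else 0)"
proof -
  have "{s \<in> S - {(k, i)}. s < (k, i)} = {s \<in> S. s < (k, i)}" by auto
  then show ?thesis
    by (simp add: cf_odd_var_mult cf_odd_deriv insert_absorb flip: mult.assoc power_add mult_2)
qed

lemma cf_gl_act_self: "cf (gl_act m n b b f) S \<alpha> = of_nat (mono_mult m n b S \<alpha>) * cf f S \<alpha>"
proof -
  have 1: "cf (act_evar b b e * even_deriv e f) S \<alpha>
      = of_nat (evar_mult b e * lookup \<alpha> e) * cf f S \<alpha>" if "e \<in> evars m n" for e
    unfolding act_evar_self[OF that] by (simp add: mult.assoc cf_euler_even)
  have 2: "cf (act_ovar b b q * odd_deriv q f) S \<alpha>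
      = of_nat (if q \<in> S then ovar_mult b q else 0) * cf f S \<alpha>" for q
  proof (cases q)
    case (Pair k i)
    show ?thesis unfolding Pair act_ovar_self by (simp add: mult.assoc cf_euler_odd del: ovar_mult.simps)
  qed
  have "cf (gl_act m n b b f) S \<alpha>
      = (\<Sum>e\<in>evars m n. of_nat (evar_mult b e * lookup \<alpha> e) * cf f S \<alpha>)
        + (\<Sum>q\<in>ovars m n. of_nat (if q \<in> S then ovar_mult b q else 0) * cf f S \<alpha>)"
    unfolding gl_act_def cf_add cf_sum 2 by (simp add: 1 del: of_nat_mult)
  also have "\<dots> = of_nat ((\<Sum>e\<in>evars m n. evar_mult b e * lookup \<alpha> e)
        + (\<Sum>q\<in>ovars m n. if q \<in> S then ovar_mult b q else 0)) * cf f S \<alpha>"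
    by (simp only: of_nat_add of_nat_sum distrib_right sum_distrib_right)
  also have "(\<Sum>q\<in>ovars m n. if q \<in> S then ovar_mult b q else 0) = (\<Sum>q\<in>ovars m n \<inter> S. ovar_mult b q)"
    by (simp add: sum.inter_restrict)
  finally show ?thesis unfolding mono_mult_def .
qed

text \<open>A weight is taken as a function on all basis vectors, so that even and odd indices are treated alike.\<close>

definition weight_vec :: "nat \<Rightarrow> nat \<Rightarrow> (bvec \<Rightarrow> complex) \<Rightarrow> superpoly \<Rightarrow> bool" where
  "weight_vec m n W f \<longleftrightarrow> (\<forall>b\<in>bvecs m n. gl_act m n b b f = const (W b) * f)"

lemma has_weight_iff: "has_weight m n a b f \<longleftrightarrow> weight_vec m n (case_bvec a b) f"
  by (auto simp: has_weight_def weight_vec_def bvecs_def)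

definition hwv :: "nat \<Rightarrow> nat \<Rightarrow> (bvec \<Rightarrow> complex) \<Rightarrow> superpoly \<Rightarrow> bool" where
  "hwv m n W f \<longleftrightarrow> f \<in> SS m n \<and> f \<noteq> 0 \<and> singular m n f \<and> weight_vec m n W f"

lemma HW_iff: "f \<in> HW m n \<longleftrightarrow> (\<exists>W. hwv m n W f)"
proof -
  have "(\<exists>a b. has_weight m n a b f) \<longleftrightarrow> (\<exists>W. weight_vec m n W f)"
  proof
    assume "\<exists>W. weight_vec m n W f"
    then obtain W where W: "weight_vec m n W f" by blast
    have "case_bvec (\<lambda>i. W (Bx i)) (\<lambda>j. W (Bxi j)) = W" by (auto split: bvec.splits)
    then show "\<exists>a b. has_weight m n a b f" using W unfolding has_weight_iff by metis
  qed (auto simp: has_weight_iff)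
  then show ?thesis by (auto simp: HW_def hwv_def)
qed

lemma hwvD: "hwv m n W f \<Longrightarrow> f \<in> SS m n" "hwv m n W f \<Longrightarrow> f \<noteq> 0"
    "hwv m n W f \<Longrightarrow> singular m n f" "hwv m n W f \<Longrightarrow> weight_vec m n W f"
  by (auto simp: hwv_def)

lemma weight_vec_cong: "(\<And>b. b \<in> bvecs m n \<Longrightarrow> W b = W' b) \<Longrightarrow> weight_vec m n W f \<longleftrightarrow> weight_vec m n W' f"
  by (auto simp: weight_vec_def)

lemma hwv_cong: "hwv m n W f \<Longrightarrow> (\<And>b. b \<in> bvecs m n \<Longrightarrow> W b = W' b) \<Longrightarrow> hwv m n W' f"
  unfolding hwv_def using weight_vec_cong[of m n W W' f] by auto

lemma weight_vec_mono_mult: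
  assumes "weight_vec m n W f" "cf f S \<alpha> \<noteq> 0" "b \<in> bvecs m n"
  shows "W b = of_nat (mono_mult m n b S \<alpha>)"
proof -
  have "of_nat (mono_mult m n b S \<alpha>) * cf f S \<alpha> = W b * cf f S \<alpha>"
    using assms(1,3) unfolding weight_vec_def by (metis cf_const_mult cf_gl_act_self)
  then show ?thesis using assms(2) by simp
qed

lemma hwv_unique_weight:
  assumes "hwv m n W f" "hwv m n W' f" "b \<in> bvecs m n"
  shows "W b = W' b"
proof -
  obtain S \<alpha> where "cf f S \<alpha> \<noteq> 0" using hwvD(2)[OF assms(1)] superpoly_eqI[of f 0] by auto
  then show ?thesis using weight_vec_mono_mult assms hwvD(4) by metis
qed

text \<open>
  If \<open>n\<close> is odd, \<open>\<xi>\<^sub>n\<close> has no partner; its value here is not a variable of the algebra, so its exponent in a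
  monomial of the algebra is zero, and so is the weight of \<open>\<xi>\<^sub>n\<close> on a diagonal monomial.
\<close>

fun diag_var :: "bvec \<Rightarrow> evar" where
  "diag_var (Bx i) = XX i i"
| "diag_var (Bxi k) = (if odd k then YY k (Suc k) else YY (k - 1) k)"

lemma evar_mult_diag:
  assumes "e \<in> evars m n" "diag e" "b \<in> bvecs m n"
  shows "evar_mult b e = (if e = diag_var b then (case b of Bx i \<Rightarrow> 2 | Bxi j \<Rightarrow> 1) else 0)"
  using assms by (cases e; cases b) (auto simp: evars_def elim!: oddE)

lemma mono_mult_diag:
  assumes "keys \<alpha> \<subseteq> evars m n \<inter> Collect diag" "b \<in> bvecs m n"
  shows "mono_mult m n b {} \<alpha> = (case b of Bx i \<Rightarrow> 2 | Bxi j \<Rightarrow> 1) * lookup \<alpha> (diag_var b)"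
proof -
  let ?c = "case b of Bx i \<Rightarrow> 2 | Bxi j \<Rightarrow> 1"
  have "mono_mult m n b {} \<alpha> = (\<Sum>e\<in>evars m n. evar_mult b e * lookup \<alpha> e)"
    by (simp add: mono_mult_def)
  also have "\<dots> = (\<Sum>e\<in>evars m n. if e = diag_var b then ?c * lookup \<alpha> e else 0)"
  proof (rule sum.cong)
    fix e assume e: "e \<in> evars m n"
    show "evar_mult b e * lookup \<alpha> e = (if e = diag_var b then ?c * lookup \<alpha> e else 0)"
    proof (cases "diag e")
      case True
      then show ?thesis using evar_mult_diag[OF e True assms(2)] by simp
    next
      case False
      then have "lookup \<alpha> e = 0" using assms(1) by (auto simp: in_keys_iff)
      then show ?thesis by auto
    qed
  qed simp
  also have "\<dots> = ?c * lookup \<alpha> (diag_var b)"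
  proof (cases "diag_var b \<in> evars m n")
    case False
    then have "diag_var b \<notin> keys \<alpha>" using assms(1) by blast
    then show ?thesis using False by (simp add: in_keys_iff)
  qed simp
  finally show ?thesis .
qed

lemma diag_var_ex:
  assumes "e \<in> evars m n" "diag e"
  shows "\<exists>b\<in>bvecs m n. e = diag_var b"
proof (cases e)
  case (XX i j)
  then show ?thesis using assms by (intro bexI[of _ "Bx i"]) (auto simp: evars_def)
next
  case (YY k l)
  then show ?thesis using assms by (intro bexI[of _ "Bxi k"]) (auto simp: evars_def)
qed

text \<open>A singular weight vector contains exactly one diagonal monomial, and its weight determines which one.\<close>

lemma hwv_diag_monomial:
  assumes "hwv m n W f"
  obtains \<alpha> where "keys \<alpha> \<subseteq> evars m n \<inter> Collect diag" "cf f {} \<alpha> \<noteq> 0"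
    "\<And>b. b \<in> bvecs m n \<Longrightarrow> W b = (case b of Bx i \<Rightarrow> 2 | Bxi j \<Rightarrow> 1) * of_nat (lookup \<alpha> (diag_var b))"
proof -
  note h = hwvD[OF assms]
  obtain \<alpha> where a: "keys \<alpha> \<subseteq> Collect diag" "cf f {} \<alpha> \<noteq> 0"
    using singular_eq_0[OF h(1,3)] h(2) by blast
  have "keys \<alpha> \<subseteq> evars m n" using h(1) a(2) unfolding SS_iff_cf by blast
  then have k: "keys \<alpha> \<subseteq> evars m n \<inter> Collect diag" using a(1) by blast
  show ?thesis
  proof (rule that[OF k a(2)])
    fix b assume b: "b \<in> bvecs m n"
    show "W b = (case b of Bx i \<Rightarrow> 2 | Bxi j \<Rightarrow> 1) * of_nat (lookup \<alpha> (diag_var b))"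
      using weight_vec_mono_mult[OF h(4) a(2) b] mono_mult_diag[OF k b] by (cases b) simp_all
  qed
qed

lemma diag_monomial_unique:
  assumes "keys \<alpha> \<subseteq> evars m n \<inter> Collect diag" "keys \<beta> \<subseteq> evars m n \<inter> Collect diag"
    and "\<And>b. b \<in> bvecs m n \<Longrightarrow> mono_mult m n b {} \<alpha> = mono_mult m n b {} \<beta>"
  shows "\<alpha> = \<beta>"
proof (rule poly_mapping_eqI)
  fix e
  show "lookup \<alpha> e = lookup \<beta> e"
  proof (cases "e \<in> evars m n \<and> diag e")
    case True
    then obtain b where b: "b \<in> bvecs m n" "e = diag_var b" using diag_var_ex by blast
    then show ?thesis using assms(3)[OF b(1)] mono_mult_diag[OF assms(1) b(1)] mono_mult_diag[OF assms(2) b(1)]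
      by (cases b) simp_all
  next
    case False
    then have "e \<notin> keys \<alpha>" "e \<notin> keys \<beta>" using assms by auto
    then show ?thesis by (simp add: in_keys_iff)
  qed
qed

lemma singular_diff: "singular m n f \<Longrightarrow> singular m n g \<Longrightarrow> singular m n (f - g)"
  by (simp add: singular_def gl_act_diff)
lemma singular_const_mult: "singular m n f \<Longrightarrow> singular m n (const c * f)"
  by (simp add: singular_def gl_act_const_mult)
lemma singular_mult: "singular m n f \<Longrightarrow> singular m n g \<Longrightarrow> singular m n (f * g)"
  by (simp add: singular_def gl_act_mult)

text \<open>The right linear combination of the two vectors has no diagonal monomial left.\<close>

theorem hwv_proportional:
  assumes f: "hwv m n W f" and g: "hwv m n W g"
  obtains c where "c \<noteq> 0" "f = const c * g"
proof -
  obtain \<alpha> where a: "keys \<alpha> \<subseteq> evars m n \<inter> Collect diag" "cf f {} \<alpha> \<noteq> 0"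
    by (rule hwv_diag_monomial[OF f])
  obtain \<beta> where b: "keys \<beta> \<subseteq> evars m n \<inter> Collect diag" "cf g {} \<beta> \<noteq> 0"
    by (rule hwv_diag_monomial[OF g])
  have uniq: "\<gamma> = \<gamma>'" if "keys \<gamma> \<subseteq> Collect diag" "keys \<gamma>' \<subseteq> Collect diag"
    "cf h {} \<gamma> \<noteq> 0" "cf h' {} \<gamma>' \<noteq> 0" "hwv m n W h" "hwv m n W h'" for \<gamma> \<gamma>' h h'
  proof (rule diag_monomial_unique)
    show "keys \<gamma> \<subseteq> evars m n \<inter> Collect diag" "keys \<gamma>' \<subseteq> evars m n \<inter> Collect diag"
      using that hwvD(1)[OF that(5)] hwvD(1)[OF that(6)] unfolding SS_iff_cf by blast+
    fix b assume "b \<in> bvecs m n"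
    then show "mono_mult m n b {} \<gamma> = mono_mult m n b {} \<gamma>'"
      using weight_vec_mono_mult[OF hwvD(4)[OF that(5)] that(3)] weight_vec_mono_mult[OF hwvD(4)[OF that(6)] that(4)]
      by (metis of_nat_eq_iff)
  qed
  have ab: "\<beta> = \<alpha>" using uniq[of \<beta> \<alpha> g f] a b f g by blast
  define c where "c = cf f {} \<alpha> / cf g {} \<alpha>"
  have c: "c \<noteq> 0" "cf f {} \<alpha> = c * cf g {} \<alpha>" using a b ab by (simp_all add: c_def)
  have "f - const c * g = 0"
  proof (rule singular_eq_0)
    show "f - const c * g \<in> SS m n" by (intro SS_diff SS_mult SS_const hwvD(1)[OF f] hwvD(1)[OF g])
    show "singular m n (f - const c * g)"
      by (intro singular_diff singular_const_mult hwvD(3)[OF f] hwvD(3)[OF g])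
    fix \<gamma> :: "evar \<Rightarrow>\<^sub>0 nat" assume \<gamma>: "keys \<gamma> \<subseteq> Collect diag"
    show "cf (f - const c * g) {} \<gamma> = 0"
    proof (cases "\<gamma> = \<alpha>")
      case True
      then show ?thesis using c by simp
    next
      case False
      have "cf f {} \<gamma> = 0" using uniq[of \<gamma> \<alpha> f f] \<gamma> a f False by blast
      moreover have "cf g {} \<gamma> = 0" using uniq[of \<gamma> \<alpha> g f] \<gamma> a f g False by blast
      ultimately show ?thesis by simp
    qed
  qed
  then show ?thesis using c(1) that by simp
qed

lemma ext_coeff_mult_body: "ext_coeff (f * g) {} = ext_coeff f {} * ext_coeff g {}"
  by (simp add: ext_coeff_mult)

text \<open>
  The diagonal monomial does not contain odd variables.  As bodies multiply in an integral domain, products of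
  highest weight vectors are not zero.
\<close>

lemma hwv_body: "hwv m n W f \<Longrightarrow> ext_coeff f {} \<noteq> 0"
  by (erule hwv_diag_monomial) (auto simp: cf_def)

lemma hwv_mult:
  assumes f: "hwv m n W f" and g: "hwv m n W' g"
  shows "hwv m n (\<lambda>b. W b + W' b) (f * g)"
  unfolding hwv_def
proof (intro conjI)
  show "f * g \<in> SS m n" by (intro SS_mult hwvD(1)[OF f] hwvD(1)[OF g])
  show "f * g \<noteq> 0" using ext_coeff_mult_body[of f g] hwv_body[OF f] hwv_body[OF g] by auto
  show "singular m n (f * g)" by (intro singular_mult hwvD(3)[OF f] hwvD(3)[OF g])
  show "weight_vec m n (\<lambda>b. W b + W' b) (f * g)"
    using hwvD(4)[OF f] hwvD(4)[OF g]
    by (auto simp: weight_vec_def gl_act_mult_even const_add distrib_right mult.assoc const_left_commute)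
qed

text \<open>
  The commutator of two elements has no part without odd variables, so in particular no diagonal monomial.
\<close>

lemma hwv_commute:
  assumes f: "hwv m n W f" and g: "hwv m n W' g"
  shows "f * g = g * f"
proof -
  have "f * g - g * f = 0"
  proof (rule singular_eq_0)
    show "f * g - g * f \<in> SS m n" by (intro SS_diff SS_mult hwvD(1)[OF f] hwvD(1)[OF g])
    show "singular m n (f * g - g * f)"
      by (intro singular_diff singular_mult hwvD(3)[OF f] hwvD(3)[OF g])
    show "cf (f * g - g * f) {} \<alpha> = 0" for \<alpha>
      by (simp add: cf_def ext_coeff_mult_body mult.commute)
  qed
  then show ?thesis by simp
qed

lemma hwv_const: "c \<noteq> 0 \<Longrightarrow> hwv m n (\<lambda>_. 0) (const c)"
  by (simp add: hwv_def singular_def weight_vec_def)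

lemma hwv_one: "hwv m n (\<lambda>_. 0) 1"
  using hwv_const[of 1] by simp

lemma hwv_const_mult: "hwv m n W f \<Longrightarrow> c \<noteq> 0 \<Longrightarrow> hwv m n W (const c * f)"
  using hwv_mult[OF hwv_const] by fastforce

lemma hwv_power: "hwv m n W f \<Longrightarrow> hwv m n (\<lambda>b. of_nat k * W b) (f ^ k)"
proof (induction k)
  case 0
  show ?case using hwv_one by simp
next
  case (Suc k)
  then have "hwv m n (\<lambda>b. W b + of_nat k * W b) (f * f ^ k)" by (intro hwv_mult) auto
  then show ?case by (simp add: algebra_simps)
qed

lemma hwv_prod_list:
  "(\<And>x. x \<in> set xs \<Longrightarrow> hwv m n (w x) (F x)) \<Longrightarrow> hwv m n (\<lambda>b. \<Sum>x\<leftarrow>xs. w x b) (\<Prod>x\<leftarrow>xs. F x)"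
proof (induction xs)
  case Nil
  show ?case using hwv_one by simp
next
  case (Cons x xs)
  then show ?case using hwv_mult[of m n "w x" "F x" "\<lambda>b. \<Sum>x\<leftarrow>xs. w x b" "\<Prod>x\<leftarrow>xs. F x"] by simp
qed

lemma hwv_cancel:
  assumes d: "hwv m n W (emb p)" and df: "hwv m n W' (emb p * f)"
  shows "hwv m n (\<lambda>b. W' b - W b) f"
  unfolding hwv_def
proof (intro conjI)
  have p: "p \<noteq> 0" using hwvD(2)[OF d] by auto
  note cancel = emb_mult_cancel[OF p]
  show "f \<in> SS m n" using SS_cancel[OF p hwvD(1)[OF d] hwvD(1)[OF df]] .
  show "f \<noteq> 0" using hwvD(2)[OF df] by auto
  have "gl_act m n u v f = 0" if "gl_act m n u v (emb p) = 0" "gl_act m n u v (emb p * f) = 0" for u v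
  proof -
    have "emb p * gl_act m n u v f = 0" using that by (simp add: gl_act_mult split: if_splits)
    then show ?thesis using p by (simp add: emb_mult_eq_0)
  qed
  then show "singular m n f"
    using hwvD(3)[OF d] hwvD(3)[OF df] unfolding singular_def by blast
  show "weight_vec m n (\<lambda>b. W' b - W b) f"
    unfolding weight_vec_def
  proof
    fix b assume b: "b \<in> bvecs m n"
    have "const (W b) * emb p * f + emb p * gl_act m n b b f = const (W' b) * (emb p * f)"
      using hwvD(4)[OF d] hwvD(4)[OF df] b unfolding weight_vec_def by (metis gl_act_mult_even)
    then have "emb p * gl_act m n b b f = emb p * (const (W' b - W b) * f)"
      by (simp add: const_diff left_diff_distrib right_diff_distrib mult.assoc const_left_commute eq_diff_eq add.commute)
    then show "gl_act m n b b f = const (W' b - W b) * f" by (rule cancel)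
  qed
qed

section \<open>Dominance\<close>

text \<open>
  The representation theory of \<open>sl\<^sub>2\<close>: with \<open>F\<^sup>k f\<close> the last nonzero vector in the string of lowerings of \<open>f\<close>,
  the relation \<open>E F\<^sup>k\<^sup>+\<^sup>1 f = (k + 1) (A - B - k) F\<^sup>k f\<close> gives \<open>A - B = k\<close>.  The string is finite since the
  weights of polynomials are non-negative.
\<close>

lemma dominant_weight:
  assumes uv: "u \<in> bvecs m n" "v \<in> bvecs m n" "u \<noteq> v" "parity u = parity v"
    and f: "f \<noteq> 0" "gl_act m n u v f = 0"
    and A: "gl_act m n u u f = const A * f" and B: "gl_act m n v v f = const B * f"
  shows "\<exists>k. A = B + of_nat k"
proof -
  let ?E = "gl_act m n u v" and ?F = "gl_act m n v u"
  define g where "g k = (?F ^^ k) f" for k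
  have g0: "g 0 = f" and gS: "g (Suc k) = ?F (g k)" for k by (simp_all add: g_def)
  have Hu: "gl_act m n u u (g k) = const (A - of_nat k) * g k" for k
  proof (induction k)
    case (Suc k)
    have "gl_act m n u u (?F (g k)) - ?F (gl_act m n u u (g k)) = - ?F (g k)"
      using gl_act_commutator[of u u m n v u "g k"] uv by simp
    then have "gl_act m n u u (g (Suc k)) = ?F (gl_act m n u u (g k)) - g (Suc k)"
      by (simp add: gS algebra_simps)
    also have "\<dots> = const (A - of_nat k) * g (Suc k) - g (Suc k)"
      unfolding Suc gl_act_const_mult gS ..
    also have "\<dots> = const (A - of_nat (Suc k)) * g (Suc k)"
      by (simp add: const_diff const_add algebra_simps)
    finally show ?case .
  qed (simp add: g0 A)
  have Hv: "gl_act m n v v (g k) = const (B + of_nat k) * g k" for k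
  proof (induction k)
    case (Suc k)
    have "gl_act m n v v (?F (g k)) - ?F (gl_act m n v v (g k)) = ?F (g k)"
      using gl_act_commutator[of v v m n v u "g k"] uv by simp
    then have "gl_act m n v v (g (Suc k)) = ?F (gl_act m n v v (g k)) + g (Suc k)"
      by (simp add: gS algebra_simps)
    also have "\<dots> = const (B + of_nat k) * g (Suc k) + g (Suc k)"
      unfolding Suc gl_act_const_mult gS ..
    also have "\<dots> = const (B + of_nat (Suc k)) * g (Suc k)"
      by (simp add: const_add algebra_simps)
    finally show ?case .
  qed (simp add: g0 B)
  have EF: "?E (?F (g k)) = ?F (?E (g k)) + const (A - B - 2 * of_nat k) * g k" for k
  proof -
    have "?E (?F (g k)) - ?F (?E (g k)) = gl_act m n u u (g k) - gl_act m n v v (g k)"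
      using gl_act_commutator[of u v m n v u "g k"] uv by simp
    then have "?E (?F (g k)) = ?F (?E (g k)) + (gl_act m n u u (g k) - gl_act m n v v (g k))"
      by (simp add: algebra_simps)
    also have "gl_act m n u u (g k) - gl_act m n v v (g k) = const (A - B - 2 * of_nat k) * g k"
      unfolding Hu Hv by (simp flip: left_diff_distrib const_diff add: algebra_simps)
    finally show ?thesis .
  qed
  have E: "?E (g (Suc k)) = const ((of_nat k + 1) * (A - B - of_nat k)) * g k" for k
  proof (induction k)
    case 0
    show ?case using EF[of 0] f(2) by (simp add: gS g0)
  next
    case (Suc k)
    have "?E (g (Suc (Suc k))) = ?F (?E (g (Suc k))) + const (A - B - 2 * of_nat (Suc k)) * g (Suc k)"
      using EF[of "Suc k"] by (simp only: gS)
    also have "\<dots> = const ((of_nat k + 1) * (A - B - of_nat k) + (A - B - 2 * of_nat (Suc k))) * g (Suc k)"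
      unfolding Suc gl_act_const_mult gS[symmetric] const_add by (simp only: distrib_right)
    also have "(of_nat k + 1) * (A - B - of_nat k) + (A - B - 2 * of_nat (Suc k))
        = (of_nat (Suc k) + 1) * (A - B - of_nat (Suc k))"
      by (simp add: algebra_simps)
    finally show ?case .
  qed
  have nn: "\<exists>j. A - of_nat k = of_nat j" if "g k \<noteq> 0" for k
  proof -
    obtain S \<alpha> where nz: "cf (g k) S \<alpha> \<noteq> 0" using \<open>g k \<noteq> 0\<close> superpoly_eqI[of "g k" 0] by auto
    have "of_nat (mono_mult m n u S \<alpha>) * cf (g k) S \<alpha> = (A - of_nat k) * cf (g k) S \<alpha>"
      using Hu[of k] by (metis cf_const_mult cf_gl_act_self)
    then show ?thesis using nz by (metis mult_right_cancel)
  qed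
  obtain a where a: "A = of_nat a" using nn[of 0] f(1) by (auto simp: g0)
  have "g (Suc a) = 0"
  proof (rule ccontr)
    assume "g (Suc a) \<noteq> 0"
    then obtain j where "A - of_nat (Suc a) = (of_nat j :: complex)" using nn by blast
    then have "of_nat (Suc j) = (A - of_nat (Suc a)) + 1" by simp
    also have "\<dots> = 0" unfolding a by simp
    finally show False by (simp only: of_nat_eq_0_iff)
  qed
  \<comment> \<open>the position of the last nonzero vector in the string\<close>
  define k where "k = (LEAST k. g (Suc k) = 0)"
  have k0: "g (Suc k) = 0" unfolding k_def by (rule LeastI) (rule \<open>g (Suc a) = 0\<close>)
  have kn: "g k \<noteq> 0"
  proof (cases k)
    case 0
    then show ?thesis using f g0 by simp
  next
    case (Suc j)
    then show ?thesis using not_less_Least[of j "\<lambda>k. g (Suc k) = 0"] k_def by auto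
  qed
  have "const ((of_nat k + 1) * (A - B - of_nat k)) * g k = 0" using E[of k] k0 by simp
  then have "(of_nat k + 1) * (A - B - of_nat k) = 0"
    using kn unfolding const_eq_emb emb_mult_eq_0 by (metis lookup_single_eq lookup_zero)
  moreover have "(of_nat k + 1 :: complex) \<noteq> 0" by (metis of_nat_Suc of_nat_neq_0 add.commute)
  ultimately have "A - B - of_nat k = 0" by (simp only: mult_eq_0_iff) simp
  then have "A = B + of_nat k" by (simp add: algebra_simps)
  then show ?thesis ..
qed

lemma hwv_dominant:
  assumes f: "hwv m n W f"
  shows "1 \<le> i \<Longrightarrow> i < m \<Longrightarrow> \<exists>k. W (Bx i) = W (Bx (i + 1)) + of_nat k"
    and "1 \<le> j \<Longrightarrow> j < n \<Longrightarrow> \<exists>k. W (Bxi j) = W (Bxi (j + 1)) + of_nat k"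
proof -
  note h = hwvD[OF f]
  show "\<exists>k. W (Bx i) = W (Bx (i + 1)) + of_nat k" if "1 \<le> i" "i < m"
    using that h(3,4) by (intro dominant_weight[of "Bx i" m n "Bx (i + 1)" f] h(2))
      (auto simp: singular_def weight_vec_def)
  show "\<exists>k. W (Bxi j) = W (Bxi (j + 1)) + of_nat k" if "1 \<le> j" "j < n"
    using that h(3,4) by (intro dominant_weight[of "Bxi j" m n "Bxi (j + 1)" f] h(2))
      (auto simp: singular_def weight_vec_def)
qed

section \<open>Determinants\<close>

definition pdet :: "nat \<Rightarrow> (nat \<Rightarrow> nat \<Rightarrow> 'r::comm_ring_1) \<Rightarrow> 'r" where
  "pdet r A = (\<Sum>\<tau> | \<tau> permutes {1..r}. of_int (sign \<tau>) * (\<Prod>i = 1..r. A i (\<tau> i)))"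

definition cofactor :: "nat \<Rightarrow> (nat \<Rightarrow> nat \<Rightarrow> 'r::comm_ring_1) \<Rightarrow> nat \<Rightarrow> nat \<Rightarrow> 'r" where
  "cofactor r A i q =
     (\<Sum>\<tau> | \<tau> permutes {1..r} \<and> \<tau> i = q. of_int (sign \<tau>) * (\<Prod>p\<in>{1..r} - {i}. A p (\<tau> p)))"

lemma finite_permutes [simp]: "finite {\<tau>. \<tau> permutes {1..r::nat}}"
  by (simp add: finite_permutations)

lemma sum_over_permutes_row:
  assumes i: "i \<in> {1..r::nat}"
  shows "(\<Sum>\<tau> | \<tau> permutes {1..r}. F \<tau>) = (\<Sum>q = 1..r. \<Sum>\<tau> | \<tau> permutes {1..r} \<and> \<tau> i = q. F \<tau>)"
proof -
  have "(\<Sum>q = 1..r. \<Sum>\<tau> | \<tau> \<in> {\<tau>. \<tau> permutes {1..r}} \<and> \<tau> i = q. F \<tau>) = (\<Sum>\<tau>\<in>{\<tau>. \<tau> permutes {1..r}}. F \<tau>)"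
    by (rule sum.group[OF finite_permutes finite_atLeastAtMost])
      (use i in \<open>auto simp: permutes_in_image simp del: atLeastAtMost_iff One_nat_def\<close>)
  then show ?thesis by simp
qed

lemma sum_row_cofactor:
  assumes i: "i \<in> {1..r}"
  shows "(\<Sum>q = 1..r. a q * cofactor r A i q) = pdet r (\<lambda>p q. if p = i then a q else A p q)"
proof -
  let ?B = "\<lambda>p q. if p = i then a q else A p q"
  have "(\<Prod>p = 1..r. ?B p (\<tau> p)) = a (\<tau> i) * (\<Prod>p\<in>{1..r} - {i}. A p (\<tau> p))" for \<tau>
  proof -
    have "(\<Prod>p = 1..r. ?B p (\<tau> p)) = ?B i (\<tau> i) * (\<Prod>p\<in>{1..r} - {i}. ?B p (\<tau> p))"
      by (rule prod.remove[OF finite_atLeastAtMost i])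
    also have "(\<Prod>p\<in>{1..r} - {i}. ?B p (\<tau> p)) = (\<Prod>p\<in>{1..r} - {i}. A p (\<tau> p))"
      by (rule prod.cong) auto
    finally show ?thesis by simp
  qed
  then have "pdet r ?B = (\<Sum>q = 1..r. \<Sum>\<tau> | \<tau> permutes {1..r} \<and> \<tau> i = q.
      of_int (sign \<tau>) * (a (\<tau> i) * (\<Prod>p\<in>{1..r} - {i}. A p (\<tau> p))))"
    unfolding pdet_def by (simp only: sum_over_permutes_row[OF i])
  also have "\<dots> = (\<Sum>q = 1..r. a q * cofactor r A i q)"
    unfolding cofactor_def sum_distrib_left by (intro sum.cong) (auto simp: mult_ac)
  finally show ?thesis by simp
qed

text \<open>Exchanging the two rows changes the sign of the determinant but not the matrix.\<close>

lemma pdet_equal_rows: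
  fixes A :: "nat \<Rightarrow> nat \<Rightarrow> 'r::{idom,ring_char_0}"
  assumes ij: "i \<in> {1..r}" "j \<in> {1..r}" "i \<noteq> j" and A: "A i = A j"
  shows "pdet r A = 0"
proof -
  let ?t = "transpose i j"
  have t: "?t permutes {1..r}" using ij by (intro permutes_swap_id)
  have At: "A (?t k) = A k" for k using A by (auto simp: transpose_def)
  have "pdet r A = (\<Sum>\<tau> | \<tau> permutes {1..r}. of_int (sign (\<tau> \<circ> ?t)) * (\<Prod>k = 1..r. A k ((\<tau> \<circ> ?t) k)))"
    unfolding pdet_def
    by (rule sum.reindex_bij_witness[where i = "\<lambda>\<tau>. \<tau> \<circ> ?t" and j = "\<lambda>\<tau>. \<tau> \<circ> ?t"])
      (auto simp: comp_assoc permutes_compose[OF t] simp del: One_nat_def)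
  also have "\<dots> = (\<Sum>\<tau> | \<tau> permutes {1..r}. - (of_int (sign \<tau>) * (\<Prod>k = 1..r. A k (\<tau> k))))"
  proof (rule sum.cong)
    fix \<tau> assume "\<tau> \<in> {\<tau>. \<tau> permutes {1..r}}"
    then have "permutation \<tau>" by (auto simp: permutation_permutes)
    then have s: "sign (\<tau> \<circ> ?t) = - sign \<tau>"
      using ij by (simp add: sign_compose permutation_swap_id sign_swap_id)
    have "(\<Prod>k = 1..r. A k (\<tau> k)) = (\<Prod>k = 1..r. A (?t k) (\<tau> (?t k)))"
      using permutes_imp_bij[OF t] by (intro prod.reindex_bij_betw[symmetric])
    then show "of_int (sign (\<tau> \<circ> ?t)) * (\<Prod>k = 1..r. A k ((\<tau> \<circ> ?t) k)) = - (of_int (sign \<tau>) * (\<Prod>k = 1..r. A k (\<tau> k)))"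
      by (simp add: s At)
  qed simp
  also have "\<dots> = - pdet r A" by (simp add: pdet_def sum_negf)
  finally show ?thesis by (simp add: eq_neg_iff_add_eq_0 flip: mult_2)
qed

lemma sum_row_cofactor_delta:
  fixes A :: "nat \<Rightarrow> nat \<Rightarrow> 'r::{idom,ring_char_0}"
  assumes i: "i \<in> {1..r}" "p \<in> {1..r}"
  shows "(\<Sum>q = 1..r. A p q * cofactor r A i q) = (if p = i then pdet r A else 0)"
proof (cases "p = i")
  case True
  have "(\<lambda>p q. if p = i then A i q else A p q) = A" by (auto simp: fun_eq_iff)
  then show ?thesis using True sum_row_cofactor[OF i(1), of "A i" A] by simp
next
  case False
  then have "pdet r (\<lambda>k q. if k = i then A p q else A k q) = 0"
    using i by (intro pdet_equal_rows[of i r p]) auto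
  then show ?thesis using False sum_row_cofactor[OF i(1), of "A p" A] by simp
qed

lemma cofactor_symmetric:
  assumes sym: "\<And>i j. A i j = A j i" and i: "i \<in> {1..r}" "q \<in> {1..r}"
  shows "cofactor r A i q = cofactor r A q i"
  unfolding cofactor_def
proof (rule sum.reindex_bij_witness[where i = "\<lambda>\<tau>. inv \<tau>" and j = "\<lambda>\<tau>. inv \<tau>"])
  fix \<tau> assume "\<tau> \<in> {\<tau>. \<tau> permutes {1..r} \<and> \<tau> i = q}"
  then have t: "\<tau> permutes {1..r}" "\<tau> i = q" by auto
  show "inv (inv \<tau>) = \<tau>" using t by (simp add: permutes_inv_inv)
  show "inv \<tau> \<in> {\<tau>. \<tau> permutes {1..r} \<and> \<tau> q = i}"
    using t permutes_inverses[OF t(1)] permutes_inv[OF t(1)] by auto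
  have "bij_betw \<tau> ({1..r} - {i}) ({1..r} - {q})"
    using permutes_imp_bij[OF t(1)] t i by (metis bij_betw_DiffI bij_betw_singletonI empty_subsetI insert_subset)
  then have "(\<Prod>p\<in>{1..r} - {q}. A p (inv \<tau> p)) = (\<Prod>p\<in>{1..r} - {i}. A (\<tau> p) (inv \<tau> (\<tau> p)))"
    by (rule prod.reindex_bij_betw[symmetric])
  also have "\<dots> = (\<Prod>p\<in>{1..r} - {i}. A p (\<tau> p))"
    using permutes_inverses(2)[OF t(1)] sym by simp
  finally show "of_int (sign (inv \<tau>)) * (\<Prod>p\<in>{1..r} - {q}. A p (inv \<tau> p))
      = of_int (sign \<tau>) * (\<Prod>p\<in>{1..r} - {i}. A p (\<tau> p))"
    using t(1) by (simp add: sign_inverse permutation_permutes exI[of _ "{1..r}"])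
next
  fix \<tau> assume "\<tau> \<in> {\<tau>. \<tau> permutes {1..r} \<and> \<tau> q = i}"
  then have t: "\<tau> permutes {1..r}" "\<tau> q = i" by auto
  show "inv (inv \<tau>) = \<tau>" using t by (simp add: permutes_inv_inv)
  show "inv \<tau> \<in> {\<tau>. \<tau> permutes {1..r} \<and> \<tau> i = q}"
    using t permutes_inverses[OF t(1)] permutes_inv[OF t(1)] by auto
qed

lemma cofactor_last: "cofactor (Suc r) A (Suc r) (Suc r) = pdet r A"
proof -
  have "\<tau> permutes {1..Suc r} \<and> \<tau> (Suc r) = Suc r \<longleftrightarrow> \<tau> permutes {1..r}" for \<tau>
  proof
    assume a: "\<tau> permutes {1..Suc r} \<and> \<tau> (Suc r) = Suc r"
    show "\<tau> permutes {1..r}"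
    proof (rule permutes_superset)
      show "\<tau> permutes {1..Suc r}" using a by blast
      fix x assume "x \<in> {1..Suc r} - {1..r}"
      then have "x = Suc r" by auto
      then show "\<tau> x = x" using a by simp
    qed
  next
    assume "\<tau> permutes {1..r}"
    then show "\<tau> permutes {1..Suc r} \<and> \<tau> (Suc r) = Suc r"
      by (auto intro: permutes_subset simp: permutes_not_in)
  qed
  moreover have "{1..Suc r} - {Suc r} = {1..r}" by auto
  ultimately show ?thesis by (simp add: cofactor_def pdet_def)
qed

text \<open>
  Operators that are odd do not preserve the even polynomials, so derivations take values in the superalgebra.
\<close>

definition derivation :: "(even_poly \<Rightarrow> superpoly) \<Rightarrow> bool" where
  "derivation d \<longleftrightarrow> (\<forall>p q. d (p + q) = d p + d q) \<and> (\<forall>p q. d (p * q) = d p * emb q + emb p * d q)"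

lemma derivation_gl_act: "derivation (\<lambda>p. gl_act m n u v (emb p))"
  by (simp add: derivation_def emb_add emb_mult gl_act_add gl_act_mult)
lemma derivation_even_deriv: "derivation (\<lambda>p. even_deriv e (emb p))"
  by (simp add: derivation_def emb_add emb_mult even_deriv_add even_deriv_mult)

context
  fixes d :: "even_poly \<Rightarrow> superpoly"
  assumes d: "derivation d"
begin

lemma derivation_add: "d (p + q) = d p + d q" using d by (simp add: derivation_def)
lemma derivation_mult: "d (p * q) = d p * emb q + emb p * d q" using d by (simp add: derivation_def)
lemma derivation_zero: "d 0 = 0" using derivation_add[of 0 0] by simp
lemma derivation_one: "d 1 = 0" using derivation_mult[of 1 1] by simp
lemma derivation_uminus: "d (- p) = - d p"
  using derivation_add[of p "- p"] derivation_zero by (simp add: eq_neg_iff_add_eq_0 add.commute)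
lemma derivation_diff: "d (p - q) = d p - d q"
  using derivation_add[of p "- q"] by (simp add: derivation_uminus)
lemma derivation_sum: "d (sum f A) = (\<Sum>x\<in>A. d (f x))"
  by (induction A rule: infinite_finite_induct) (auto simp: derivation_add derivation_zero)
lemma derivation_of_int: "d (of_int k) = 0"
  by (induction k rule: int_induct[where k = 0]) (auto simp: derivation_add derivation_diff derivation_zero derivation_one)

lemma derivation_prod:
  "finite A \<Longrightarrow> d (prod f A) = (\<Sum>k\<in>A. d (f k) * emb (\<Prod>i\<in>A - {k}. f i))"
proof (induction A rule: finite_induct)
  case empty
  show ?case by (simp add: derivation_one)
next
  case (insert a A)
  have 1: "(\<Prod>i\<in>insert a A - {k}. f i) = f a * (\<Prod>i\<in>A - {k}. f i)" if "k \<in> A" for k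
  proof -
    have "insert a A - {k} = insert a (A - {k})" using that insert by auto
    then show ?thesis using insert by simp
  qed
  have 2: "insert a A - {a} = A" using insert by auto
  have "(\<Sum>k\<in>insert a A. d (f k) * emb (\<Prod>i\<in>insert a A - {k}. f i))
      = d (f a) * emb (prod f A) + (\<Sum>k\<in>A. d (f k) * emb (f a * (\<Prod>i\<in>A - {k}. f i)))"
    using insert 2 1 by simp
  also have "\<dots> = d (f a) * emb (prod f A) + emb (f a) * d (prod f A)"
    unfolding insert.IH sum_distrib_left emb_mult by (simp add: emb_left_commute)
  finally show ?case using insert by (simp add: derivation_mult)
qed

text \<open>A determinant is linear in each entry, with the cofactor as coefficient.\<close>

lemma derivation_pdet:
  "d (pdet r A) = (\<Sum>k = 1..r. \<Sum>q = 1..r. d (A k q) * emb (cofactor r A k q))"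
proof -
  have "d (pdet r A) = (\<Sum>\<tau> | \<tau> permutes {1..r}. \<Sum>k = 1..r.
      emb (of_int (sign \<tau>)) * (d (A k (\<tau> k)) * emb (\<Prod>i\<in>{1..r} - {k}. A i (\<tau> i))))"
    unfolding pdet_def derivation_sum derivation_mult derivation_of_int
    by (simp add: derivation_prod sum_distrib_left)
  also have "\<dots> = (\<Sum>k = 1..r. \<Sum>\<tau> | \<tau> permutes {1..r}.
      emb (of_int (sign \<tau>)) * (d (A k (\<tau> k)) * emb (\<Prod>i\<in>{1..r} - {k}. A i (\<tau> i))))"
    by (rule sum.swap)
  also have "\<dots> = (\<Sum>k = 1..r. \<Sum>q = 1..r. d (A k q) * emb (cofactor r A k q))"
  proof (rule sum.cong)
    fix k assume k: "k \<in> {1..r}"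
    show "(\<Sum>\<tau> | \<tau> permutes {1..r}. emb (of_int (sign \<tau>)) * (d (A k (\<tau> k)) * emb (\<Prod>i\<in>{1..r} - {k}. A i (\<tau> i))))
        = (\<Sum>q = 1..r. d (A k q) * emb (cofactor r A k q))"
      unfolding sum_over_permutes_row[OF k] cofactor_def emb_sum sum_distrib_left emb_mult
      by (intro sum.cong) (auto simp: emb_left_commute)
  qed simp
  finally show ?thesis .
qed

end

subsection \<open>The generic symmetric matrix\<close>

definition xp :: "nat \<Rightarrow> nat \<Rightarrow> even_poly" where
  "xp i j = pvar (XX (min i j) (max i j))"

abbreviation detX :: "nat \<Rightarrow> even_poly" where "detX r \<equiv> pdet r xp"
abbreviation cofX :: "nat \<Rightarrow> nat \<Rightarrow> nat \<Rightarrow> even_poly" where "cofX r \<equiv> cofactor r xp"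

lemma emb_xp: "emb (xp i j) = xvar i j"
  by (simp add: xp_def xvar_def even_var_eq_emb)
lemma twist_xvar [simp]: "twist (xvar i j) = xvar i j"
  by (simp flip: emb_xp)
lemma xp_commute: "xp i j = xp j i"
  by (simp add: xp_def min.commute max.commute)

lemma prod_list_interval: "(\<Prod>i\<leftarrow>[1..<r + 1]. f i) = (\<Prod>i = 1..r. f i :: 'r::comm_monoid_mult)"
  by (induction r) (simp_all add: mult.commute)

lemma Delta_eq_emb: "Delta r = emb (detX r)"
proof -
  have "(\<Prod>i\<leftarrow>[1..<r + 1]. xvar i (\<tau> i)) = emb (\<Prod>i = 1..r. xp i (\<tau> i))" for \<tau>
    unfolding prod_list_interval[symmetric] emb_prod_list emb_xp ..
  then show ?thesis
    unfolding Delta_def sdet_def pdet_def emb_sum emb_mult emb_of_int by simp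
qed

lemma detX_row_eq:
  assumes i: "i \<in> {1..m}"
  shows "detX_row m i k = (\<Sum>q = 1..m. emb (cofX m i q) * odd_var k q)"
proof -
  have "(\<Prod>p\<leftarrow>xs. if p = i then odd_var k (\<tau> p) else xvar p (\<tau> p))
      = emb (\<Prod>p\<in>set xs - {i}. xp p (\<tau> p)) * (if i \<in> set xs then odd_var k (\<tau> i) else 1)" if "distinct xs" for xs \<tau>
    using that
  proof (induction xs)
    case (Cons x xs)
    then have IH: "(\<Prod>p\<leftarrow>xs. if p = i then odd_var k (\<tau> p) else xvar p (\<tau> p))
      = emb (\<Prod>p\<in>set xs - {i}. xp p (\<tau> p)) * (if i \<in> set xs then odd_var k (\<tau> i) else 1)" by simp
    show ?case
    proof (cases "x = i")
      case True
      then have "set (x # xs) - {i} = set xs - {i}" "i \<notin> set xs" using Cons(2) by auto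
      then show ?thesis using True by (simp add: IH emb_central[of "odd_var k (\<tau> i)"])
    next
      case False
      then have "set (x # xs) - {i} = insert x (set xs - {i})" "x \<notin> set xs - {i}" using Cons(2) by auto
      then show ?thesis using False by (simp add: IH emb_mult emb_xp mult.assoc)
    qed
  qed simp
  note gen = this
  have sm: "set [1..<m + 1] = {1..m}" by auto
  have e: "(\<Prod>p\<leftarrow>[1..<m + 1]. if p = i then odd_var k (\<tau> p) else xvar p (\<tau> p))
      = emb (\<Prod>p\<in>{1..m} - {i}. xp p (\<tau> p)) * odd_var k (\<tau> i)" for \<tau>
    using gen[of "[1..<m + 1]" \<tau>] i by (simp only: sm distinct_upt if_True simp_thms)
  show ?thesis
    unfolding detX_row_def sdet_def cofactor_def emb_sum sum_distrib_right
    unfolding e sum_over_permutes_row[OF i]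
    by (intro sum.cong) (auto simp: emb_mult emb_of_int mult.assoc)
qed

lemma row_cofX:
  assumes "i \<in> {1..r}" "p \<in> {1..r}"
  shows "(\<Sum>q = 1..r. xvar p q * emb (cofX r i q)) = (if p = i then emb (detX r) else 0)"
proof -
  have "(\<Sum>q = 1..r. xvar p q * emb (cofX r i q)) = emb (\<Sum>q = 1..r. xp p q * cofX r i q)"
    by (simp add: emb_sum emb_mult emb_xp)
  then show ?thesis using sum_row_cofactor_delta[OF assms, of xp] by simp
qed

lemma cofX_commute: "i \<in> {1..r} \<Longrightarrow> q \<in> {1..r} \<Longrightarrow> cofX r i q = cofX r q i"
  by (rule cofactor_symmetric) (rule xp_commute)

lemma even_deriv_xp:
  "even_deriv (XX a b) (emb (xp i j)) = of_bool (a = min i j \<and> b = max i j)"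
  using even_deriv_even_var_mult[of "XX a b" "XX (min i j) (max i j)" "const 1"]
  by (simp add: emb_xp xvar_def even_deriv_const[of _ 1, unfolded const_one])

lemma even_deriv_detX:
  "even_deriv (XX (Suc r) (Suc r)) (emb (detX (Suc r))) = emb (detX r)"
proof -
  have "even_deriv (XX (Suc r) (Suc r)) (emb (detX (Suc r)))
      = (\<Sum>k = 1..Suc r. \<Sum>q = 1..Suc r. of_bool (Suc r = min k q \<and> Suc r = max k q) * emb (cofX (Suc r) k q))"
    by (simp only: derivation_pdet[OF derivation_even_deriv] even_deriv_xp)
  also have "\<dots> = (\<Sum>k = 1..Suc r. \<Sum>q = 1..Suc r. if k = Suc r then if q = Suc r then emb (cofX (Suc r) k q) else 0 else 0)"
    by (intro sum.cong) (auto simp: min_def max_def)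
  also have "\<dots> = (\<Sum>k = 1..Suc r. if k = Suc r then emb (cofX (Suc r) k (Suc r)) else 0)"
    by (intro sum.cong) (auto simp: sum.delta)
  also have "\<dots> = emb (detX r)"
    by (simp add: sum.delta cofactor_last del: sum.cl_ivl_Suc)
  finally show ?thesis .
qed

lemma detX_0 [simp]: "pdet 0 A = 1"
  by (simp add: pdet_def)

lemma detX_nonzero: "detX r \<noteq> 0"
proof (induction r)
  case (Suc r)
  then show ?case using even_deriv_detX[of r] even_deriv_const_mult[of "XX (Suc r) (Suc r)" 0 0] by (metis const_zero emb_eq_0_iff ext_monom_zero mult_zero_left)
qed simp

text \<open>
  The generic symmetric matrix becomes invertible when its determinant is inverted.  Identities between cofactors
  are proved below by multiplying them with the matrix, where they reduce to \<open>X adj X = det X\<close>.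
\<close>

lemma X_injective:
  assumes Z: "\<And>p. p \<in> {1..r} \<Longrightarrow> (\<Sum>i = 1..r. xvar p i * Z i) = 0" and j: "j \<in> {1..r}"
  shows "Z j = 0"
proof -
  have "0 = (\<Sum>p = 1..r. emb (cofX r j p) * (\<Sum>i = 1..r. xvar p i * Z i))"
    using Z by simp
  also have "\<dots> = (\<Sum>i = 1..r. \<Sum>p = 1..r. (xvar i p * emb (cofX r j p)) * Z i)"
    unfolding sum_distrib_left
    by (subst sum.swap) (intro sum.cong refl, simp add: mult.assoc[symmetric] emb_central xvar_commute)
  also have "\<dots> = (\<Sum>i = 1..r. (if i = j then emb (detX r) else 0) * Z i)"
    unfolding sum_distrib_right[symmetric] by (intro sum.cong refl) (simp only: row_cofX[OF j])
  also have "\<dots> = emb (detX r) * Z j"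
    using j by (simp add: if_distrib[of "\<lambda>x. x * _"] sum.delta cong: if_cong)
  finally show ?thesis using detX_nonzero[of r] by (simp add: emb_mult_eq_0)
qed

section \<open>The action on minors and cofactors\<close>

lemma gl_act_xvar_x:
  assumes "k \<in> {1..m}" "q \<in> {1..m}"
  shows "gl_act m n (Bx a) (Bx b) (xvar k q) = of_bool (b = k) * xvar a q + of_bool (b = q) * xvar k a"
  using gl_act_sq[of "Bx k" m n "Bx q" "Bx a" "Bx b"] assms by (auto simp: act_sq_def)

lemma gl_act_xvar_xi:
  assumes "k \<in> {1..m}" "q \<in> {1..m}"
  shows "gl_act m n u (Bxi b) (xvar k q) = 0"
  using gl_act_sq[of "Bx k" m n "Bx q" u "Bxi b"] assms by (auto simp: act_sq_def)

lemma sum_of_bool_mult: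
  "finite A \<Longrightarrow> (\<Sum>k\<in>A. of_bool (b = k) * (f k :: 'r::semiring_1)) = (if b \<in> A then f b else 0)"
  by (simp add: of_bool_def if_distrib[of "\<lambda>x. x * _"] sum.delta' cong: if_cong)

text \<open>
  The operator replaces the row \<open>b\<close>, and likewise the column \<open>b\<close>, by the one with index \<open>a\<close>.  For \<open>a \<noteq> b\<close> the resulting
  determinants have two equal rows or columns, provided that \<open>a\<close> is an index of the minor.
\<close>

lemma gl_act_detX_x:
  assumes r: "r \<le> m" and a: "a \<le> r \<or> r < b" "1 \<le> a"
  shows "gl_act m n (Bx a) (Bx b) (emb (detX r)) = of_bool (a = b \<and> b \<in> {1..r}) * (2 * emb (detX r))"
proof -
  have "gl_act m n (Bx a) (Bx b) (emb (detX r))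
      = (\<Sum>k = 1..r. \<Sum>q = 1..r. (of_bool (b = k) * xvar a q + of_bool (b = q) * xvar k a) * emb (cofX r k q))"
    unfolding derivation_pdet[OF derivation_gl_act] emb_xp using r
    by (intro sum.cong refl) (simp add: gl_act_xvar_x)
  also have "\<dots> = (\<Sum>k = 1..r. of_bool (b = k) * (\<Sum>q = 1..r. xvar a q * emb (cofX r k q)))
      + (\<Sum>k = 1..r. \<Sum>q = 1..r. of_bool (b = q) * (xvar k a * emb (cofX r k q)))"
    by (simp add: distrib_right sum.distrib sum_distrib_left mult.assoc)
  also have "\<dots> = (if b \<in> {1..r} then (\<Sum>q = 1..r. xvar a q * emb (cofX r b q)) + (\<Sum>k = 1..r. xvar k a * emb (cofX r k b)) else 0)"
    by (simp only: sum_of_bool_mult finite_atLeastAtMost) (cases "b \<in> {1..r}"; simp only: if_True if_False sum.neutral_const add_0_right simp_thms)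
  also have "\<dots> = of_bool (a = b \<and> b \<in> {1..r}) * (2 * emb (detX r))"
  proof (cases "b \<in> {1..r}")
    case True
    then have ar: "a \<in> {1..r}" using a by auto
    have "(\<Sum>k = 1..r. xvar k a * emb (cofX r k b)) = (\<Sum>k = 1..r. xvar a k * emb (cofX r b k))"
      by (intro sum.cong refl) (simp add: xvar_commute cofX_commute[OF _ True])
    then show ?thesis using row_cofX[OF True ar] True by (simp add: mult_2)
  qed auto
  finally show ?thesis .
qed

lemma gl_act_detX_xi:
  assumes "r \<le> m"
  shows "gl_act m n u (Bxi b) (emb (detX r)) = 0"
  unfolding derivation_pdet[OF derivation_gl_act] emb_xp using assms
  by (intro sum.neutral ballI) (simp add: gl_act_xvar_xi)

text \<open>
  Differentiating \<open>X adj X = det X\<close> shows how the cofactors transform.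
\<close>

lemma gl_act_cofX_x:
  assumes a: "a \<in> {1..m}" "b \<in> {1..m}" and i: "i \<in> {1..m}" "q \<in> {1..m}"
  shows "gl_act m n (Bx a) (Bx b) (emb (cofX m i q)) =
    of_bool (a = b) * (2 * emb (cofX m i q)) - of_bool (a = q) * emb (cofX m i b) - of_bool (a = i) * emb (cofX m b q)"
proof -
  let ?D = "gl_act m n (Bx a) (Bx b)" and ?C = "\<lambda>i q. emb (cofX m i q)"
  define Z where "Z i = ?D (?C i q) - (of_bool (a = b) * (2 * ?C i q) - of_bool (a = q) * ?C i b - of_bool (a = i) * ?C b q)" for i
  have rc: "(\<Sum>i = 1..m. xvar p i * ?C i q) = of_bool (p = q) * emb (detX m)" if "p \<in> {1..m}" "q \<in> {1..m}" for p q
  proof -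
    have "(\<Sum>i = 1..m. xvar p i * ?C i q) = (\<Sum>i = 1..m. xvar p i * ?C q i)"
      by (intro sum.cong refl) (simp add: cofX_commute[OF _ that(2)])
    then show ?thesis using row_cofX[OF that(2,1)] by simp
  qed
  have "Z i = 0"
  proof (rule X_injective[OF _ i(1), of Z])
    fix p assume p: "p \<in> {1..m}"
    have "(\<Sum>i = 1..m. ?D (xvar p i) * ?C i q + xvar p i * ?D (?C i q)) = ?D (\<Sum>i = 1..m. xvar p i * ?C i q)"
      by (simp add: gl_act_sum gl_act_mult_even)
    also have "\<dots> = ?D (of_bool (p = q) * emb (detX m))" unfolding rc[OF p i(2)] ..
    also have "\<dots> = of_bool (p = q) * (of_bool (a = b) * (2 * emb (detX m)))"
      using gl_act_detX_x[of m m a b n] a by (cases "p = q") (auto simp: of_bool_def)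
    finally have 1: "(\<Sum>i = 1..m. xvar p i * ?D (?C i q))
        = of_bool (p = q) * (of_bool (a = b) * (2 * emb (detX m))) - (\<Sum>i = 1..m. ?D (xvar p i) * ?C i q)"
      by (simp add: sum.distrib eq_diff_eq add.commute)
    have "(\<Sum>i = 1..m. ?D (xvar p i) * ?C i q)
        = (\<Sum>i = 1..m. of_bool (b = p) * (xvar a i * ?C i q)) + (\<Sum>i = 1..m. of_bool (b = i) * (xvar p a * ?C i q))"
      using p by (simp add: gl_act_xvar_x distrib_right sum.distrib mult.assoc)
    also have "\<dots> = of_bool (b = p) * (of_bool (a = q) * emb (detX m)) + xvar p a * ?C b q"
      unfolding sum_distrib_left[symmetric] rc[OF a(1) i(2)] using a(2)
      by (simp only: sum_of_bool_mult finite_atLeastAtMost if_True)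
    finally have 2: "(\<Sum>i = 1..m. ?D (xvar p i) * ?C i q)
        = of_bool (b = p) * (of_bool (a = q) * emb (detX m)) + xvar p a * ?C b q" .
    have 3: "(\<Sum>i = 1..m. xvar p i * (of_bool (a = b) * (2 * ?C i q))) = of_bool (a = b) * (2 * (of_bool (p = q) * emb (detX m)))"
      unfolding rc[OF p i(2), symmetric] sum_distrib_left by (intro sum.cong refl) (simp add: of_bool_def mult_2 distrib_left)
    have 4: "(\<Sum>i = 1..m. xvar p i * (of_bool (a = q) * ?C i b)) = of_bool (a = q) * (of_bool (p = b) * emb (detX m))"
      unfolding rc[OF p a(2), symmetric] sum_distrib_left by (intro sum.cong refl) (simp add: of_bool_def)
    have 5: "(\<Sum>i = 1..m. xvar p i * (of_bool (a = i) * ?C b q)) = xvar p a * ?C b q"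
    proof -
      have "(\<Sum>i = 1..m. xvar p i * (of_bool (a = i) * ?C b q)) = (\<Sum>i = 1..m. of_bool (a = i) * (xvar p i * ?C b q))"
        by (intro sum.cong refl) (simp add: of_bool_def)
      then show ?thesis using a(1) by (simp only: sum_of_bool_mult finite_atLeastAtMost if_True)
    qed
    have "(\<Sum>i = 1..m. xvar p i * Z i) = (\<Sum>i = 1..m. xvar p i * ?D (?C i q))
       - ((\<Sum>i = 1..m. xvar p i * (of_bool (a = b) * (2 * ?C i q))) - (\<Sum>i = 1..m. xvar p i * (of_bool (a = q) * ?C i b))
          - (\<Sum>i = 1..m. xvar p i * (of_bool (a = i) * ?C b q)))"
      unfolding Z_def right_diff_distrib sum_subtractf ..
    also have "\<dots> = 0" unfolding 3 4 5 1 2 by (simp add: of_bool_def)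
    finally show "(\<Sum>i = 1..m. xvar p i * Z i) = 0" .
  qed
  then show ?thesis by (simp add: Z_def)
qed

lemma gl_act_cofX_xi:
  assumes i: "i \<in> {1..m}" "q \<in> {1..m}"
  shows "gl_act m n u (Bxi b) (emb (cofX m i q)) = 0"
proof -
  let ?D = "gl_act m n u (Bxi b)" and ?C = "\<lambda>i q. emb (cofX m i q)"
  show ?thesis
  proof (rule X_injective[OF _ i(2), of "\<lambda>q. ?D (?C i q)"])
    fix p assume p: "p \<in> {1..m}"
    have "(\<Sum>q = 1..m. xvar p q * ?D (?C i q)) = (\<Sum>q = 1..m. ?D (xvar p q * ?C i q))"
      using p by (intro sum.cong refl) (simp add: gl_act_mult gl_act_xvar_xi)
    also have "\<dots> = ?D (if p = i then emb (detX m) else 0)"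
      unfolding gl_act_sum[symmetric] row_cofX[OF i(1) p] ..
    also have "\<dots> = 0" by (simp add: gl_act_detX_xi)
    finally show "(\<Sum>q = 1..m. xvar p q * ?D (?C i q)) = 0" .
  qed
qed

lemma hwv_Delta:
  assumes "r \<le> m"
  shows "hwv m n (\<lambda>b. case b of Bx i \<Rightarrow> if i \<le> r then 2 else 0 | Bxi j \<Rightarrow> 0) (Delta r)"
  unfolding hwv_def Delta_eq_emb
proof (intro conjI)
  have "xvar i j \<in> SS m n" if "i \<in> {1..r}" "j \<in> {1..r}" for i j
    using SS_sq[of "Bx i" m n "Bx j"] that assms by simp
  then show "emb (detX r) \<in> SS m n"
    unfolding Delta_eq_emb[symmetric] Delta_def sdet_def
    by (intro SS_sum SS_mult SS_of_int SS_prod_list) (auto simp: permutes_in_image simp del: One_nat_def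
        dest!: permutes_in_image)
  show "emb (detX r) \<noteq> 0" by (simp add: detX_nonzero)
  show "singular m n (emb (detX r))"
  proof -
    have "gl_act m n (Bx i) (Bx (i + 1)) (emb (detX r)) = 0" if "1 \<le> i" for i
      using gl_act_detX_x[OF assms, of i "i + 1" n] that by (cases "i \<le> r") auto
    then show ?thesis unfolding singular_def using assms by (auto simp: gl_act_detX_xi)
  qed
  show "weight_vec m n (\<lambda>b. case b of Bx i \<Rightarrow> if i \<le> r then 2 else 0 | Bxi j \<Rightarrow> 0) (emb (detX r))"
    unfolding weight_vec_def
  proof
    fix b assume "b \<in> bvecs m n"
    then show "gl_act m n b b (emb (detX r)) = const (case b of Bx i \<Rightarrow> if i \<le> r then 2 else 0 | Bxi j \<Rightarrow> 0) * emb (detX r)"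
      using assms by (cases b) (auto simp: gl_act_detX_xi gl_act_detX_x const_two)
  qed
qed

section \<open>The elements \<open>\<Delta>(\<xi>\<^sub>k, \<xi>\<^sub>l)\<close>\<close>

text \<open>Moving an element of even parity past an odd variable costs no sign.\<close>

lemma even_central: "twist g = g \<Longrightarrow> f * g = g * (f :: superpoly)"
proof (induction f rule: superpoly_induct)
  case (const c)
  show ?case by (rule const_central[symmetric])
next
  case (odd k i f)
  have "odd_var k i * f * g = odd_var k i * g * f" using odd by (simp add: mult.assoc)
  also have "\<dots> = g * odd_var k i * f" using odd(2) by (simp add: odd_var_commute[of g])
  finally show ?case by (simp add: mult.assoc)
qed (simp_all add: distrib_left distrib_right mult.assoc even_var_left_commute)

lemma superpoly_eq_neg_0: "(f :: superpoly) = - f \<Longrightarrow> f = 0"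
proof -
  assume a: "f = - f"
  have "cf f S \<alpha> = - cf f S \<alpha>" for S \<alpha> using arg_cong[OF a, of "\<lambda>x. cf x S \<alpha>"] by simp
  then show "f = 0" by (intro superpoly_eqI) simp
qed

text \<open>
  In matrix notation, this is \<open>- (det X) y + \<eta> (adj X) \<eta>\<^sup>T\<close>, that is \<open>- det X\<close> times the Schur complement of \<open>X\<close> in the generic
  supersymmetric matrix.
\<close>

lemma Delta_xi_eq:
  "Delta_xi m k l = - (emb (detX m) * yvar k l)
     + (\<Sum>i = 1..m. \<Sum>q = 1..m. emb (cofX m i q) * (odd_var k q * odd_var l i))"
proof -
  have "(\<Sum>i = 1..m. detX_row m i k * odd_var l i)
      = (\<Sum>i = 1..m. \<Sum>q = 1..m. emb (cofX m i q) * (odd_var k q * odd_var l i))"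
    by (rule sum.cong) (simp_all add: detX_row_eq sum_distrib_right mult.assoc del: One_nat_def)
  then show ?thesis by (simp add: Delta_xi_def Delta_eq_emb)
qed

lemma Delta_xi_antisym: "Delta_xi m l k = - Delta_xi m k l"
proof -
  have "(\<Sum>i = 1..m. \<Sum>q = 1..m. emb (cofX m i q) * (odd_var l q * odd_var k i))
      = (\<Sum>q = 1..m. \<Sum>i = 1..m. emb (cofX m i q) * (odd_var l q * odd_var k i))"
    by (rule sum.swap)
  also have "\<dots> = (\<Sum>q = 1..m. \<Sum>i = 1..m. - (emb (cofX m q i) * (odd_var k i * odd_var l q)))"
    by (intro sum.cong refl) (simp add: cofX_commute odd_var_anticommute[of l])
  finally show ?thesis
    unfolding Delta_xi_eq yvar_anticommute[of l k] by (simp add: sum_negf)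
qed

lemma Delta_xi_same: "Delta_xi m k k = 0"
  using Delta_xi_antisym superpoly_eq_neg_0 by blast

lemma twist_sum: "twist (sum f A :: superpoly) = (\<Sum>x\<in>A. twist (f x))"
  by (induction A rule: infinite_finite_induct) (simp_all add: twist_add)

lemma twist_yvar [simp]: "twist (yvar k l) = yvar k l"
  by (simp add: yvar_def twist_uminus)

lemma twist_Delta_xi: "twist (Delta_xi m k l) = Delta_xi m k l"
  unfolding Delta_xi_eq twist_add twist_uminus twist_mult twist_sum by simp

lemmas Delta_xi_central = even_central[OF twist_Delta_xi]

lemma gl_act_yvar:
  assumes "k \<in> {1..n}" "l \<in> {1..n}"
  shows "gl_act m n (Bx p) (Bxi c) (yvar k l) = of_bool (c = k) * odd_var l p - of_bool (c = l) * odd_var k p"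
    and "gl_act m n (Bx p) (Bx c) (yvar k l) = 0"
    and "gl_act m n (Bxi a) (Bxi c) (yvar k l) = of_bool (c = k) * yvar a l + of_bool (c = l) * yvar k a"
  using gl_act_sq[of "Bxi k" m n "Bxi l" "Bx p" "Bxi c"] gl_act_sq[of "Bxi k" m n "Bxi l" "Bx p" "Bx c"]
    gl_act_sq[of "Bxi k" m n "Bxi l" "Bxi a" "Bxi c"] assms
  by (auto simp: act_sq_def)

lemma gl_act_odd_var:
  assumes "k \<in> {1..n}" "i \<in> {1..m}"
  shows "gl_act m n (Bx p) (Bxi c) (odd_var k i) = of_bool (c = k) * xvar p i"
    and "gl_act m n (Bx p) (Bx c) (odd_var k i) = of_bool (c = i) * odd_var k p"
    and "gl_act m n (Bxi a) (Bxi c) (odd_var k i) = of_bool (c = k) * odd_var a i"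
  using gl_act_sq[of "Bxi k" m n "Bx i" "Bx p" "Bxi c"] gl_act_sq[of "Bxi k" m n "Bx i" "Bx p" "Bx c"]
    gl_act_sq[of "Bxi k" m n "Bx i" "Bxi a" "Bxi c"] assms
  by (auto simp: act_sq_def)

lemma xvar_central: "f * xvar i j = xvar i j * f"
  unfolding emb_xp[symmetric] by (rule emb_central)

text \<open>
  The operator turns \<open>y\<close> into \<open>\<eta>\<close> and \<open>\<eta>\<close> into a row of \<open>X\<close>, and \<open>X adj X = det X\<close> makes the two contributions cancel.
\<close>

lemma gl_act_Delta_xi_odd:
  assumes p: "p \<in> {1..m}" and kl: "k \<in> {1..n}" "l \<in> {1..n}"
  shows "gl_act m n (Bx p) (Bxi c) (Delta_xi m k l) = 0"
proof -
  let ?D = "gl_act m n (Bx p) (Bxi c)" and ?C = "\<lambda>i q. emb (cofX m i q)"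
  have 1: "?D (?C i q * (odd_var k q * odd_var l i))
      = of_bool (c = k) * (xvar p q * ?C i q * odd_var l i) - of_bool (c = l) * (xvar p i * ?C q i * odd_var k q)"
    if "i \<in> {1..m}" "q \<in> {1..m}" for i q
  proof -
    have a: "?D (?C i q * (odd_var k q * odd_var l i))
        = ?C i q * (of_bool (c = k) * xvar p q * odd_var l i - odd_var k q * (of_bool (c = l) * xvar p i))"
      using that kl by (simp add: gl_act_mult gl_act_cofX_xi gl_act_odd_var del: One_nat_def)
    have b: "?C i q * (xvar p q * odd_var l i) = xvar p q * ?C i q * odd_var l i"
      by (simp add: emb_central[of "xvar p q"] mult.assoc)
    have c: "?C i q * (odd_var k q * xvar p i) = xvar p i * ?C q i * odd_var k q"
      using that by (simp add: emb_central[of "xvar p i"] cofX_commute[of q] xvar_central[of "odd_var k q"] mult.assoc)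
    show ?thesis unfolding a using b c by (cases "c = k"; cases "c = l"; simp add: right_diff_distrib)
  qed
  have "(\<Sum>i = 1..m. \<Sum>q = 1..m. ?D (?C i q * (odd_var k q * odd_var l i)))
      = (\<Sum>i = 1..m. \<Sum>q = 1..m. of_bool (c = k) * (xvar p q * ?C i q * odd_var l i))
        - (\<Sum>i = 1..m. \<Sum>q = 1..m. of_bool (c = l) * (xvar p i * ?C q i * odd_var k q))"
    unfolding sum_subtractf[symmetric] by (intro sum.cong refl 1)
  also have "(\<Sum>i = 1..m. \<Sum>q = 1..m. of_bool (c = k) * (xvar p q * ?C i q * odd_var l i))
      = of_bool (c = k) * (\<Sum>i = 1..m. (\<Sum>q = 1..m. xvar p q * ?C i q) * odd_var l i)"
    by (simp add: sum_distrib_left sum_distrib_right)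
  also have "(\<Sum>i = 1..m. (\<Sum>q = 1..m. xvar p q * ?C i q) * odd_var l i)
      = (\<Sum>i = 1..m. if i = p then emb (detX m) * odd_var l i else 0)"
    by (intro sum.cong refl) (simp add: row_cofX[OF _ p] del: One_nat_def)
  also have "\<dots> = emb (detX m) * odd_var l p" using p by simp
  also have "(\<Sum>i = 1..m. \<Sum>q = 1..m. of_bool (c = l) * (xvar p i * ?C q i * odd_var k q))
      = of_bool (c = l) * (\<Sum>q = 1..m. (\<Sum>i = 1..m. xvar p i * ?C q i) * odd_var k q)"
    by (subst sum.swap) (simp add: sum_distrib_left sum_distrib_right)
  also have "(\<Sum>q = 1..m. (\<Sum>i = 1..m. xvar p i * ?C q i) * odd_var k q)
      = (\<Sum>q = 1..m. if q = p then emb (detX m) * odd_var k q else 0)"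
    by (intro sum.cong refl) (simp add: row_cofX[OF _ p] del: One_nat_def)
  also have "\<dots> = emb (detX m) * odd_var k p" using p by simp
  finally have S: "(\<Sum>i = 1..m. \<Sum>q = 1..m. ?D (?C i q * (odd_var k q * odd_var l i)))
      = of_bool (c = k) * (emb (detX m) * odd_var l p) - of_bool (c = l) * (emb (detX m) * odd_var k p)" .
  show ?thesis
    unfolding Delta_xi_eq gl_act_add gl_act_uminus gl_act_sum S
    using kl by (simp add: gl_act_mult gl_act_detX_xi gl_act_yvar right_diff_distrib of_bool_def)
qed

lemma gl_act_Delta_xi_x:
  assumes ab: "a \<in> {1..m}" "b \<in> {1..m}" and kl: "k \<in> {1..n}" "l \<in> {1..n}"
  shows "gl_act m n (Bx a) (Bx b) (Delta_xi m k l) = of_bool (a = b) * (2 * Delta_xi m k l)"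
proof -
  let ?D = "gl_act m n (Bx a) (Bx b)" and ?C = "\<lambda>i q. emb (cofX m i q)"
  let ?t = "\<lambda>i q. ?C i q * (odd_var k q * odd_var l i)"
  have 1: "?D (?t i q) = of_bool (a = b) * (2 * ?t i q)
      - of_bool (a = q) * (?C i b * (odd_var k q * odd_var l i)) - of_bool (a = i) * (?C b q * (odd_var k q * odd_var l i))
      + of_bool (b = q) * (?C i q * (odd_var k a * odd_var l i)) + of_bool (b = i) * (?C i q * (odd_var k q * odd_var l a))"
    if "i \<in> {1..m}" "q \<in> {1..m}" for i q
    using that kl ab
    by (simp add: gl_act_mult_even gl_act_cofX_x gl_act_odd_var left_diff_distrib distrib_left of_bool_def mult.assoc del: One_nat_def)
  have 2: "(\<Sum>i = 1..m. \<Sum>q = 1..m. of_bool (x = q) * F i q) = (\<Sum>i = 1..m. F i x)" if "x \<in> {1..m}" for x and F :: "nat \<Rightarrow> nat \<Rightarrow> superpoly"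
    by (simp only: sum_of_bool_mult finite_atLeastAtMost that if_True)
  have 3: "(\<Sum>i = 1..m. \<Sum>q = 1..m. of_bool (x = i) * F i q) = (\<Sum>q = 1..m. F x q)" if "x \<in> {1..m}" for x and F :: "nat \<Rightarrow> nat \<Rightarrow> superpoly"
    by (subst sum.swap) (simp only: sum_of_bool_mult finite_atLeastAtMost that if_True)
  have "(\<Sum>i = 1..m. \<Sum>q = 1..m. ?D (?t i q))
      = (\<Sum>i = 1..m. \<Sum>q = 1..m. of_bool (a = b) * (2 * ?t i q)
      - of_bool (a = q) * (?C i b * (odd_var k q * odd_var l i)) - of_bool (a = i) * (?C b q * (odd_var k q * odd_var l i))
      + of_bool (b = q) * (?C i q * (odd_var k a * odd_var l i)) + of_bool (b = i) * (?C i q * (odd_var k q * odd_var l a)))"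
    by (intro sum.cong refl 1)
  also have "\<dots> = (\<Sum>i = 1..m. \<Sum>q = 1..m. of_bool (a = b) * (2 * ?t i q))
      - (\<Sum>i = 1..m. ?C i b * (odd_var k a * odd_var l i)) - (\<Sum>q = 1..m. ?C b q * (odd_var k q * odd_var l a))
      + (\<Sum>i = 1..m. ?C i b * (odd_var k a * odd_var l i)) + (\<Sum>q = 1..m. ?C b q * (odd_var k q * odd_var l a))"
    unfolding sum.distrib sum_subtractf 2[OF ab(1)] 2[OF ab(2)] 3[OF ab(1)] 3[OF ab(2)] ..
  also have "\<dots> = of_bool (a = b) * (2 * (\<Sum>i = 1..m. \<Sum>q = 1..m. ?t i q))"
    by (simp add: sum_distrib_left)
  finally have S: "(\<Sum>i = 1..m. \<Sum>q = 1..m. ?D (?t i q)) = of_bool (a = b) * (2 * (\<Sum>i = 1..m. \<Sum>q = 1..m. ?t i q))" .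
  show ?thesis
    unfolding Delta_xi_eq gl_act_add gl_act_uminus gl_act_sum S
    using kl ab gl_act_detX_x[of m m a b n]
    by (simp add: gl_act_mult_even gl_act_yvar of_bool_def distrib_left mult_2 distrib_right)
qed

text \<open>
  The form \<open>\<Delta>(\<xi>\<^sub>k, \<xi>\<^sub>l)\<close> is bilinear in \<open>\<xi>\<^sub>k\<close> and \<open>\<xi>\<^sub>l\<close>, with coefficients that \<open>gl\<^sub>n\<close> does not move.
\<close>

lemma gl_act_Delta_xi_xi:
  assumes kl: "k \<in> {1..n}" "l \<in> {1..n}"
  shows "gl_act m n (Bxi a) (Bxi b) (Delta_xi m k l) = of_bool (b = k) * Delta_xi m a l + of_bool (b = l) * Delta_xi m k a"
proof -
  let ?D = "gl_act m n (Bxi a) (Bxi b)" and ?C = "\<lambda>i q. emb (cofX m i q)"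
  have 1: "?D (?C i q * (odd_var k q * odd_var l i)) =
      of_bool (b = k) * (?C i q * (odd_var a q * odd_var l i)) + of_bool (b = l) * (?C i q * (odd_var k q * odd_var a i))"
    if "i \<in> {1..m}" "q \<in> {1..m}" for i q
    using that kl by (simp add: gl_act_mult_even gl_act_cofX_xi gl_act_odd_var distrib_left of_bool_def del: One_nat_def)
  have S: "(\<Sum>i = 1..m. \<Sum>q = 1..m. ?D (?C i q * (odd_var k q * odd_var l i)))
    = of_bool (b = k) * (\<Sum>i = 1..m. \<Sum>q = 1..m. ?C i q * (odd_var a q * odd_var l i))
      + of_bool (b = l) * (\<Sum>i = 1..m. \<Sum>q = 1..m. ?C i q * (odd_var k q * odd_var a i))"
    unfolding sum_distrib_left sum.distrib[symmetric] by (intro sum.cong refl 1)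
  show ?thesis
    unfolding Delta_xi_eq gl_act_add gl_act_uminus gl_act_sum S
    using kl by (simp add: gl_act_mult_even gl_act_detX_xi gl_act_yvar of_bool_def distrib_left)
qed

lemma SS_Delta_xi:
  assumes kl: "k \<in> {1..n}" "l \<in> {1..n}"
  shows "Delta_xi m k l \<in> SS m n"
proof -
  have x: "xvar i j \<in> SS m n" if "i \<in> {1..m}" "j \<in> {1..m}" for i j
    using SS_sq[of "Bx i" m n "Bx j"] that by simp
  have y: "yvar k l \<in> SS m n" using SS_sq[of "Bxi k" m n "Bxi l"] kl by simp
  have o: "odd_var j i \<in> SS m n" if "j \<in> {1..n}" "i \<in> {1..m}" for i j
    using that by (intro SS_odd_var) (auto simp: ovars_def)
  have "detX_row m i k \<in> SS m n" for i
    unfolding detX_row_def sdet_def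
    by (intro SS_sum SS_mult SS_of_int SS_prod_list)
      (use kl in \<open>auto intro!: x o simp: permutes_in_image simp del: One_nat_def dest!: permutes_in_image\<close>)
  then show ?thesis
    unfolding Delta_xi_def using kl hwvD(1)[OF hwv_Delta[of m m n]]
    by (intro SS_add SS_uminus SS_mult SS_sum y o) auto
qed

section \<open>The Pfaffians \<open>\<Gamma>(2l)\<close>\<close>

abbreviation pair_prod :: "nat \<Rightarrow> nat \<Rightarrow> (nat \<Rightarrow> nat) \<Rightarrow> superpoly" where
  "pair_prod m L p \<equiv> (\<Prod>k\<leftarrow>[1..<L + 1]. Delta_xi m (p (2 * k - 1)) (p (2 * k)))"

lemma Gamma_even: "Gamma m (2 * L) = (\<Sum>p\<in>pairings L. of_int (sign p) * pair_prod m L p)"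
  by (simp add: Gamma_def)

lemma pairings_in_range:
  assumes "p \<in> pairings L" "k \<in> {1..L}"
  shows "p (2 * k - 1) \<in> {1..2 * L}" "p (2 * k) \<in> {1..2 * L}"
proof -
  have "p permutes {1..2 * L}" using assms(1) by (simp add: pairings_def)
  then show "p (2 * k - 1) \<in> {1..2 * L}" "p (2 * k) \<in> {1..2 * L}"
    using assms(2) unfolding permutes_in_image[OF \<open>p permutes {1..2 * L}\<close>] by auto
qed

lemma gl_act_prod_list_zero:
  assumes "\<And>x. x \<in> set xs \<Longrightarrow> gl_act m n u v (F x) = 0"
  shows "gl_act m n u v (\<Prod>x\<leftarrow>xs. F x) = 0"
  using assms by (induction xs) (auto simp: gl_act_mult)

lemma gl_act_prod_list_eigen:
  assumes "parity u = parity v" "\<And>x. x \<in> set xs \<Longrightarrow> gl_act m n u v (F x) = const (w x) * F x"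
  shows "gl_act m n u v (\<Prod>x\<leftarrow>xs. F x) = const (\<Sum>x\<leftarrow>xs. w x) * (\<Prod>x\<leftarrow>xs. F x)"
  using assms(2)
proof (induction xs)
  case (Cons x xs)
  then show ?case using assms(1)
    by (simp add: gl_act_mult_even const_add distrib_right mult.assoc const_left_commute)
qed simp

text \<open>Used when all factors but one are killed: the Leibniz rule then replaces just that factor.\<close>

lemma gl_act_prod_list_single:
  assumes "parity u = parity v" "distinct xs" "x0 \<in> set xs"
    and "\<And>x. x \<in> set xs \<Longrightarrow> x \<noteq> x0 \<Longrightarrow> gl_act m n u v (F x) = 0 \<and> G x = F x"
    and "gl_act m n u v (F x0) = G x0"
  shows "gl_act m n u v (\<Prod>x\<leftarrow>xs. F x) = (\<Prod>x\<leftarrow>xs. G x)"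
  using assms(2-4)
proof (induction xs)
  case (Cons x xs)
  show ?case
  proof (cases "x = x0")
    case True
    then have "gl_act m n u v (F y) = 0 \<and> G y = F y" if "y \<in> set xs" for y using Cons that by auto
    then have "gl_act m n u v (\<Prod>x\<leftarrow>xs. F x) = 0" "(\<Prod>x\<leftarrow>xs. G x) = (\<Prod>x\<leftarrow>xs. F x)"
      by (auto intro: gl_act_prod_list_zero cong: map_cong)
    then show ?thesis using True assms(1,5) by (simp add: gl_act_mult_even)
  next
    case False
    then have "gl_act m n u v (F x) = 0 \<and> G x = F x" using Cons by auto
    then show ?thesis using Cons False assms(1) by (simp add: gl_act_mult_even)
  qed
qed simp

lemma gl_act_of_int_mult: "gl_act m n u v (of_int k * f) = of_int k * gl_act m n u v f"
proof -
  have "of_int k = const (of_int k)" by (simp add: const_eq_emb flip: emb_of_int)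
  then show ?thesis by (simp add: gl_act_const_mult)
qed

lemma prod_list_zero: "x \<in> set xs \<Longrightarrow> F x = 0 \<Longrightarrow> (\<Prod>x\<leftarrow>xs. F x) = (0 :: 'r::semiring_1)"
  by (induction xs) auto

lemma pairings_pos:
  assumes "p \<in> pairings L"
  shows "k \<in> {1..L} \<Longrightarrow> p (2 * k - 1) < p (2 * k)" "1 \<le> k \<Longrightarrow> k < L \<Longrightarrow> p (2 * k - 1) < p (2 * k + 1)"
  using assms by (auto simp: pairings_def)

text \<open>
  The raising operator \<open>\<xi>\<^sub>a \<partial>/\<partial>\<xi>\<^sub>a\<^sub>+\<^sub>1\<close> replaces the index \<open>a + 1\<close> by \<open>a\<close>.  In the resulting sum over
  pairings, the terms in which \<open>a\<close> and \<open>a + 1\<close> are paired vanish, and the others cancel in couples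
  that differ by exchanging \<open>a\<close> and \<open>a + 1\<close>.  Exchanging adjacent numbers does not disturb the order of a pair;
  it disturbs the order of the list of pairs only if both numbers are first elements, and then the two
  pairs have to be exchanged as well, which amounts to exchanging their second elements.
\<close>

lemma sum_pairings_equal_index:
  assumes ab: "1 \<le> a" "b = Suc a" "b \<le> 2 * L"
  defines "r \<equiv> (\<lambda>x. if x = b then a else x)"
  shows "(\<Sum>p\<in>pairings L. of_int (sign p) * pair_prod m L (r \<circ> p)) = 0"
proof -
  let ?T = "\<lambda>p. of_int (sign p) * pair_prod m L (r \<circ> p)"
  define s where "s = transpose a b"
  define P where "P = {p \<in> pairings L. \<not> (\<exists>k\<in>{1..L}. p (2 * k - 1) = a \<and> p (2 * k) = b)}"
  define B where "B p k \<longleftrightarrow> 1 \<le> k \<and> k < L \<and> p (2 * k - 1) = a \<and> p (2 * k + 1) = b" for p k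
  \<comment> \<open>the position of the pair that begins with \<open>a\<close>\<close>
  define K where "K p = (inv p a + 1) div 2" for p :: "nat \<Rightarrow> nat"
  \<comment> \<open>exchange \<open>a\<close> and \<open>b\<close>; if the pairs that begin with them change places, only the second elements move\<close>
  define \<iota> where "\<iota> p = (if \<exists>k. B p k then p \<circ> transpose (2 * K p) (2 * K p + 2) else s \<circ> p)" for p
  have alb: "a < b" using ab(2) by simp
  have finP: "finite (pairings L)"
    by (rule finite_subset[OF _ finite_permutes[of "2 * L"]]) (auto simp: pairings_def)
  have s: "s permutes {1..2 * L}" unfolding s_def using ab by (intro permutes_swap_id) auto
  have rs: "r (s x) = r x" for x by (auto simp: r_def s_def transpose_def)
  have s_mono: "s x < s y" if "x < y" "\<not> (x = a \<and> y = b)" for x y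
    using that ab(2) by (auto simp: s_def transpose_def)
  have perm: "permutation p" if "p permutes {1..2 * L}" for p :: "nat \<Rightarrow> nat"
    using that by (auto simp: permutation_permutes)
  have BK: "K p = k" if "B p k" "p permutes {1..2 * L}" for p k
  proof -
    have "inv p a = 2 * k - 1" using that by (auto simp: B_def permutes_inv_eq)
    then show ?thesis using that(1) by (simp add: K_def B_def)
  qed
  have Pperm: "p permutes {1..2 * L}" if "p \<in> P" for p using that by (simp add: P_def pairings_def)
  have main: "\<iota> p \<in> P \<and> \<iota> (\<iota> p) = p \<and> ?T (\<iota> p) = - ?T p" if p: "p \<in> P" for p
  proof (cases "\<exists>k. B p k")
    case False
    have pp: "p \<in> pairings L" using p by (simp add: P_def)
    have i: "\<iota> p = s \<circ> p" using False by (simp add: \<iota>_def)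
    have 1: "s \<circ> p permutes {1..2 * L}" using Pperm[OF p] s by (rule permutes_compose)
    have 2: "(s \<circ> p) (2 * k - 1) < (s \<circ> p) (2 * k)" if "k \<in> {1..L}" for k
      using s_mono[OF pairings_pos(1)[OF pp that]] p that by (auto simp: P_def)
    have 3: "(s \<circ> p) (2 * k - 1) < (s \<circ> p) (2 * k + 1)" if "1 \<le> k" "k < L" for k
      using s_mono[OF pairings_pos(2)[OF pp that]] False that by (auto simp: B_def)
    have sab: "s x = a \<longleftrightarrow> x = b" "s x = b \<longleftrightarrow> x = a" for x
      using ab by (auto simp: s_def transpose_def)
    have "s \<circ> p \<in> pairings L" using 1 2 3 by (simp add: pairings_def)
    moreover have "\<not> ((s \<circ> p) (2 * k - 1) = a \<and> (s \<circ> p) (2 * k) = b)" if "k \<in> {1..L}" for k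
      using pairings_pos(1)[OF pp that] alb by (auto simp: sab)
    ultimately have 4: "s \<circ> p \<in> P" unfolding P_def by blast
    have 5: "\<not> B (s \<circ> p) k" for k
      using pairings_pos(2)[OF pp, of k] alb by (auto simp: B_def sab)
    have "\<iota> (s \<circ> p) = s \<circ> (s \<circ> p)" using 5 by (simp add: \<iota>_def)
    also have "\<dots> = p" by (simp add: s_def fun_eq_iff)
    finally have 6: "\<iota> (s \<circ> p) = p" .
    have sg: "sign (s \<circ> p) = - sign p"
      using perm[OF Pperm[OF p]] ab by (simp add: s_def sign_compose permutation_swap_id sign_swap_id)
    have "?T (s \<circ> p) = - ?T p" by (simp add: sg rs)
    then show ?thesis using i 4 6 by simp
  next
    case True
    then obtain k where k: "B p k" by blast
    have pp: "p \<in> pairings L" using p by (simp add: P_def)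
    note prm = Pperm[OF p]
    let ?t = "transpose (2 * k) (2 * k + 2)"
    have kL: "1 \<le> k" "k < L" "p (2 * k - 1) = a" "p (2 * k + 1) = b" using k by (auto simp: B_def)
    have i: "\<iota> p = p \<circ> ?t" using True BK[OF k prm] by (simp add: \<iota>_def)
    have todd: "?t (2 * j - 1) = 2 * j - 1" if "1 \<le> j" for j
      using that kL by (auto simp: transpose_def) presburger+
    have todd': "?t (2 * j + 1) = 2 * j + 1" for j
      by (auto simp: transpose_def) presburger+
    have t: "?t permutes {1..2 * L}" using kL by (intro permutes_swap_id) auto
    have 1: "p \<circ> ?t permutes {1..2 * L}" using t prm by (rule permutes_compose)
    have inj: "p x = p y \<longleftrightarrow> x = y" for x y using permutes_inj[OF prm] by (auto dest: injD)
    have g1: "a < p (2 * k)" "b < p (2 * k + 2)"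
      using pairings_pos(1)[OF pp, of k] pairings_pos(1)[OF pp, of "k + 1"] kL by auto
    have g2: "p (2 * k) \<noteq> b" using inj[of "2 * k" "2 * k + 1"] kL by auto
    have 2: "(p \<circ> ?t) (2 * j - 1) < (p \<circ> ?t) (2 * j)" if j: "j \<in> {1..L}" for j
    proof -
      consider "j = k" | "j = k + 1" | "j \<noteq> k" "j \<noteq> k + 1" by blast
      then show ?thesis
      proof cases
        case 1
        then show ?thesis using todd[of j] kL g1 ab by simp
      next
        case 2
        then show ?thesis using todd'[of k] kL g1 g2 ab by simp
      next
        case 3
        then have "?t (2 * j) = 2 * j" by (auto simp: transpose_def)
        then show ?thesis using todd[of j] j pairings_pos(1)[OF pp j] by simp
      qed
    qed
    have 3: "(p \<circ> ?t) (2 * j - 1) < (p \<circ> ?t) (2 * j + 1)" if "1 \<le> j" "j < L" for j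
      using pairings_pos(2)[OF pp that] todd[OF that(1)] todd'[of j] by simp
    have 4: "\<not> (\<exists>j\<in>{1..L}. (p \<circ> ?t) (2 * j - 1) = a \<and> (p \<circ> ?t) (2 * j) = b)"
    proof
      assume "\<exists>j\<in>{1..L}. (p \<circ> ?t) (2 * j - 1) = a \<and> (p \<circ> ?t) (2 * j) = b"
      then obtain j where j: "1 \<le> j" "p (2 * j - 1) = a" "p (?t (2 * j)) = b"
        using todd by auto
      then have "2 * j - 1 = 2 * k - 1" using inj kL by metis
      then have "j = k" using j(1) kL(1) by linarith
      then show False using j(3) g1 by simp
    qed
    have P': "p \<circ> ?t \<in> P" using 1 2 3 4 by (simp add: P_def pairings_def)
    have B': "B (p \<circ> ?t) k" using k todd[OF kL(1)] todd'[of k] by (simp add: B_def)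
    have "\<iota> (p \<circ> ?t) = (p \<circ> ?t) \<circ> ?t" using B' BK[OF B' 1] by (auto simp: \<iota>_def)
    also have "\<dots> = p" by (simp add: fun_eq_iff)
    finally have 6: "\<iota> (p \<circ> ?t) = p" .
    have sg: "sign (p \<circ> ?t) = - sign p"
      using perm[OF prm] by (simp add: sign_compose permutation_swap_id sign_swap_id)
    let ?F = "\<lambda>p j. Delta_xi m ((r \<circ> p) (2 * j - 1)) ((r \<circ> p) (2 * j))"
    have spl: "[1..<L + 1] = [1..<k] @ [k, k + 1] @ [k + 2..<L + 1]"
      using kL upt_add_eq_append[of 1 k "L + 1 - k"] by (simp add: upt_conv_Cons)
    have oth: "?F (p \<circ> ?t) j = ?F p j" if "j \<noteq> k" "j \<noteq> k + 1" "1 \<le> j" for j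
    proof -
      have "?t (2 * j) = 2 * j" using that by (auto simp: transpose_def)
      then show ?thesis using todd[OF that(3)] by simp
    qed
    have o1: "(\<Prod>j\<leftarrow>[1..<k]. ?F (p \<circ> ?t) j) = (\<Prod>j\<leftarrow>[1..<k]. ?F p j)"
      by (intro arg_cong[of _ _ prod_list] map_cong refl oth) auto
    have o2: "(\<Prod>j\<leftarrow>[k + 2..<L + 1]. ?F (p \<circ> ?t) j) = (\<Prod>j\<leftarrow>[k + 2..<L + 1]. ?F p j)"
      by (intro arg_cong[of _ _ prod_list] map_cong refl oth) auto
    have k1: "2 * (k + 1) - 1 = 2 * k + 1" "2 * (k + 1) = 2 * k + 2" by auto
    have "?F (p \<circ> ?t) k = ?F p (k + 1)"
      using todd[OF kL(1)] kL ab unfolding k1 by (simp add: r_def)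
    moreover have "?F (p \<circ> ?t) (k + 1) = ?F p k"
      using todd'[of k] kL ab unfolding k1 by (simp add: r_def)
    ultimately have "?F (p \<circ> ?t) k * ?F (p \<circ> ?t) (k + 1) = ?F p k * ?F p (k + 1)"
      by (simp only: Delta_xi_central[of "?F p (k + 1)"])
    then have "pair_prod m L (r \<circ> (p \<circ> ?t)) = pair_prod m L (r \<circ> p)"
      unfolding spl map_append prod_list.append o1[unfolded comp_assoc] o2[unfolded comp_assoc]
      by (simp only: list.map prod_list.Cons prod_list.Nil mult_1_right comp_assoc)
    then have "?T (p \<circ> ?t) = - ?T p" unfolding sg by simp
    then show ?thesis using i P' 6 by simp
  qed
  have "(\<Sum>p\<in>P. ?T p) = (\<Sum>p\<in>P. ?T (\<iota> p))"
    by (rule sum.reindex_bij_witness[of _ \<iota> \<iota>]) (use main in auto)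
  also have "\<dots> = - (\<Sum>p\<in>P. ?T p)"
    unfolding sum_negf[symmetric] by (intro sum.cong refl) (use main in auto)
  finally have "(\<Sum>p\<in>P. ?T p) = 0" by (rule superpoly_eq_neg_0)
  moreover have "(\<Sum>p\<in>pairings L. ?T p) = (\<Sum>p\<in>P. ?T p)"
  proof (rule sum.mono_neutral_right[OF finP])
    show "P \<subseteq> pairings L" by (auto simp: P_def)
    show "\<forall>p\<in>pairings L - P. ?T p = 0"
    proof
      fix p assume "p \<in> pairings L - P"
      then obtain k where k: "k \<in> {1..L}" "p (2 * k - 1) = a" "p (2 * k) = b" by (auto simp: P_def)
      have "pair_prod m L (r \<circ> p) = 0"
        by (rule prod_list_zero[of k]) (use k ab in \<open>auto simp: r_def Delta_xi_same\<close>)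
      then show "?T p = 0" by simp
    qed
  qed
  ultimately show ?thesis by simp
qed

lemma gl_act_Gamma_raising:
  assumes ab: "1 \<le> a" "b = Suc a" "b \<le> n" and L: "2 * L \<le> n"
  shows "gl_act m n (Bxi a) (Bxi b) (Gamma m (2 * L)) = 0"
proof -
  let ?r = "\<lambda>x. if x = b then a else x"
  let ?D = "gl_act m n (Bxi a) (Bxi b)"
  have rng: "p (2 * k - 1) \<in> {1..n}" "p (2 * k) \<in> {1..n}" if "p \<in> pairings L" "k \<in> {1..L}" for p k
    using pairings_in_range[OF that] L by auto
  have D: "?D (Delta_xi m (p (2 * k - 1)) (p (2 * k))) = of_bool (b = p (2 * k - 1)) * Delta_xi m a (p (2 * k))
      + of_bool (b = p (2 * k)) * Delta_xi m (p (2 * k - 1)) a" if "p \<in> pairings L" "k \<in> {1..L}" for p k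
    using rng[OF that] by (rule gl_act_Delta_xi_xi)
  have setL: "set [1..<L + 1] = {1..L}" by auto
  show ?thesis
  proof (cases "b \<le> 2 * L")
    case False
    have "?D (pair_prod m L p) = 0" if p: "p \<in> pairings L" for p
    proof (rule gl_act_prod_list_zero)
      fix k assume "k \<in> set [1..<L + 1]"
      then have k: "k \<in> {1..L}" by auto
      show "?D (Delta_xi m (p (2 * k - 1)) (p (2 * k))) = 0"
        unfolding D[OF p k] using pairings_in_range[OF p k] False by auto
    qed
    then show ?thesis by (simp add: Gamma_even gl_act_sum gl_act_of_int_mult)
  next
    case True
    have "?D (pair_prod m L p) = pair_prod m L (?r \<circ> p)" if p: "p \<in> pairings L" for p
    proof -
      have prm: "p permutes {1..2 * L}" using p by (simp add: pairings_def)
      define t where "t = inv p b"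
      have pt: "p t = b" unfolding t_def using prm by (simp add: permutes_inverses)
      have inj: "p x = p y \<longleftrightarrow> x = y" for x y using permutes_inj[OF prm] by (auto dest: injD)
      have tr: "t \<in> {1..2 * L}" using permutes_in_image[OF prm, of t] pt True ab by auto
      define k0 where "k0 = (t + 1) div 2"
      have k0: "k0 \<in> {1..L}" "t = 2 * k0 - 1 \<or> t = 2 * k0" using tr by (auto simp: k0_def)
      have pb: "b = p x \<longleftrightarrow> x = t" for x using inj[of t x] pt by auto
      show ?thesis
      proof (rule gl_act_prod_list_single[where ?x0.0 = k0])
        show "k0 \<in> set [1..<L + 1]" using k0 by auto
        fix k assume k: "k \<in> set [1..<L + 1]" "k \<noteq> k0"
        then have kL: "k \<in> {1..L}" by auto
        have "2 * k - 1 \<noteq> t" "2 * k \<noteq> t" using k0 k(2) kL by auto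
        then show "?D (Delta_xi m (p (2 * k - 1)) (p (2 * k))) = 0
            \<and> Delta_xi m ((?r \<circ> p) (2 * k - 1)) ((?r \<circ> p) (2 * k)) = Delta_xi m (p (2 * k - 1)) (p (2 * k))"
          unfolding D[OF p kL] by (simp add: pb pb[unfolded eq_commute[of b]])
      next
        have ne: "2 * k0 - 1 \<noteq> 2 * k0" using k0 by auto
        show "?D (Delta_xi m (p (2 * k0 - 1)) (p (2 * k0))) = Delta_xi m ((?r \<circ> p) (2 * k0 - 1)) ((?r \<circ> p) (2 * k0))"
          unfolding D[OF p k0(1)] using k0(2) ne by (auto simp: pb pb[unfolded eq_commute[of b]])
      qed auto
    qed
    then have "?D (Gamma m (2 * L)) = (\<Sum>p\<in>pairings L. of_int (sign p) * pair_prod m L (?r \<circ> p))"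
      by (simp add: Gamma_even gl_act_sum gl_act_of_int_mult)
    also have "\<dots> = 0" using sum_pairings_equal_index[OF ab(1,2) True] by simp
    finally show ?thesis .
  qed
qed

lemma ext_coeff_one_body [simp]: "ext_coeff (1 :: superpoly) {} = 1"
  unfolding one_ext_alg_def ext_coeff_monom by simp

lemma ext_coeff_prod_list_body: "ext_coeff (\<Prod>x\<leftarrow>xs. F x :: superpoly) {} = (\<Prod>x\<leftarrow>xs. ext_coeff (F x) {})"
  by (induction xs) (simp_all add: ext_coeff_mult_body)

lemma Delta_xi_body: "k < l \<Longrightarrow> ext_coeff (Delta_xi m k l) {} = - detX m * pvar (YY k l)"
proof -
  assume "k < l"
  have "ext_coeff (odd_var a b) {} = 0" for a b by (simp add: odd_var_def ext_coeff_monom)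
  then show ?thesis using \<open>k < l\<close> unfolding Delta_xi_eq
    by (simp add: ext_coeff_mult_body ext_coeff_monom yvar_def even_var_def)
qed

lemma prod_pvar: "(\<Prod>k\<in>A. pvar (e k)) = single (\<Sum>k\<in>A. single (e k) 1) 1"
  by (induction A rule: infinite_finite_induct) (simp_all add: mult_single)

text \<open>
  A strictly increasing map of \<open>{1..L}\<close> into itself can neither fall behind nor get ahead.
\<close>

lemma increasing_self_map:
  assumes J: "\<And>k. k \<in> {1..L} \<Longrightarrow> J k \<in> {1..L::nat}" and mono: "\<And>k. 1 \<le> k \<Longrightarrow> k < L \<Longrightarrow> J k < J (k + 1)"
    and k: "k \<in> {1..L}"
  shows "J k = k"
proof -
  have lower: "k \<le> J k" if "1 \<le> k" "k \<le> L" for k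
    using that
  proof (induction k rule: nat_induct_at_least)
    case base
    then show ?case using J[of 1] by simp
  next
    case (Suc k)
    then show ?case using mono[of k] by simp
  qed
  have upper: "J (L - d) \<le> L - d" if "d < L" for d
    using that
  proof (induction d)
    case 0
    then show ?case using J[of L] by simp
  next
    case (Suc d)
    have e: "L - Suc d + 1 = L - d" using Suc(2) by simp
    have "J (L - Suc d) < J (L - d)" using mono[of "L - Suc d"] Suc(2) unfolding e by simp
    then show ?case using Suc by simp
  qed
  show ?thesis using lower[of k] upper[of "L - k"] k by simp
qed

text \<open>
  The pairs \<open>(1, 2), (3, 4), \<dots>\<close> can be listed in increasing order in one way only.
\<close>

lemma pairing_eq_id:
  assumes p: "p \<in> pairings L" and j: "\<And>k. k \<in> {1..L} \<Longrightarrow> \<exists>j\<in>{1..L}. p (2 * k - 1) = 2 * j - 1 \<and> p (2 * k) = 2 * j"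
  shows "p = id"
proof
  obtain J where J: "\<And>k. k \<in> {1..L} \<Longrightarrow> J k \<in> {1..L} \<and> p (2 * k - 1) = 2 * J k - 1 \<and> p (2 * k) = 2 * J k"
    using j by metis
  have "J k < J (k + 1)" if "1 \<le> k" "k < L" for k
    using pairings_pos(2)[OF p that] J[of k] J[of "k + 1"] that by auto
  then have Jk: "J k = k" if "k \<in> {1..L}" for k
    using increasing_self_map[of L J k] J that by blast
  fix x show "p x = id x"
  proof (cases "x \<in> {1..2 * L}")
    case True
    define k where "k = (x + 1) div 2"
    have "k \<in> {1..L}" "x = 2 * k - 1 \<or> x = 2 * k" using True by (auto simp: k_def)
    then show ?thesis using J[of k] Jk[of k] by auto
  next
    case False
    then show ?thesis using p by (auto simp: pairings_def intro: permutes_not_in)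
  qed
qed

lemma id_pairing: "id \<in> pairings L"
  by (auto simp: pairings_def permutes_id)

text \<open>The part of \<open>\<Gamma>(2l)\<close> without odd variables is, up to sign, a power of \<open>det X\<close> times the Pfaffian of \<open>(y\<^sub>k\<^sub>l)\<close>, in which the monomial
  \<open>y\<^sub>1\<^sub>2 y\<^sub>3\<^sub>4 \<cdots>\<close> belongs to one pairing only.\<close>

lemma Gamma_body_nonzero: "ext_coeff (Gamma m (2 * L)) {} \<noteq> 0"
proof -
  define M where "M p = (\<Sum>k = 1..L. single (YY (p (2 * k - 1)) (p (2 * k))) (1::nat))" for p
  have oi: "ext_coeff (of_int k :: superpoly) {} = of_int k" for k
    by (simp add: ext_coeff_monom flip: emb_of_int)
  have finP: "finite (pairings L)"
    by (rule finite_subset[OF _ finite_permutes[of "2 * L"]]) (auto simp: pairings_def)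
  have body: "ext_coeff (pair_prod m L p) {} = (- detX m) ^ L * single (M p) 1" if p: "p \<in> pairings L" for p
  proof -
    have "ext_coeff (pair_prod m L p) {} = (\<Prod>k = 1..L. ext_coeff (Delta_xi m (p (2 * k - 1)) (p (2 * k))) {})"
      unfolding ext_coeff_prod_list_body prod_list_interval ..
    also have "\<dots> = (\<Prod>k = 1..L. - detX m * pvar (YY (p (2 * k - 1)) (p (2 * k))))"
      by (intro prod.cong refl Delta_xi_body pairings_pos(1)[OF p])
    also have "\<dots> = (- detX m) ^ L * single (M p) 1"
      by (simp only: prod.distrib prod_pvar M_def prod_constant card_atLeastAtMost) simp
    finally show ?thesis .
  qed
  define P where "P = (\<Sum>p\<in>pairings L. of_int (sign p) * (single (M p) 1 :: even_poly))"
  have "ext_coeff (Gamma m (2 * L)) {} = (\<Sum>p\<in>pairings L. of_int (sign p) * ((- detX m) ^ L * single (M p) 1))"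
    unfolding Gamma_even ext_coeff_sum by (intro sum.cong refl) (simp only: ext_coeff_mult_body oi body)
  also have "\<dots> = (- detX m) ^ L * P"
    unfolding P_def sum_distrib_left by (intro sum.cong refl) (simp add: mult_ac)
  finally have e: "ext_coeff (Gamma m (2 * L)) {} = (- detX m) ^ L * P" .
  have M_id: "p = id" if p: "p \<in> pairings L" "M p = M id" for p
  proof (rule pairing_eq_id[OF p(1)])
    fix k assume k: "k \<in> {1..L}"
    let ?e = "YY (p (2 * k - 1)) (p (2 * k))"
    have "lookup (M p) ?e \<ge> lookup (single ?e (1::nat)) ?e"
      unfolding M_def lookup_sum by (rule member_le_sum[OF k]) auto
    then have "lookup (M id) ?e \<noteq> 0" using p(2) by simp
    then obtain j where j: "j \<in> {1..L}" "lookup (single (YY (2 * j - 1) (2 * j)) (1::nat)) ?e \<noteq> 0"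
      unfolding M_def lookup_sum by (auto elim: sum.not_neutral_contains_not_neutral)
    then show "\<exists>j\<in>{1..L}. p (2 * k - 1) = 2 * j - 1 \<and> p (2 * k) = 2 * j"
      by (intro bexI[OF _ j(1)]) (simp add: lookup_single when_def split: if_splits)
  qed
  have "lookup P (M id) = (\<Sum>p\<in>pairings L. if p = id then 1 else 0)"
    unfolding P_def lookup_sum
  proof (intro sum.cong refl)
    fix p assume p: "p \<in> pairings L"
    have "of_int (sign p) = (single 0 (of_int (sign p)) :: even_poly)" by simp
    then show "lookup (of_int (sign p) * (single (M p) 1 :: even_poly)) (M id) = (if p = id then 1 else 0)"
      using M_id[OF p] by (simp only: lookup_const_mult lookup_single when_def) (auto simp: sign_id)
  qed
  also have "\<dots> = 1" using finP id_pairing by (simp add: sum.delta)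
  finally have "P \<noteq> 0" by auto
  then show ?thesis unfolding e using detX_nonzero by simp
qed

lemma hwv_Gamma:
  assumes L: "2 * L \<le> n"
  shows "hwv m n (\<lambda>b. case b of Bx i \<Rightarrow> of_nat (2 * L) | Bxi j \<Rightarrow> of_bool (j \<le> 2 * L)) (Gamma m (2 * L))"
  unfolding hwv_def
proof (intro conjI)
  have rng: "p (2 * k - 1) \<in> {1..n}" "p (2 * k) \<in> {1..n}" if "p \<in> pairings L" "k \<in> {1..L}" for p k
    using pairings_in_range[OF that] L by auto
  have setL: "k \<in> set [1..<L + 1] \<longleftrightarrow> k \<in> {1..L}" for k by auto
  show "Gamma m (2 * L) \<in> SS m n"
    unfolding Gamma_even by (intro SS_sum SS_mult SS_of_int SS_prod_list SS_Delta_xi rng) (auto simp del: One_nat_def)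
  show "Gamma m (2 * L) \<noteq> 0" using Gamma_body_nonzero[of m L] by auto
  have sc: "gl_act m n u v (Gamma m (2 * L)) = const w * Gamma m (2 * L)"
    if "\<And>p. p \<in> pairings L \<Longrightarrow> gl_act m n u v (pair_prod m L p) = const w * pair_prod m L p" for u v w
    using that unfolding Gamma_even
    by (simp add: gl_act_sum gl_act_of_int_mult sum_distrib_left mult.assoc[symmetric] const_central)
  have x: "gl_act m n (Bx a) (Bx b) (Gamma m (2 * L)) = const (of_bool (a = b) * of_nat (2 * L)) * Gamma m (2 * L)"
    if "a \<in> {1..m}" "b \<in> {1..m}" for a b
  proof (rule sc)
    fix p assume p: "p \<in> pairings L"
    have "gl_act m n (Bx a) (Bx b) (pair_prod m L p)
        = const (\<Sum>k\<leftarrow>[1..<L + 1]. 2 * of_bool (a = b)) * pair_prod m L p"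
    proof (rule gl_act_prod_list_eigen)
      fix k assume "k \<in> set [1..<L + 1]"
      then have k: "k \<in> {1..L}" by auto
      show "gl_act m n (Bx a) (Bx b) (Delta_xi m (p (2 * k - 1)) (p (2 * k)))
          = const (2 * of_bool (a = b)) * Delta_xi m (p (2 * k - 1)) (p (2 * k))"
        using gl_act_Delta_xi_x[OF that rng[OF p k]] by (simp add: of_bool_def const_two)
    qed simp
    also have "(\<Sum>k\<leftarrow>[1..<L + 1]. 2 * of_bool (a = b)) = (of_bool (a = b) * of_nat (2 * L) :: complex)"
      by (simp add: sum_list_triv)
    finally show "gl_act m n (Bx a) (Bx b) (pair_prod m L p) = const (of_bool (a = b) * of_nat (2 * L)) * pair_prod m L p" .
  qed
  have xi: "gl_act m n (Bxi a) (Bxi a) (Gamma m (2 * L)) = const (of_bool (a \<le> 2 * L)) * Gamma m (2 * L)"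
    if a: "1 \<le> a" for a
  proof (rule sc)
    fix p assume p: "p \<in> pairings L"
    have prm: "p permutes {1..2 * L}" using p by (simp add: pairings_def)
    let ?w = "\<lambda>k. of_bool (a = p (2 * k - 1)) + of_bool (a = p (2 * k)) :: complex"
    have "gl_act m n (Bxi a) (Bxi a) (pair_prod m L p) = const (\<Sum>k\<leftarrow>[1..<L + 1]. ?w k) * pair_prod m L p"
    proof (rule gl_act_prod_list_eigen)
      fix k assume "k \<in> set [1..<L + 1]"
      then have k: "k \<in> {1..L}" by auto
      have lt: "p (2 * k - 1) < p (2 * k)" using pairings_pos(1)[OF p k] .
      show "gl_act m n (Bxi a) (Bxi a) (Delta_xi m (p (2 * k - 1)) (p (2 * k)))
          = const (?w k) * Delta_xi m (p (2 * k - 1)) (p (2 * k))"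
        unfolding gl_act_Delta_xi_xi[OF rng[OF p k]] using lt by (auto simp: of_bool_def const_add)
    qed simp
    also have "(\<Sum>k\<leftarrow>[1..<L + 1]. ?w k) = (\<Sum>k = 1..L. ?w k)"
      by (subst sum_list_distinct_conv_sum_set) (auto intro!: sum.cong)
    also have "\<dots> = (\<Sum>t = 1..2 * L. of_bool (a = p t))"
    proof -
      have "(\<Sum>k = 1..K. F (2 * k - 1) + F (2 * k)) = (\<Sum>t = 1..2 * K. F t)" for F :: "nat \<Rightarrow> complex" and K
        by (induction K) (simp_all add: add_ac)
      from this[of "\<lambda>t. of_bool (a = p t)" L] show ?thesis .
    qed
    also have "\<dots> = (\<Sum>t = 1..2 * L. of_bool (a = t))"
      by (rule sum.reindex_bij_betw[OF permutes_imp_bij[OF prm]])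
    also have "\<dots> = of_bool (a \<le> 2 * L)" using a by (auto simp: of_bool_def)
    finally show "gl_act m n (Bxi a) (Bxi a) (pair_prod m L p) = const (of_bool (a \<le> 2 * L)) * pair_prod m L p" .
  qed
  have xxi: "gl_act m n (Bx a) (Bxi b) (Gamma m (2 * L)) = 0" if a: "a \<in> {1..m}" for a b
  proof -
    have "gl_act m n (Bx a) (Bxi b) (pair_prod m L p) = 0" if p: "p \<in> pairings L" for p
    proof (rule gl_act_prod_list_zero)
      fix k assume "k \<in> set [1..<L + 1]"
      then have k: "k \<in> {1..L}" by auto
      show "gl_act m n (Bx a) (Bxi b) (Delta_xi m (p (2 * k - 1)) (p (2 * k))) = 0"
        by (rule gl_act_Delta_xi_odd[OF a rng[OF p k]])
    qed
    then show ?thesis by (simp add: Gamma_even gl_act_sum gl_act_of_int_mult)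
  qed
  show "singular m n (Gamma m (2 * L))"
    unfolding singular_def
  proof (intro conjI allI impI)
    fix i assume "1 \<le> i \<and> i < m"
    then show "gl_act m n (Bx i) (Bx (i + 1)) (Gamma m (2 * L)) = 0" using x[of i "i + 1"] by simp
  next
    fix j assume "1 \<le> j \<and> j < n"
    then show "gl_act m n (Bxi j) (Bxi (j + 1)) (Gamma m (2 * L)) = 0"
      using L by (intro gl_act_Gamma_raising) auto
  next
    assume "1 \<le> m \<and> 1 \<le> n"
    then show "gl_act m n (Bx m) (Bxi 1) (Gamma m (2 * L)) = 0" by (intro xxi) auto
  qed
  show "weight_vec m n (\<lambda>b. case b of Bx i \<Rightarrow> of_nat (2 * L) | Bxi j \<Rightarrow> of_bool (j \<le> 2 * L)) (Gamma m (2 * L))"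
    unfolding weight_vec_def
  proof
    fix b assume "b \<in> bvecs m n"
    then show "gl_act m n b b (Gamma m (2 * L)) = const (case b of Bx i \<Rightarrow> of_nat (2 * L) | Bxi j \<Rightarrow> of_bool (j \<le> 2 * L)) * Gamma m (2 * L)"
      using x xi by (cases b) auto
  qed
qed

section \<open>Bordered minors\<close>

lemma even_deriv_emb: "even_deriv e (emb p) = emb (poly_deriv e p)"
  by (rule ext_alg_eqI') (simp add: ext_coeff_even_deriv ext_coeff_monom poly_deriv_def)

lemma poly_deriv_mult: "poly_deriv e (p * q) = poly_deriv e p * q + p * poly_deriv e q"
proof -
  have "emb (poly_deriv e (p * q)) = emb (poly_deriv e p * q + p * poly_deriv e q)"
    by (simp add: emb_add emb_mult even_deriv_mult flip: even_deriv_emb)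
  then show ?thesis by simp
qed

lemma poly_deriv_add: "poly_deriv e (p + q) = poly_deriv e p + poly_deriv e q"
proof -
  have "emb (poly_deriv e (p + q)) = emb (poly_deriv e p + poly_deriv e q)"
    by (simp add: emb_add even_deriv_add flip: even_deriv_emb)
  then show ?thesis by simp
qed

lemma poly_deriv_zero [simp]: "poly_deriv e 0 = 0"
  by (simp add: poly_deriv_def)
lemma poly_deriv_single0: "poly_deriv e (single 0 c) = 0"
proof -
  have "emb (poly_deriv e (single 0 c)) = 0"
    by (simp flip: even_deriv_emb const_eq_emb)
  then show ?thesis by simp
qed
lemma poly_deriv_one [simp]: "poly_deriv e 1 = 0"
  using poly_deriv_single0[of e 1] by simp
lemma poly_deriv_scale: "poly_deriv e (single 0 c * p) = single 0 c * poly_deriv e p"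
  by (simp add: poly_deriv_mult poly_deriv_single0)
lemma poly_deriv_of_nat_mult: "poly_deriv e (of_nat k * p) = of_nat k * poly_deriv e p"
  using poly_deriv_scale[of e "of_nat k" p] by simp
lemma poly_deriv_of_int_mult: "poly_deriv e (of_int k * p) = of_int k * poly_deriv e p"
  using poly_deriv_scale[of e "of_int k" p] by simp
lemma poly_deriv_uminus: "poly_deriv e (- p) = - poly_deriv e p"
  using poly_deriv_of_int_mult[of e "- 1" p] by simp
lemma poly_deriv_diff: "poly_deriv e (p - q) = poly_deriv e p - poly_deriv e q"
  using poly_deriv_add[of e p "- q"] by (simp add: poly_deriv_uminus)
lemma poly_deriv_sum: "poly_deriv e (sum f A) = (\<Sum>x\<in>A. poly_deriv e (f x))"
  by (induction A rule: infinite_finite_induct) (auto simp: poly_deriv_add)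
lemma poly_deriv_prod_zero: "(\<And>x. x \<in> A \<Longrightarrow> poly_deriv e (f x) = 0) \<Longrightarrow> poly_deriv e (prod f A) = 0"
  by (induction A rule: infinite_finite_induct) (auto simp: poly_deriv_mult)

lemma poly_deriv_xp: "poly_deriv (XX a b) (xp i j) = of_bool (a = min i j \<and> b = max i j)"
proof -
  have "emb (poly_deriv (XX a b) (xp i j)) = emb (of_bool (a = min i j \<and> b = max i j))"
    by (simp add: even_deriv_xp of_bool_def flip: even_deriv_emb)
  then show ?thesis by (simp only: emb_eq_iff)
qed

lemma poly_deriv_pdet_cofactor_zero:
  assumes "\<And>i j. i \<in> {1..r} \<Longrightarrow> j \<in> {1..r} \<Longrightarrow> poly_deriv e (A i j) = 0"
  shows "poly_deriv e (pdet r A) = 0" "poly_deriv e (cofactor r A i q) = 0"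
proof -
  have "poly_deriv e (A p (\<tau> p)) = 0" if "\<tau> permutes {1..r}" "p \<in> {1..r}" for p \<tau>
    using assms that permutes_in_image[OF that(1)] by blast
  then show "poly_deriv e (pdet r A) = 0" "poly_deriv e (cofactor r A i q) = 0"
    unfolding pdet_def cofactor_def poly_deriv_sum poly_deriv_of_int_mult
    by (auto intro!: sum.neutral poly_deriv_prod_zero simp del: One_nat_def)
qed

lemma xp_row_cofX:
  assumes "i \<in> {1..r}" "p \<in> {1..r}"
  shows "(\<Sum>q = 1..r. xp p q * cofX r i q) = (if p = i then detX r else 0)"
    and "(\<Sum>q = 1..r. xp p q * cofX r q i) = (if p = i then detX r else 0)"
proof -
  show 1: "(\<Sum>q = 1..r. xp p q * cofX r i q) = (if p = i then detX r else 0)"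
    by (rule sum_row_cofactor_delta[OF assms])
  show "(\<Sum>q = 1..r. xp p q * cofX r q i) = (if p = i then detX r else 0)"
    unfolding 1[symmetric] by (intro sum.cong refl) (simp add: cofX_commute[OF _ assms(1)])
qed

lemma X_injective_poly:
  assumes Z: "\<And>p. p \<in> {1..r} \<Longrightarrow> (\<Sum>i = 1..r. xp p i * z i) = 0" and j: "j \<in> {1..r}"
  shows "z j = 0"
proof -
  have "emb (z j) = 0"
  proof (rule X_injective[OF _ j, of "\<lambda>i. emb (z i)"])
    fix p assume "p \<in> {1..r}"
    from arg_cong[OF Z[OF this], of emb] show "(\<Sum>i = 1..r. xvar p i * emb (z i)) = 0"
      by (simp add: emb_sum emb_mult emb_xp)
  qed
  then show ?thesis by simp
qed

text \<open>
  The last column of the adjugate of a bordered matrix.  The vector \<open>ct\<close> solves \<open>X ct = \<delta> e\<^sub>m\<close> by construction, and multiplying with the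
  adjugate identifies it with the last column of cofactors.  Its last entry is the smaller minor, whence \<open>\<delta> = det X\<close>.
\<close>

lemma bordered_column:
  defines "\<delta> r \<equiv> detX r * xp (Suc r) (Suc r) - (\<Sum>i = 1..r. \<Sum>j = 1..r. xp (Suc r) i * (cofX r i j * xp j (Suc r)))"
  shows "detX (Suc r) = \<delta> r"
    and "j \<in> {1..r} \<Longrightarrow> cofX (Suc r) j (Suc r) = - (\<Sum>i = 1..r. cofX r j i * xp i (Suc r))"
proof -
  let ?m = "Suc r"
  \<comment> \<open>the first \<open>r\<close> entries are chosen so that the first \<open>r\<close> rows of \<open>X ct\<close> vanish\<close>
  define ct where "ct i = (if i = ?m then detX r else - (\<Sum>j = 1..r. cofX r i j * xp j ?m))" for i
  have split: "(\<Sum>i = 1..?m. F i) = (\<Sum>i = 1..r. F i) + F ?m" for F :: "nat \<Rightarrow> even_poly" by simp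
  have ct_r: "(\<Sum>i = 1..r. xp p i * ct i) = - (\<Sum>i = 1..r. \<Sum>j = 1..r. xp p i * (cofX r i j * xp j ?m))" for p
    unfolding sum_negf[symmetric] by (intro sum.cong refl) (auto simp: ct_def sum_distrib_left sum_negf)
  have Xct: "(\<Sum>i = 1..?m. xp p i * ct i) = (if p = ?m then \<delta> r else 0)" if p: "p \<in> {1..?m}" for p
  proof (cases "p = ?m")
    case True
    then show ?thesis unfolding split ct_r by (simp add: \<delta>_def ct_def)
  next
    case False
    then have pr: "p \<in> {1..r}" using p by auto
    have "(\<Sum>i = 1..r. \<Sum>j = 1..r. xp p i * (cofX r i j * xp j ?m))
        = (\<Sum>j = 1..r. (\<Sum>i = 1..r. xp p i * cofX r i j) * xp j ?m)"
      by (subst sum.swap) (simp add: sum_distrib_right mult.assoc)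
    also have "\<dots> = (\<Sum>j = 1..r. (if p = j then detX r else 0) * xp j ?m)"
      by (intro sum.cong refl) (simp only: xp_row_cofX(2)[OF _ pr])
    also have "\<dots> = detX r * xp p ?m"
      using pr by (simp add: if_distrib[of "\<lambda>x. x * _"] sum.delta' cong: if_cong)
    finally show ?thesis unfolding split ct_r using False by (simp add: ct_def)
  qed
  have key: "detX ?m * ct j = cofX ?m j ?m * \<delta> r" if j: "j \<in> {1..?m}" for j
  proof -
    have "(\<Sum>p = 1..?m. cofX ?m j p * (\<Sum>i = 1..?m. xp p i * ct i)) = (\<Sum>p = 1..?m. if p = ?m then cofX ?m j p * \<delta> r else 0)"
      by (intro sum.cong refl) (simp only: Xct mult_zero_right if_distrib[of "\<lambda>x. _ * x"])
    also have "\<dots> = cofX ?m j ?m * \<delta> r" by (simp del: sum.cl_ivl_Suc)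
    finally have 1: "(\<Sum>p = 1..?m. cofX ?m j p * (\<Sum>i = 1..?m. xp p i * ct i)) = cofX ?m j ?m * \<delta> r" .
    have "(\<Sum>p = 1..?m. cofX ?m j p * (\<Sum>i = 1..?m. xp p i * ct i))
        = (\<Sum>i = 1..?m. (\<Sum>p = 1..?m. xp i p * cofX ?m j p) * ct i)"
      unfolding sum_distrib_left sum_distrib_right
      by (subst sum.swap) (intro sum.cong refl, simp add: mult_ac xp_commute)
    also have "\<dots> = (\<Sum>i = 1..?m. (if i = j then detX ?m else 0) * ct i)"
      by (intro sum.cong refl) (simp only: xp_row_cofX(1)[OF j])
    also have "\<dots> = detX ?m * ct j"
      using j by (simp add: if_distrib[of "\<lambda>x. x * _"] sum.delta cong: if_cong del: sum.cl_ivl_Suc)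
    finally show ?thesis using 1 by simp
  qed
  have "detX ?m * detX r = detX r * \<delta> r" using key[of ?m] by (simp add: ct_def cofactor_last)
  then show d: "detX (Suc r) = \<delta> r" using detX_nonzero[of r] by (simp add: mult.commute)
  show "cofX (Suc r) j (Suc r) = - (\<Sum>i = 1..r. cofX r j i * xp i (Suc r))" if j: "j \<in> {1..r}"
  proof -
    have "detX ?m * ct j = detX ?m * cofX ?m j ?m" using key[of j] j by (simp add: d mult.commute)
    then have "ct j = cofX ?m j ?m" using detX_nonzero[of ?m] by simp
    then show ?thesis using j by (simp add: ct_def)
  qed
qed

text \<open>
  Jacobi's identity for complementary minors, in the case of two rows and two columns one of which is the last:
  the \<open>2 \<times> 2\<close> minors of the adjugate are multiples of \<open>det X\<close>.
\<close>

lemma cofactor_product: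
  assumes iq: "i \<in> {1..Suc r}" "q \<in> {1..Suc r}"
  shows "detX r * cofX (Suc r) i q = cofX (Suc r) i (Suc r) * cofX (Suc r) q (Suc r)
           + detX (Suc r) * (if i \<le> r \<and> q \<le> r then cofX r i q else 0)"
proof -
  let ?m = "Suc r"
  let ?c = "\<lambda>i q. if i \<le> r \<and> q \<le> r then cofX r i q else 0"
  define z where "z i = detX r * cofX ?m i q - (cofX ?m i ?m * cofX ?m q ?m + detX ?m * ?c i q)" for i
  have split: "(\<Sum>i = 1..?m. F i) = (\<Sum>i = 1..r. F i) + F ?m" for F :: "nat \<Rightarrow> even_poly" by simp
  have "z i = 0"
  proof (rule X_injective_poly[OF _ iq(1), of z])
    fix p assume p: "p \<in> {1..?m}"
    have "(\<Sum>i = 1..?m. xp p i * z i) = detX r * (\<Sum>i = 1..?m. xp p i * cofX ?m i q)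
       - ((\<Sum>i = 1..?m. xp p i * cofX ?m i ?m) * cofX ?m q ?m + detX ?m * (\<Sum>i = 1..?m. xp p i * ?c i q))"
      unfolding z_def right_diff_distrib distrib_left sum.distrib sum_subtractf sum_distrib_left sum_distrib_right
      by (simp only: mult_ac)
    also have "(\<Sum>i = 1..?m. xp p i * cofX ?m i q) = (if p = q then detX ?m else 0)"
      by (rule xp_row_cofX(2)[OF iq(2) p])
    also have "(\<Sum>i = 1..?m. xp p i * cofX ?m i ?m) = (if p = ?m then detX ?m else 0)"
      by (rule xp_row_cofX(2)[OF _ p]) simp
    also have c: "(\<Sum>i = 1..?m. xp p i * ?c i q)
        = (if q = ?m then 0 else if p = ?m then - cofX ?m q ?m else if p = q then detX r else 0)"
    proof (cases "q = ?m")
      case True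
      then show ?thesis by (auto intro!: sum.neutral)
    next
      case False
      then have q: "q \<in> {1..r}" using iq by auto
      have "(\<Sum>i = 1..?m. xp p i * ?c i q) = (\<Sum>i = 1..r. xp p i * cofX r i q)"
        unfolding split using q by auto
      also have "\<dots> = (if p = ?m then - cofX ?m q ?m else if p = q then detX r else 0)"
      proof (cases "p = ?m")
        case True
        have "(\<Sum>i = 1..r. xp ?m i * cofX r i q) = (\<Sum>i = 1..r. cofX r q i * xp i ?m)"
          by (intro sum.cong refl) (simp add: cofX_commute[OF _ q] xp_commute mult.commute)
        then show ?thesis using bordered_column(2)[OF q] True by simp
      next
        case F: False
        then have "p \<in> {1..r}" using p by auto
        then show ?thesis using F xp_row_cofX(2)[OF q] by simp
      qed
      finally show ?thesis using False by simp
    qed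
    finally have e: "(\<Sum>i = 1..?m. xp p i * z i) = detX r * (if p = q then detX ?m else 0)
       - ((if p = ?m then detX ?m else 0) * cofX ?m q ?m
          + detX ?m * (if q = ?m then 0 else if p = ?m then - cofX ?m q ?m else if p = q then detX r else 0))" .
    show "(\<Sum>i = 1..?m. xp p i * z i) = 0"
      unfolding e using iq p by (auto simp: cofactor_last)
  qed
  then show ?thesis by (simp add: z_def)
qed

section \<open>Consecutive leading minors are coprime\<close>

lemma single_inverse_of_nat: "k \<noteq> 0 \<Longrightarrow> single 0 (1 / of_nat k) * of_nat k = (1 :: even_poly)"
proof -
  assume "k \<noteq> 0"
  then have "single 0 (1 / of_nat k) * single 0 (of_nat k) = (1 :: even_poly)"
    by (simp add: mult_single del: single_of_nat)
  then show ?thesis by (simp only: single_of_nat)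
qed

lemma poly_deriv_funpow_zero: "\<exists>d. (poly_deriv e ^^ d) p = 0"
proof -
  have nz: "lookup p (\<alpha> + single e k) \<noteq> 0"
    if "lookup ((poly_deriv e ^^ k) p) \<alpha> \<noteq> 0" for k \<alpha>
    using that
  proof (induction k arbitrary: \<alpha>)
    case (Suc k)
    then have "lookup ((poly_deriv e ^^ k) p) (\<alpha> + single e 1) \<noteq> 0"
      by (auto simp only: funpow.simps o_apply lookup_poly_deriv mult_eq_0_iff)
    from Suc.IH[OF this] show ?case by (simp add: add.assoc flip: single_add)
  qed simp
  define d where "d = Suc (\<Sum>\<alpha>\<in>keys p. lookup \<alpha> e)"
  have "(poly_deriv e ^^ d) p = 0"
  proof (rule poly_mapping_eqI, rule ccontr)
    fix \<alpha> assume "lookup ((poly_deriv e ^^ d) p) \<alpha> \<noteq> lookup 0 \<alpha>"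
    then have k: "\<alpha> + single e d \<in> keys p" using nz by (simp add: in_keys_iff)
    have "d \<le> lookup (\<alpha> + single e d) e" by (simp add: lookup_add)
    also have "\<dots> \<le> (\<Sum>\<alpha>\<in>keys p. lookup \<alpha> e)"
      by (rule member_le_sum[OF k]) auto
    finally show False by (simp add: d_def)
  qed
  then show ?thesis ..
qed

lemma poly_deriv_funpow_mult:
  assumes "poly_deriv e a = 0"
  shows "(poly_deriv e ^^ k) (a * p) = a * (poly_deriv e ^^ k) p"
  using assms by (induction k) (simp_all add: poly_deriv_mult)

lemma poly_deriv_funpow_diff: "(poly_deriv e ^^ k) (p - q) = (poly_deriv e ^^ k) p - (poly_deriv e ^^ k) q"
  by (induction k) (simp_all add: poly_deriv_diff)

lemma poly_deriv_pvar_power: "poly_deriv e (pvar e ^ Suc k) = of_nat (Suc k) * pvar e ^ k"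
proof (induction k)
  have v: "poly_deriv e (pvar e) = 1"
  proof -
    have "even_deriv e (even_var e) = 1"
      using even_deriv_even_var_mult[of e e 1] by (simp add: even_deriv_const[of e 1, unfolded const_one])
    then have "emb (poly_deriv e (pvar e)) = emb 1" by (simp only: even_var_eq_emb even_deriv_emb emb_one)
    then show ?thesis by (simp only: emb_eq_iff)
  qed
  case 0
  show ?case using v by simp
  case (Suc k)
  have "poly_deriv e (pvar e ^ Suc (Suc k)) = poly_deriv e (pvar e) * pvar e ^ Suc k + pvar e * poly_deriv e (pvar e ^ Suc k)"
    unfolding power_Suc[of "pvar e" "Suc k"] by (rule poly_deriv_mult)
  also have "\<dots> = of_nat (Suc (Suc k)) * pvar e ^ Suc k" unfolding v Suc by (simp add: algebra_simps)
  finally show ?case .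
qed

lemma poly_deriv_funpow_power:
  assumes "poly_deriv e h = 0"
  shows "(poly_deriv e ^^ d) (pvar e ^ d * h) = of_nat (fact d) * h"
proof (induction d)
  case (Suc d)
  have "(poly_deriv e ^^ Suc d) (pvar e ^ Suc d * h) = (poly_deriv e ^^ d) (poly_deriv e (pvar e ^ Suc d * h))"
    by (simp only: funpow_Suc_right o_apply)
  also have "poly_deriv e (pvar e ^ Suc d * h) = of_nat (Suc d) * (pvar e ^ d * h)"
    unfolding poly_deriv_mult poly_deriv_pvar_power assms by (simp add: mult.assoc)
  also have "(poly_deriv e ^^ d) \<dots> = of_nat (Suc d) * (poly_deriv e ^^ d) (pvar e ^ d * h)"
    by (rule poly_deriv_funpow_mult) (use poly_deriv_of_nat_mult[of e "Suc d" 1] in simp)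
  also have "\<dots> = of_nat (fact (Suc d)) * h" unfolding Suc by (simp add: algebra_simps)
  finally show ?case .
qed simp

lemma poly_deriv_of_nat: "poly_deriv e (of_nat k) = 0"
  using poly_deriv_of_nat_mult[of e k 1] by simp

text \<open>
  The Leibniz formula for higher derivatives, which has three terms when the third derivative of \<open>D\<close> vanishes.
\<close>

lemma poly_deriv_funpow_quadratic:
  assumes D: "poly_deriv e D = D1" "poly_deriv e D1 = - (2 * E)" "poly_deriv e E = 0"
  shows "(poly_deriv e ^^ (k + 2)) (D * g) = D * (poly_deriv e ^^ (k + 2)) g
     + of_nat (k + 2) * D1 * (poly_deriv e ^^ (k + 1)) g - of_nat ((k + 2) * (k + 1)) * E * (poly_deriv e ^^ k) g"
proof (induction k)
  case 0
  show ?case by (simp add: numeral_2_eq_2 poly_deriv_mult poly_deriv_add D algebra_simps)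
next
  case (Suc k)
  let ?d = "poly_deriv e"
  have "(?d ^^ (Suc k + 2)) (D * g) = ?d ((?d ^^ (k + 2)) (D * g))" by simp
  also have "\<dots> = D1 * (?d ^^ (k + 2)) g + D * (?d ^^ (k + 3)) g
      + of_nat (k + 2) * (- (2 * E) * (?d ^^ (k + 1)) g + D1 * (?d ^^ (k + 2)) g)
      - of_nat ((k + 2) * (k + 1)) * (E * (?d ^^ (k + 1)) g)"
    unfolding Suc poly_deriv_add poly_deriv_diff poly_deriv_mult poly_deriv_of_nat D
    by (simp add: numeral_3_eq_3 algebra_simps)
  also have "\<dots> = D * (?d ^^ (Suc k + 2)) g + of_nat (Suc k + 2) * D1 * (?d ^^ (Suc k + 1)) g
      - of_nat ((Suc k + 2) * (Suc k + 1)) * E * (?d ^^ Suc k) g"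
    by (simp add: algebra_simps numeral_3_eq_3)
  finally show ?case .
qed

text \<open>
  As a polynomial in \<open>z = x\<^sub>r\<^sub>+\<^sub>1\<^sub>,\<^sub>r\<^sub>+\<^sub>2\<close>, the minor \<open>\<Delta>\<^sub>r\<^sub>+\<^sub>2\<close> is quadratic with leading coefficient \<open>-\<Delta>\<^sub>r\<close>, while \<open>\<Delta>\<^sub>r\<^sub>+\<^sub>1\<close>
  does not contain \<open>z\<close>.  Comparing leading coefficients in \<open>z\<close> therefore reduces coprimality of
  \<open>\<Delta>\<^sub>r\<^sub>+\<^sub>1\<close> and \<open>\<Delta>\<^sub>r\<^sub>+\<^sub>2\<close> to that of \<open>\<Delta>\<^sub>r\<close> and \<open>\<Delta>\<^sub>r\<^sub>+\<^sub>1\<close>.  Leading coefficients are extracted by derivatives.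
\<close>

lemma minors_coprime:
  "detX r * f = detX (Suc r) * g \<Longrightarrow> detX (Suc r) dvd f"
proof (induction r arbitrary: f g)
  case 0
  then show ?case by simp
next
  case (Suc r)
  let ?m = "Suc (Suc r)"
  define z where "z = XX (Suc r) ?m"
  let ?d = "poly_deriv z"
  define a where "a = detX (Suc r)"
  define D where "D = detX ?m"
  define D1 where "D1 = - (\<Sum>j = 1..Suc r. cofX (Suc r) (Suc r) j * xp j ?m) - (\<Sum>i = 1..Suc r. xp ?m i * cofX (Suc r) i (Suc r))"
  have xz: "?d (xp i j) = 0" if "i \<in> {1..Suc r}" "j \<in> {1..Suc r}" for i j
    using that by (simp add: z_def poly_deriv_xp max_def)
  have da: "?d a = 0" unfolding a_def by (rule poly_deriv_pdet_cofactor_zero(1)[OF xz])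
  have dc: "?d (cofX (Suc r) i j) = 0" for i j by (rule poly_deriv_pdet_cofactor_zero(2)[OF xz])
  have dx: "?d (xp ?m i) = of_bool (i = Suc r)" "?d (xp i ?m) = of_bool (i = Suc r)" if "i \<in> {1..Suc r}" for i
    using that by (auto simp: z_def poly_deriv_xp min_def max_def)
  have dmm: "?d (xp ?m ?m) = 0" by (simp add: z_def poly_deriv_xp)
  have sumb: "(\<Sum>i = 1..Suc r. of_bool (i = Suc r) * F i) = F (Suc r)" for F :: "nat \<Rightarrow> even_poly"
    by (simp add: of_bool_def if_distrib[of "\<lambda>x. x * _"] sum.delta cong: if_cong del: sum.cl_ivl_Suc)
  have dD: "?d D = D1"
  proof -
    have t: "?d (xp ?m i * (cofX (Suc r) i j * xp j ?m))
        = of_bool (i = Suc r) * (cofX (Suc r) i j * xp j ?m) + of_bool (j = Suc r) * (xp ?m i * cofX (Suc r) i j)"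
      if "i \<in> {1..Suc r}" "j \<in> {1..Suc r}" for i j
      unfolding poly_deriv_mult dc dx(1)[OF that(1)] dx(2)[OF that(2)] by (simp add: algebra_simps)
    have "?d (\<Sum>i = 1..Suc r. \<Sum>j = 1..Suc r. xp ?m i * (cofX (Suc r) i j * xp j ?m))
        = (\<Sum>i = 1..Suc r. \<Sum>j = 1..Suc r. of_bool (i = Suc r) * (cofX (Suc r) i j * xp j ?m)
        + of_bool (j = Suc r) * (xp ?m i * cofX (Suc r) i j))"
      unfolding poly_deriv_sum by (intro sum.cong refl t)
    then have "?d D = - (\<Sum>i = 1..Suc r. \<Sum>j = 1..Suc r. of_bool (i = Suc r) * (cofX (Suc r) i j * xp j ?m)
        + of_bool (j = Suc r) * (xp ?m i * cofX (Suc r) i j))"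
      unfolding D_def bordered_column(1)[of "Suc r"] poly_deriv_diff a_def[symmetric] poly_deriv_mult[of z a] da dmm
      by simp
    also have "\<dots> = - ((\<Sum>j = 1..Suc r. \<Sum>i = 1..Suc r. of_bool (i = Suc r) * (cofX (Suc r) i j * xp j ?m))
        + (\<Sum>i = 1..Suc r. \<Sum>j = 1..Suc r. of_bool (j = Suc r) * (xp ?m i * cofX (Suc r) i j)))"
      unfolding sum.distrib by (subst sum.swap) (rule refl)
    also have "\<dots> = D1" unfolding sumb D1_def by simp
    finally show ?thesis .
  qed
  have dD1: "?d D1 = - (2 * detX r)"
  proof -
    have t1: "?d (cofX (Suc r) (Suc r) j * xp j ?m) = of_bool (j = Suc r) * cofX (Suc r) (Suc r) j"
      "?d (xp ?m j * cofX (Suc r) j (Suc r)) = of_bool (j = Suc r) * cofX (Suc r) j (Suc r)"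
      if "j \<in> {1..Suc r}" for j
      unfolding poly_deriv_mult dc dx(1)[OF that] dx(2)[OF that] by (simp_all add: algebra_simps)
    have "?d D1 = - (\<Sum>j = 1..Suc r. of_bool (j = Suc r) * cofX (Suc r) (Suc r) j)
        - (\<Sum>i = 1..Suc r. of_bool (i = Suc r) * cofX (Suc r) i (Suc r))"
      unfolding D1_def poly_deriv_diff poly_deriv_uminus poly_deriv_sum
      by (intro arg_cong2[of _ _ _ _ "(-)"] arg_cong[of _ _ uminus] sum.cong refl t1)
    then show ?thesis unfolding sumb by (simp add: cofactor_last)
  qed
  have dE: "?d (detX r) = 0" by (rule poly_deriv_pdet_cofactor_zero(1)) (use xz in auto)
  have nza: "a \<noteq> 0" "D \<noteq> 0" by (simp_all add: a_def D_def detX_nonzero)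
  have main: "a dvd g" if "(?d ^^ d) g = 0" "a * f = D * g" for d f g
    using that
  proof (induction d arbitrary: f g)
    case 0
    then show ?case by simp
  next
    case (Suc d)
    have z1: "(?d ^^ (d + 1)) g = 0" using Suc.prems(1) by simp
    then have z2: "(?d ^^ (d + 2)) g = 0" by (simp add: numeral_2_eq_2)
    let ?c = "of_nat ((d + 2) * (d + 1)) :: even_poly"
    have "a * (?d ^^ (d + 2)) f = (?d ^^ (d + 2)) (D * g)"
      unfolding Suc.prems(2)[symmetric] by (rule poly_deriv_funpow_mult[OF da, symmetric])
    also have "\<dots> = - (?c * detX r * (?d ^^ d) g)"
      unfolding poly_deriv_funpow_quadratic[OF dD dD1 dE] z1 z2 by simp
    finally have "detX r * (- (?c * (?d ^^ d) g)) = a * (?d ^^ (d + 2)) f" by (simp add: mult_ac)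
    then have "a dvd - (?c * (?d ^^ d) g)" unfolding a_def by (rule \<open>\<And>g f. detX r * f = detX (Suc r) * g \<Longrightarrow> detX (Suc r) dvd f\<close>)
    then have "a dvd ?c * (?d ^^ d) g" by simp
    then have "a dvd single 0 (1 / of_nat ((d + 2) * (d + 1))) * (?c * (?d ^^ d) g)" by (rule dvd_mult)
    moreover have "single 0 (1 / of_nat ((d + 2) * (d + 1))) * ?c = 1"
      by (rule single_inverse_of_nat) simp
    ultimately have "a dvd (?d ^^ d) g" by (simp only: mult.assoc[symmetric] mult_1_left)
    then obtain h where h: "(?d ^^ d) g = a * h" by blast
    have "a * ?d h = ?d (a * h)" using da by (simp add: poly_deriv_mult)
    also have "\<dots> = 0" using z1 unfolding h[symmetric] by simp
    finally have dh: "?d h = 0" using nza by simp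
    \<comment> \<open>\<open>a w\<close> is the leading term of \<open>g\<close> with respect to \<open>z\<close>, so subtracting it lowers the degree\<close>
    define w where "w = single 0 (1 / of_nat (fact d)) * (pvar z ^ d * h)"
    have "(?d ^^ d) w = single 0 (1 / of_nat (fact d)) * (of_nat (fact d) * h)"
      unfolding w_def by (subst poly_deriv_funpow_mult[OF poly_deriv_single0]) (simp only: poly_deriv_funpow_power[OF dh])
    also have "\<dots> = h"
      unfolding mult.assoc[symmetric] by (subst single_inverse_of_nat) simp_all
    finally have w: "(?d ^^ d) w = h" .
    have "(?d ^^ d) (g - a * w) = 0"
      unfolding poly_deriv_funpow_diff poly_deriv_funpow_mult[OF da] w h by simp
    moreover have "a * (f - D * w) = D * (g - a * w)"
      using Suc.prems(2) by (simp add: algebra_simps)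
    ultimately have "a dvd g - a * w" by (rule Suc.IH)
    then show ?case by (metis dvd_triv_left dvd_diffD1 dvd_add_times_triv_right_iff diff_add_cancel dvd_add)
  qed
  obtain d where "(?d ^^ d) g = 0" using poly_deriv_funpow_zero by blast
  then have "a dvd g" using main Suc.prems unfolding a_def D_def by blast
  then obtain h where "g = a * h" by blast
  then have "a * f = a * (D * h)" using Suc.prems unfolding a_def D_def by (simp add: mult_ac)
  then have "f = D * h" using nza by simp
  then show ?case by (simp add: D_def)
qed

lemma emb_dvd_coeffwise:
  assumes "\<And>S. p dvd ext_coeff f S"
  shows "\<exists>h. f = emb p * (h :: superpoly)"
proof -
  obtain H where H: "\<And>S. ext_coeff f S = p * H S" using assms unfolding dvd_def by metis
  define h where "h = (\<Sum>S | ext_coeff f S \<noteq> 0. ext_monom S (H S))"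
  have "f = emb p * h"
  proof (rule ext_alg_eqI)
    fix S :: "ovar set" assume S: "finite S"
    have "ext_coeff h S = (\<Sum>T | ext_coeff f T \<noteq> 0. if T = S then H S else 0)"
      unfolding h_def ext_coeff_sum using S by (intro sum.cong refl) (auto simp: ext_coeff_monom)
    then have "ext_coeff h S = (if ext_coeff f S \<noteq> 0 then H S else 0)" by (simp add: sum.delta)
    then show "ext_coeff f S = ext_coeff (emb p * h) S"
      using H[of S] by (auto simp: ext_coeff_scalar_mult)
  qed
  then show ?thesis ..
qed

lemma detX_cancel:
  assumes "emb (detX r) * f = emb (detX (Suc r)) * g"
  shows "\<exists>h. f = emb (detX (Suc r)) * h"
proof (rule emb_dvd_coeffwise)
  fix S
  have "detX r * ext_coeff f S = detX (Suc r) * ext_coeff g S"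
    using arg_cong[OF assms, of "\<lambda>x. ext_coeff x S"] by (simp add: ext_coeff_scalar_mult)
  then show "detX (Suc r) dvd ext_coeff f S" by (rule minors_coprime)
qed

text \<open>
  Divides by \<open>det X\<close> once at a time, and before each division removes the factors \<open>\<Delta>\<^sub>r\<close> once at a time.
\<close>

lemma detX_power_cancel:
  "emb (detX r) ^ p * f = emb (detX (Suc r)) ^ q * g \<Longrightarrow> \<exists>h. f = emb (detX (Suc r)) ^ q * h"
proof (induction q arbitrary: f g)
  case (Suc q)
  have step: "emb (detX r) ^ p * f = emb (detX (Suc r)) * G \<Longrightarrow> \<exists>h. f = emb (detX (Suc r)) * h" for p f G
  proof (induction p arbitrary: G)
    case (Suc p)
    then have "emb (detX r) * (emb (detX r) ^ p * f) = emb (detX (Suc r)) * G" by (simp add: mult.assoc)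
    from detX_cancel[OF this] Suc.IH show ?case by blast
  qed auto
  have "emb (detX r) ^ p * f = emb (detX (Suc r)) * (emb (detX (Suc r)) ^ q * g)"
    using Suc.prems by (simp add: mult.assoc)
  from step[OF this] obtain f1 where f1: "f = emb (detX (Suc r)) * f1" by blast
  have "emb (detX (Suc r)) * (emb (detX r) ^ p * f1) = emb (detX (Suc r)) * (emb (detX (Suc r)) ^ q * g)"
    using Suc.prems unfolding f1 by (simp add: emb_left_commute[of "emb (detX r) ^ p"] mult.assoc)
  then have "emb (detX r) ^ p * f1 = emb (detX (Suc r)) ^ q * g" by (rule emb_mult_cancel[OF detX_nonzero])
  from Suc.IH[OF this] obtain h where "f1 = emb (detX (Suc r)) ^ q * h" by blast
  then show ?case unfolding f1 by (auto simp: mult.assoc)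
qed auto

section \<open>Divisibility of products of Pfaffians by powers of the determinant\<close>

definition theta :: "nat \<Rightarrow> nat \<Rightarrow> superpoly" where
  "theta m k = (\<Sum>i = 1..m. emb (cofX m i m) * odd_var k i)"

lemma theta_commute: "f * theta m k = theta m k * twist f"
  unfolding theta_def sum_distrib_left sum_distrib_right
  by (intro sum.cong refl) (simp only: emb_left_commute[of f] odd_var_commute[of f] mult.assoc)

lemma theta_square: "theta m k * theta m k = 0"
proof -
  have "twist (theta m k) = - theta m k"
    by (simp add: theta_def twist_sum twist_mult sum_negf)
  then have "theta m k * theta m k = - (theta m k * theta m k)"
    using theta_commute[of "theta m k" m k] by simp
  then show ?thesis by (rule superpoly_eq_neg_0)
qed

lemma theta_word_repeated:
  assumes "\<not> distinct ks"
  shows "(\<Prod>k\<leftarrow>ks. theta m k) = 0"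
proof -
  obtain xs ys zs y where ks: "ks = xs @ [y] @ ys @ [y] @ zs" using not_distinct_decomp[OF assms] by blast
  have "theta m y * (P * theta m y) = 0" for P
  proof -
    have "theta m y * (P * theta m y) = theta m y * theta m y * twist P"
      by (simp only: theta_commute[of P] mult.assoc)
    then show ?thesis by (simp only: theta_square mult_zero_left)
  qed
  note 0 = this
  have "theta m y * (P * (theta m y * Z)) = 0" for P Z
  proof -
    have "theta m y * (P * (theta m y * Z)) = theta m y * (P * theta m y) * Z" by (simp only: mult.assoc)
    then show ?thesis by (simp only: 0 mult_zero_left)
  qed
  then show ?thesis unfolding ks by (simp add: mult.assoc)
qed

text \<open>
  Modulo \<open>det X\<close> the adjugate of \<open>X\<close> has rank one.  After multiplication by the corner minor, the quadratic form
  \<open>\<eta> (adj X) \<eta>\<^sup>T\<close> therefore becomes a product of two odd linear forms modulo \<open>det X\<close>.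
\<close>

lemma minor_Delta_xi:
  "\<exists>R. twist R = R \<and> emb (detX r) * Delta_xi (Suc r) k l
     = theta (Suc r) k * theta (Suc r) l + emb (detX (Suc r)) * R"
proof -
  let ?m = "Suc r" and ?o = "\<lambda>i q. odd_var k q * odd_var l i"
  let ?c = "\<lambda>i q. if i \<le> r \<and> q \<le> r then cofX r i q else 0"
  define R where "R = - (emb (detX r) * yvar k l) + (\<Sum>i = 1..?m. \<Sum>q = 1..?m. emb (?c i q) * ?o i q)"
  have tR: "twist R = R" unfolding R_def twist_add twist_uminus twist_mult twist_sum by simp
  have 1: "emb (detX r) * (emb (cofX ?m i q) * ?o i q)
      = emb (cofX ?m q ?m) * odd_var k q * (emb (cofX ?m i ?m) * odd_var l i) + emb (detX ?m) * (emb (?c i q) * ?o i q)"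
    if "i \<in> {1..?m}" "q \<in> {1..?m}" for i q
  proof -
    have "emb (detX r) * (emb (cofX ?m i q) * ?o i q) = emb (detX r * cofX ?m i q) * ?o i q"
      by (simp add: emb_mult mult.assoc)
    also have "\<dots> = emb (cofX ?m q ?m * cofX ?m i ?m + detX ?m * ?c i q) * ?o i q"
      unfolding cofactor_product[OF that] by (simp only: mult.commute)
    also have "\<dots> = emb (cofX ?m q ?m) * (emb (cofX ?m i ?m) * ?o i q) + emb (detX ?m) * (emb (?c i q) * ?o i q)"
      by (simp only: emb_add emb_mult distrib_right mult.assoc)
    also have "emb (cofX ?m i ?m) * ?o i q = odd_var k q * (emb (cofX ?m i ?m) * odd_var l i)"
      by (rule emb_left_commute[symmetric])
    finally show ?thesis by (simp only: mult.assoc)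
  qed
  have "(\<Sum>i = 1..?m. \<Sum>q = 1..?m. emb (detX r) * (emb (cofX ?m i q) * ?o i q))
      = (\<Sum>i = 1..?m. \<Sum>q = 1..?m. emb (cofX ?m q ?m) * odd_var k q * (emb (cofX ?m i ?m) * odd_var l i))
        + (\<Sum>i = 1..?m. \<Sum>q = 1..?m. emb (detX ?m) * (emb (?c i q) * ?o i q))"
    unfolding sum.distrib[symmetric] by (intro sum.cong refl 1)
  also have "(\<Sum>i = 1..?m. \<Sum>q = 1..?m. emb (cofX ?m q ?m) * odd_var k q * (emb (cofX ?m i ?m) * odd_var l i))
      = theta ?m k * theta ?m l"
    unfolding theta_def sum_product by (rule sum.swap)
  finally have S: "(\<Sum>i = 1..?m. \<Sum>q = 1..?m. emb (detX r) * (emb (cofX ?m i q) * ?o i q))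
      = theta ?m k * theta ?m l + (\<Sum>i = 1..?m. \<Sum>q = 1..?m. emb (detX ?m) * (emb (?c i q) * ?o i q))" .
  have "emb (detX r) * Delta_xi ?m k l = - (emb (detX ?m) * (emb (detX r) * yvar k l))
      + (\<Sum>i = 1..?m. \<Sum>q = 1..?m. emb (detX r) * (emb (cofX ?m i q) * ?o i q))"
    unfolding Delta_xi_eq distrib_left sum_distrib_left by (simp add: emb_left_commute[of "emb (detX r)" "detX ?m"] del: sum.cl_ivl_Suc)
  also have "\<dots> = theta ?m k * theta ?m l + emb (detX ?m) * R"
    unfolding S R_def distrib_left sum_distrib_left by (simp del: sum.cl_ivl_Suc)
  finally show ?thesis using tR by blast
qed

text \<open>
  The span of the elements \<open>(det X)\<^sup>j g \<theta>\<^sub>k\<^sub>1 \<cdots> \<theta>\<^sub>k\<^sub>2\<^sub>q\<close> with \<open>q + j \<ge> t\<close>.  The \<open>\<theta>\<close>'s anticommute, so that every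
  word with more than \<open>N\<close> letters vanishes.
\<close>

inductive theta_span :: "nat \<Rightarrow> nat \<Rightarrow> nat \<Rightarrow> superpoly \<Rightarrow> bool" for m N t where
  zero: "theta_span m N t 0"
| word: "length ks = 2 * q \<Longrightarrow> set ks \<subseteq> {1..N} \<Longrightarrow> t \<le> q + j \<Longrightarrow>
    theta_span m N t (emb (detX m) ^ j * (g * (\<Prod>k\<leftarrow>ks. theta m k)))"
| add: "theta_span m N t f \<Longrightarrow> theta_span m N t g \<Longrightarrow> theta_span m N t (f + g)"

lemma theta_span_mult_left: "theta_span m N t f \<Longrightarrow> theta_span m N t (h * f)"
proof (induction rule: theta_span.induct)
  case (word ks q j g)
  have "h * (emb (detX m) ^ j * (g * (\<Prod>k\<leftarrow>ks. theta m k))) = emb (detX m) ^ j * ((h * g) * (\<Prod>k\<leftarrow>ks. theta m k))"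
    by (simp add: emb_left_commute mult.assoc flip: emb_power)
  then show ?case using theta_span.word[OF word, of m "h * g"] by simp
qed (auto simp: distrib_left intro: theta_span.intros)

lemma theta_span_sum: "(\<And>x. x \<in> A \<Longrightarrow> theta_span m N t (f x)) \<Longrightarrow> theta_span m N t (sum f A)"
  by (induction A rule: infinite_finite_induct) (auto intro: theta_span.intros)

lemma theta_span_step:
  assumes "theta_span m N t f" "k \<in> {1..N}" "l \<in> {1..N}" "twist R = R"
  shows "theta_span m N (Suc t) (f * (theta m k * theta m l + emb (detX m) * R))"
  using assms(1)
proof (induction rule: theta_span.induct)
  case (word ks q j g)
  let ?W = "\<Prod>k\<leftarrow>ks. theta m k" and ?d = "emb (detX m)"
  have 1: "theta_span m N (Suc t) (?d ^ j * (g * (\<Prod>k\<leftarrow>ks @ [k, l]. theta m k)))"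
    by (rule theta_span.word[of _ "Suc q"]) (use word assms in auto)
  have 2: "theta_span m N (Suc t) (?d ^ Suc j * ((g * R) * ?W))"
    by (rule theta_span.word) (use word in auto)
  have "?d ^ j * (g * ?W) * (?d * R) = ?d ^ Suc j * ((g * R) * ?W)"
  proof -
    have "?d ^ j * (g * ?W) * (?d * R) = ?d * (?d ^ j * (g * ?W) * R)" by (rule emb_left_commute)
    also have "\<dots> = ?d * (?d ^ j * (g * (?W * R)))" by (simp only: mult.assoc)
    also have "?W * R = R * ?W" by (rule even_central[OF assms(4)])
    finally show ?thesis by (simp only: mult.assoc power_Suc)
  qed
  then have "?d ^ j * (g * ?W) * (theta m k * theta m l + ?d * R)
      = ?d ^ j * (g * (\<Prod>k\<leftarrow>ks @ [k, l]. theta m k)) + ?d ^ Suc j * ((g * R) * ?W)"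
    by (simp add: distrib_left mult.assoc)
  then show ?case using theta_span.add[OF 1 2] by simp
qed (auto simp: distrib_right intro: theta_span.intros)

text \<open>
  A word with \<open>2q\<close> different letters has \<open>q \<le> N/2\<close>, so that \<open>j \<ge> t - N/2\<close>.
\<close>

lemma theta_span_divisible:
  assumes "theta_span m N t f"
  shows "\<exists>h. f = emb (detX m) ^ (t - N div 2) * h"
  using assms
proof (induction rule: theta_span.induct)
  case zero
  show ?case by (intro exI[of _ 0]) simp
next
  case (word ks q j g)
  let ?d = "emb (detX m)"
  show ?case
  proof (cases "distinct ks")
    case True
    then have "2 * q \<le> N" using word card_mono[of "{1..N}" "set ks"] by (simp add: distinct_card)
    then have "j = (t - N div 2) + (j - (t - N div 2))" using word(3) by auto
    then have "?d ^ j = ?d ^ (t - N div 2) * ?d ^ (j - (t - N div 2))" by (metis power_add)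
    then have "?d ^ j * (g * (\<Prod>k\<leftarrow>ks. theta m k))
        = ?d ^ (t - N div 2) * (?d ^ (j - (t - N div 2)) * (g * (\<Prod>k\<leftarrow>ks. theta m k)))"
      by (simp only: mult.assoc)
    then show ?thesis ..
  next
    case False
    then show ?thesis by (intro exI[of _ 0]) (simp add: theta_word_repeated)
  qed
next
  case (add f g)
  then obtain h h' where "f = emb (detX m) ^ (t - N div 2) * h" "g = emb (detX m) ^ (t - N div 2) * h'" by blast
  then have "f + g = emb (detX m) ^ (t - N div 2) * (h + h')" by (simp only: distrib_left)
  then show ?case ..
qed

lemma theta_span_Gamma:
  assumes f: "theta_span (Suc r) N p (emb (detX r) ^ p * f)" and L: "2 * L \<le> N"
  shows "theta_span (Suc r) N (p + L) (emb (detX r) ^ (p + L) * (f * Gamma (Suc r) (2 * L)))"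
proof -
  let ?a = "emb (detX r)" and ?m = "Suc r"
  have prod: "theta_span ?m N (p + length kl) (?a ^ (p + length kl) * (f * (\<Prod>x\<leftarrow>kl. Delta_xi ?m (fst x) (snd x))))"
    if "set kl \<subseteq> {1..N} \<times> {1..N}" for kl
    using that
  proof (induction kl rule: rev_induct)
    case Nil
    then show ?case using f by simp
  next
    case (snoc x kl)
    let ?P = "\<Prod>x\<leftarrow>kl. Delta_xi ?m (fst x) (snd x)"
    obtain R where R: "twist R = R"
      "?a * Delta_xi ?m (fst x) (snd x) = theta ?m (fst x) * theta ?m (snd x) + emb (detX ?m) * R"
      using minor_Delta_xi by blast
    have "theta_span ?m N (Suc (p + length kl)) (?a ^ (p + length kl) * (f * ?P) * (?a * Delta_xi ?m (fst x) (snd x)))"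
      unfolding R(2) using snoc R(1) by (intro theta_span_step) auto
    also have "?a ^ (p + length kl) * (f * ?P) * (?a * Delta_xi ?m (fst x) (snd x))
        = ?a * (?a ^ (p + length kl) * (f * ?P) * Delta_xi ?m (fst x) (snd x))"
      by (rule emb_left_commute)
    finally show ?case by (simp add: mult.assoc)
  qed
  have pp: "theta_span ?m N (p + L) (?a ^ (p + L) * (f * pair_prod ?m L \<sigma>))" if s: "\<sigma> \<in> pairings L" for \<sigma>
  proof -
    let ?kl = "map (\<lambda>k. (\<sigma> (2 * k - 1), \<sigma> (2 * k))) [1..<L + 1]"
    have "set ?kl \<subseteq> {1..N} \<times> {1..N}"
    proof
      fix x assume "x \<in> set ?kl"
      then obtain k where "k \<in> set [1..<L + 1]" and x: "x = (\<sigma> (2 * k - 1), \<sigma> (2 * k))"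
        unfolding set_map by (elim imageE)
      then have k: "k \<in> {1..L}" by auto
      show "x \<in> {1..N} \<times> {1..N}" using pairings_in_range[OF s k] L x by auto
    qed
    from prod[OF this] show ?thesis by (simp add: o_def del: upt_Suc One_nat_def)
  qed
  have "?a ^ (p + L) * (f * Gamma ?m (2 * L))
      = (\<Sum>\<sigma>\<in>pairings L. of_int (sign \<sigma>) * (?a ^ (p + L) * (f * pair_prod ?m L \<sigma>)))"
  proof -
    have "G * (of_int k * H) = of_int k * (G * H)" for G H :: superpoly and k
      using emb_left_commute[of G "of_int k" H] by (simp only: emb_of_int)
    then show ?thesis unfolding Gamma_even sum_distrib_left by (intro sum.cong refl) simp
  qed
  also have "theta_span ?m N (p + L) \<dots>" by (intro theta_span_sum theta_span_mult_left pp)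
  finally show ?thesis .
qed

text \<open>
  Each \<open>\<Gamma>\<close> of even index \<open>x\<close> contributes \<open>x/2\<close> factors \<open>\<Delta>(\<xi>\<^sub>k, \<xi>\<^sub>l)\<close>, all with \<open>k, l \<le> N\<close>.  The power of the corner
  minor that makes the product divisible can be cancelled, because this minor is coprime to \<open>det X\<close>.
\<close>

theorem Gamma_product_divisible:
  assumes xs: "\<And>x. x \<in> set xs \<Longrightarrow> even x \<and> x \<le> N"
  shows "\<exists>h. (\<Prod>x\<leftarrow>xs. Gamma m x) = emb (detX m) ^ (sum_list xs div 2 - N div 2) * h"
proof (cases m)
  case 0
  then show ?thesis by auto
next
  case (Suc r)
  have "theta_span m N (sum_list xs div 2) (emb (detX r) ^ (sum_list xs div 2) * (\<Prod>x\<leftarrow>xs. Gamma m x))"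
    using xs
  proof (induction xs rule: rev_induct)
    case Nil
    show ?case using theta_span.word[of "[]" 0 N 0 0 m 1] by simp
  next
    case (snoc x xs)
    have ev: "even (sum_list xs)" using snoc.prems by (induction xs) auto
    obtain L where L: "x = 2 * L" "2 * L \<le> N" using snoc.prems[of x] by auto
    have "(sum_list xs + 2 * L) div 2 = sum_list xs div 2 + L" by simp
    then show ?case using theta_span_Gamma[of r N "sum_list xs div 2" "\<Prod>x\<leftarrow>xs. Gamma m x" L] snoc L Suc
      by (simp add: mult.assoc add.commute[of L])
  qed
  from theta_span_divisible[OF this] show ?thesis
    using detX_power_cancel Suc by blast
qed

section \<open>The semigroup of highest weight vectors\<close>

abbreviation weight_Delta :: "nat \<Rightarrow> bvec \<Rightarrow> complex" where
  "weight_Delta r \<equiv> (\<lambda>b. case b of Bx i \<Rightarrow> if i \<le> r then 2 else 0 | Bxi j \<Rightarrow> 0)"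

abbreviation weight_Gamma :: "nat \<Rightarrow> bvec \<Rightarrow> complex" where
  "weight_Gamma l \<equiv> (\<lambda>b. case b of Bx i \<Rightarrow> of_nat (2 * l) | Bxi j \<Rightarrow> of_bool (j \<le> 2 * l))"

lemma HW_one: "1 \<in> HW m n"
  using hwv_one HW_iff by blast

lemma HW_mult: "f \<in> HW m n \<Longrightarrow> g \<in> HW m n \<Longrightarrow> f * g \<in> HW m n"
  unfolding HW_iff by (elim exE) (rule exI, rule hwv_mult)

lemma HW_prod_list: "set gs \<subseteq> HW m n \<Longrightarrow> prod_list gs \<in> HW m n"
  by (induction gs) (auto intro: HW_one HW_mult)

lemma HW_power: "f \<in> HW m n \<Longrightarrow> f ^ k \<in> HW m n"
  by (induction k) (auto intro: HW_one HW_mult)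

lemma Delta_HW: "r \<le> m \<Longrightarrow> Delta r \<in> HW m n"
  using hwv_Delta HW_iff by blast

lemma Gamma_HW: "2 * l \<le> n \<Longrightarrow> Gamma m (2 * l) \<in> HW m n"
  using hwv_Gamma HW_iff by blast

lemma hw_generators_HW: "hw_generators m n \<subseteq> HW m n"
  unfolding hw_generators_def using Delta_HW Gamma_HW by fastforce

lemma Delta_power_eq_emb: "Delta m ^ k = emb (detX m ^ k)"
  by (simp add: Delta_eq_emb emb_power)

lemma HW_divide_Delta:
  assumes "Delta m ^ k * f \<in> HW m n"
  shows "f \<in> HW m n"
  using hwv_cancel[of m n _ "detX m ^ k" _ f] hwv_power[OF hwv_Delta[OF order_refl], of m n k] assms
  unfolding HW_iff Delta_power_eq_emb by blast

lemma Delta_power_cancel: "Delta m ^ k * f = Delta m ^ k * g \<Longrightarrow> f = g"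
  unfolding Delta_power_eq_emb by (rule emb_mult_cancel) (simp_all add: detX_nonzero)

lemma generated_semigroup_subset: "generated_semigroup m n (hw_generators m n) \<subseteq> HW m n"
proof
  fix f assume "f \<in> generated_semigroup m n (hw_generators m n)"
  then obtain c k gs where c: "c \<noteq> 0" "set gs \<subseteq> hw_generators m n" "Delta m ^ k * f = const c * prod_list gs"
    by (auto simp: generated_semigroup_def)
  have "prod_list gs \<in> HW m n" using c(2) hw_generators_HW by (intro HW_prod_list) blast
  moreover have "const c \<in> HW m n" using hwv_const[OF c(1)] HW_iff by blast
  ultimately have "Delta m ^ k * f \<in> HW m n" unfolding c(3) by (intro HW_mult)
  then show "f \<in> HW m n" by (rule HW_divide_Delta)
qed

subsection \<open>Products of generators with a given weight\<close>

lemma sum_telescope_nat: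
  fixes A :: "nat \<Rightarrow> nat"
  assumes "\<And>r. 1 \<le> r \<Longrightarrow> r \<le> m \<Longrightarrow> A (r + 1) \<le> A r" "A (m + 1) = 0" "1 \<le> i" "i \<le> m + 1"
  shows "(\<Sum>r = i..m. A r - A (r + 1)) = A i"
  using assms(4,3)
proof (induction i rule: inc_induct)
  case base
  then show ?case using assms(2) by simp
next
  case (step i)
  have "(\<Sum>r = i..m. A r - A (r + 1)) = (A i - A (i + 1)) + (\<Sum>r = Suc i..m. A r - A (r + 1))"
    using step by (intro sum.atLeast_Suc_atMost) auto
  then show ?case using step assms(1)[of i] by simp
qed

lemma sum_weighted_telescope_nat:
  fixes B :: "nat \<Rightarrow> nat"
  assumes "\<And>l. 1 \<le> l \<Longrightarrow> l \<le> q \<Longrightarrow> B (l + 1) \<le> B l"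
  shows "(\<Sum>l = 1..q. l * (B l - B (l + 1))) + q * B (q + 1) = (\<Sum>l = 1..q. B l)"
  using assms
proof (induction q)
  case (Suc q)
  obtain d where d: "B (Suc q) = B (Suc (Suc q)) + d" using Suc.prems[of "Suc q"] le_Suc_ex by auto
  have "(\<Sum>l = 1..q. l * (B l - B (l + 1))) + q * B (q + 1) = (\<Sum>l = 1..q. B l)"
    using Suc by simp
  then show ?case using d by (simp add: algebra_simps)
qed simp

text \<open>
  The exponents are the differences of consecutive parts of two partitions \<open>A\<close> and \<open>B\<close>.  The word then has weight
  \<open>2 A\<^sub>i\<close> in \<open>x\<^sub>i\<close> up to a multiple of the weight of \<open>det X\<close>, and \<open>B\<^sub>p\<close> in both \<open>\<xi>\<^sub>2\<^sub>p\<^sub>-\<^sub>1\<close> and \<open>\<xi>\<^sub>2\<^sub>p\<close>.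
\<close>

definition generator_word :: "nat \<Rightarrow> nat \<Rightarrow> (nat \<Rightarrow> nat) \<Rightarrow> (nat \<Rightarrow> nat) \<Rightarrow> superpoly list" where
  "generator_word m n A B =
     concat (map (\<lambda>i. replicate (A i - A (i + 1)) (Delta i)) [1..<m + 1])
     @ concat (map (\<lambda>l. replicate (B l - B (l + 1)) (Gamma m (2 * l))) [1..<n div 2 + 1])"

lemma set_generator_word: "set (generator_word m n A B) \<subseteq> hw_generators m n"
proof
  fix x assume "x \<in> set (generator_word m n A B)"
  then consider i where "i \<in> set [1..<m + 1]" "x = Delta i" | l where "l \<in> set [1..<n div 2 + 1]" "x = Gamma m (2 * l)"
    by (auto simp: generator_word_def simp del: upt_Suc)
  then show "x \<in> hw_generators m n"
    by cases (auto simp: hw_generators_def)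
qed

lemma prod_list_concat_replicate: "prod_list (concat (map (\<lambda>i. replicate (a i) (F i)) xs)) = (\<Prod>i\<leftarrow>xs. F i ^ a i)"
  by (induction xs) simp_all

lemma hwv_generator_word:
  assumes A: "\<And>r. 1 \<le> r \<Longrightarrow> r \<le> m \<Longrightarrow> A (r + 1) \<le> A r" "A (m + 1) = 0"
    and B: "\<And>l. 1 \<le> l \<Longrightarrow> l \<le> n div 2 \<Longrightarrow> B (l + 1) \<le> B l" "B (n div 2 + 1) = 0"
  shows "hwv m n (\<lambda>b. case b of Bx i \<Rightarrow> of_nat (2 * A i + 2 * (\<Sum>l = 1..n div 2. B l)) | Bxi j \<Rightarrow> of_nat (B ((j + 1) div 2)))
    (prod_list (generator_word m n A B))"
proof -
  let ?q = "n div 2"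
  let ?WA = "\<lambda>b. \<Sum>i\<leftarrow>[1..<m + 1]. of_nat (A i - A (i + 1)) * weight_Delta i b"
  let ?WB = "\<lambda>b. \<Sum>l\<leftarrow>[1..<?q + 1]. of_nat (B l - B (l + 1)) * weight_Gamma l b"
  have 1: "hwv m n ?WA (\<Prod>i\<leftarrow>[1..<m + 1]. Delta i ^ (A i - A (i + 1)))"
    by (intro hwv_prod_list hwv_power hwv_Delta) auto
  have 2: "hwv m n ?WB (\<Prod>l\<leftarrow>[1..<?q + 1]. Gamma m (2 * l) ^ (B l - B (l + 1)))"
    by (intro hwv_prod_list hwv_power hwv_Gamma) auto
  have "hwv m n (\<lambda>b. ?WA b + ?WB b) (prod_list (generator_word m n A B))"
    unfolding generator_word_def prod_list.append prod_list_concat_replicate by (rule hwv_mult[OF 1 2])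
  then show ?thesis
  proof (rule hwv_cong)
    fix b assume b: "b \<in> bvecs m n"
    have s: "set [1..<k + 1] = {1..k}" for k by auto
    have L: "(\<Sum>i\<leftarrow>[1..<k + 1]. F i) = (\<Sum>i = 1..k. F i)" for F :: "nat \<Rightarrow> complex" and k
      unfolding interv_sum_list_conv_sum_set_nat s ..
    show "?WA b + ?WB b = (case b of Bx i \<Rightarrow> of_nat (2 * A i + 2 * (\<Sum>l = 1..?q. B l)) | Bxi j \<Rightarrow> of_nat (B ((j + 1) div 2)))"
    proof (cases b)
      case (Bx i)
      then have i: "1 \<le> i" "i \<le> m" using b by auto
      have "?WA b = (\<Sum>r = 1..m. if i \<le> r then of_nat (2 * (A r - A (r + 1))) else 0)"
        unfolding L Bx by (intro sum.cong refl) auto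
      also have "\<dots> = (\<Sum>r = i..m. of_nat (2 * (A r - A (r + 1))))"
        by (rule sum.mono_neutral_cong_right) (use i in auto)
      also have "\<dots> = of_nat (2 * A i)"
        using sum_telescope_nat[of m A i, OF A] i by (simp flip: of_nat_sum sum_distrib_left of_nat_mult)
      finally have a: "?WA b = of_nat (2 * A i)" .
      have "?WB b = (\<Sum>l = 1..?q. of_nat (2 * (l * (B l - B (l + 1)))))"
        unfolding L Bx by (intro sum.cong refl) (simp add: mult_ac)
      also have "\<dots> = of_nat (2 * (\<Sum>l = 1..?q. l * (B l - B (l + 1))))"
        by (simp only: of_nat_sum sum_distrib_left)
      also have "(\<Sum>l = 1..?q. l * (B l - B (l + 1))) = (\<Sum>l = 1..?q. B l)"
        using sum_weighted_telescope_nat[of ?q B, OF B(1)] B(2) by simp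
      finally show ?thesis using a Bx by simp
    next
      case (Bxi j)
      then have j: "1 \<le> j" "j \<le> n" using b by auto
      let ?p = "(j + 1) div 2"
      have jl: "j \<le> 2 * l \<longleftrightarrow> ?p \<le> l" for l by auto
      have a: "?WA b = 0" unfolding L Bxi by simp
      have "?WB b = (\<Sum>l = 1..?q. if ?p \<le> l then of_nat (B l - B (l + 1)) else 0)"
        unfolding L Bxi by (intro sum.cong refl) (simp add: jl)
      also have "\<dots> = (\<Sum>l = ?p..?q. of_nat (B l - B (l + 1)))"
        by (rule sum.mono_neutral_cong_right) (use j in auto)
      also have "\<dots> = of_nat (B ?p)"
      proof -
        have "?p \<le> ?q + 1" "1 \<le> ?p" using j by auto
        then have "(\<Sum>l = ?p..?q. B l - B (l + 1)) = B ?p" using sum_telescope_nat[of ?q B ?p, OF B] by blast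
        then show ?thesis by (simp only: of_nat_sum[symmetric])
      qed
      finally show ?thesis using a Bxi by simp
    qed
  qed
qed

text \<open>
  The weight of a highest weight vector is read off its diagonal monomial and is dominant, so that it
  is the weight of a product of generators up to a power of the determinant.
\<close>

theorem HW_generated:
  assumes f: "f \<in> HW m n"
  obtains A B c where "c \<noteq> 0"
    "Delta m ^ (\<Sum>l = 1..n div 2. B l) * f = const c * prod_list (generator_word m n A B)"
proof -
  obtain W where W: "hwv m n W f" using f HW_iff by blast
  obtain \<alpha> where \<alpha>: "keys \<alpha> \<subseteq> evars m n \<inter> Collect diag"
    "\<And>b. b \<in> bvecs m n \<Longrightarrow> W b = (case b of Bx i \<Rightarrow> 2 | Bxi j \<Rightarrow> 1) * of_nat (lookup \<alpha> (diag_var b))"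
    using hwv_diag_monomial[OF W] by metis
  let ?q = "n div 2"
  define A where "A i = lookup \<alpha> (XX i i)" for i
  define B where "B l = lookup \<alpha> (YY (2 * l - 1) (2 * l))" for l
  have WA: "W (Bx i) = of_nat (2 * A i)" if "1 \<le> i" "i \<le> m" for i
    using \<alpha>(2)[of "Bx i"] that by (simp add: A_def)
  have WB: "W (Bxi j) = of_nat (B ((j + 1) div 2))" if "1 \<le> j" "j \<le> n" for j
  proof -
    have "diag_var (Bxi j) = YY (2 * ((j + 1) div 2) - 1) (2 * ((j + 1) div 2))"
      using that by (cases "odd j") (auto elim!: oddE evenE)
    then show ?thesis using \<alpha>(2)[of "Bxi j"] that by (simp add: B_def del: diag_var.simps)
  qed
  have "XX (m + 1) (m + 1) \<notin> keys \<alpha>" using \<alpha>(1) by (auto simp: evars_def)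
  then have A0: "A (m + 1) = 0" unfolding A_def by (simp only: in_keys_iff) simp
  have "YY (2 * (?q + 1) - 1) (2 * (?q + 1)) \<notin> keys \<alpha>" using \<alpha>(1) by (auto simp: evars_def)
  then have B0: "B (?q + 1) = 0" unfolding B_def by (simp only: in_keys_iff) simp
  have A1: "A (r + 1) \<le> A r" if r: "1 \<le> r" "r \<le> m" for r
  proof (cases "r = m")
    case False
    then obtain k where "W (Bx r) = W (Bx (r + 1)) + of_nat k" using hwv_dominant(1)[OF W, of r] r by auto
    then have "of_nat (2 * A r) = (of_nat (2 * A (r + 1) + k) :: complex)" using WA[of r] WA[of "r + 1"] r False by simp
    then show ?thesis by (simp only: of_nat_eq_iff)
  qed (use A0 in simp)
  have B1: "B (l + 1) \<le> B l" if l: "1 \<le> l" "l \<le> ?q" for l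
  proof (cases "2 * l < n")
    case True
    then obtain k where "W (Bxi (2 * l)) = W (Bxi (2 * l + 1)) + of_nat k" using hwv_dominant(2)[OF W, of "2 * l"] l by auto
    moreover have "(2 * l + 1) div 2 = l" "(2 * l + 1 + 1) div 2 = l + 1" by auto
    ultimately have "of_nat (B l) = (of_nat (B (l + 1) + k) :: complex)"
      using WB[of "2 * l"] WB[of "2 * l + 1"] l True by simp
    then show ?thesis by (simp only: of_nat_eq_iff)
  next
    case False
    then have "l = ?q" using l by auto
    then show ?thesis using B0 by simp
  qed
  let ?S = "\<Sum>l = 1..?q. B l"
  let ?W = "\<lambda>b. case b of Bx i \<Rightarrow> of_nat (2 * A i + 2 * ?S) | Bxi j \<Rightarrow> of_nat (B ((j + 1) div 2))"
  have 1: "hwv m n ?W (prod_list (generator_word m n A B))"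
    by (rule hwv_generator_word[OF A1 A0 B1 B0])
  have "hwv m n (\<lambda>b. of_nat ?S * weight_Delta m b + W b) (Delta m ^ ?S * f)"
    by (intro hwv_mult hwv_power hwv_Delta W) simp
  then have 2: "hwv m n ?W (Delta m ^ ?S * f)"
  proof (rule hwv_cong)
    fix b assume "b \<in> bvecs m n"
    then show "of_nat ?S * weight_Delta m b + W b = ?W b"
      by (cases b) (auto simp: WA WB mult.commute simp del: of_nat_sum)
  qed
  from hwv_proportional[OF 2 1] show thesis using that by blast
qed

theorem HW_eq_generated_semigroup: "HW m n = generated_semigroup m n (hw_generators m n)"
proof
  show "HW m n \<subseteq> generated_semigroup m n (hw_generators m n)"
  proof
    fix f assume f: "f \<in> HW m n"
    obtain A B c where "c \<noteq> 0" "Delta m ^ (\<Sum>l = 1..n div 2. B l) * f = const c * prod_list (generator_word m n A B)"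
      using HW_generated[OF f] by blast
    moreover have "f \<in> SS m n" using f by (simp add: HW_def)
    ultimately show "f \<in> generated_semigroup m n (hw_generators m n)"
      unfolding generated_semigroup_def using set_generator_word by blast
  qed
qed (rule generated_semigroup_subset)

subsection \<open>Freeness\<close>

lemma hwv_Delta_list:
  "set rs \<subseteq> {1..m} \<Longrightarrow> hwv m n (\<lambda>b. \<Sum>r\<leftarrow>rs. weight_Delta r b) (prod_list (map Delta rs))"
  by (rule hwv_prod_list) (auto intro!: hwv_Delta)

lemma count_by_tails:
  "count (mset rs) r + length (filter (\<lambda>x. Suc r \<le> x) rs) = length (filter (\<lambda>x. r \<le> x) rs)"
  by (induction rs) auto

text \<open>
  The weight of \<open>x\<^sub>i\<close> is twice the number of factors \<open>\<Delta>\<^sub>r\<close> with \<open>r \<ge> i\<close>, and these numbers determine the multiset.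
\<close>

lemma Delta_list_unique:
  assumes rs: "set rs \<subseteq> {1..m}" "set rs' \<subseteq> {1..m}" and c: "c \<noteq> 0" "c' \<noteq> 0"
    and eq: "const c * prod_list (map Delta rs) = const c' * prod_list (map Delta rs')"
  shows "mset rs = mset rs'"
proof (rule multiset_eqI)
  have w: "(\<Sum>r\<leftarrow>xs. weight_Delta r (Bx i)) = of_nat (2 * length (filter (\<lambda>x. i \<le> x) xs))" for xs i
    by (induction xs) auto
  have len: "length (filter (\<lambda>x. i \<le> x) rs) = length (filter (\<lambda>x. i \<le> x) rs')" if "1 \<le> i" for i
  proof (cases "i \<le> m")
    case True
    note 1 = hwv_const_mult[OF hwv_Delta_list[OF rs(1)] c(1), of 0]
    note 2 = hwv_const_mult[OF hwv_Delta_list[OF rs(2)] c(2), of 0]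
    have "(\<Sum>r\<leftarrow>rs. weight_Delta r (Bx i)) = (\<Sum>r\<leftarrow>rs'. weight_Delta r (Bx i))"
      using hwv_unique_weight[OF 1 2[folded eq], of "Bx i"] that True by simp
    then show ?thesis unfolding w by (simp only: of_nat_eq_iff)
  next
    case False
    then have "filter (\<lambda>x. i \<le> x) rs = []" "filter (\<lambda>x. i \<le> x) rs' = []" using rs by (auto simp: filter_empty_conv)
    then show ?thesis by simp
  qed
  fix r
  show "count (mset rs) r = count (mset rs') r"
  proof (cases "1 \<le> r")
    case True
    then show ?thesis using count_by_tails[of rs r] count_by_tails[of rs' r] len[of r] len[of "Suc r"] by simp
  next
    case False
    then have "r \<notin> set rs" "r \<notin> set rs'" using rs by auto
    then show ?thesis by (simp add: count_eq_zero_iff[THEN iffD2])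
  qed
qed

lemma hw_generators_small: "n = 0 \<or> n = 1 \<Longrightarrow> hw_generators m n = Delta ` {1..m}"
  by (auto simp: hw_generators_def)

theorem free_basis_small:
  assumes n: "n = 0 \<or> n = 1"
  shows "free_basis (HW m n) (hw_generators m n)"
  unfolding free_basis_def
proof (intro conjI ballI)
  show "hw_generators m n \<subseteq> HW m n" by (rule hw_generators_HW)
  note gen = hw_generators_small[OF n, of m]
  fix f assume f: "f \<in> HW m n"
  have n2: "n div 2 = 0" using n by auto
  obtain A B c where c: "c \<noteq> 0" "f = const c * prod_list (generator_word m n A B)"
  proof (rule HW_generated[OF f])
    fix A B c
    assume "c \<noteq> 0" "Delta m ^ (\<Sum>l = 1..n div 2. B l) * f = const c * prod_list (generator_word m n A B)"
    then show thesis using that[of c A B] unfolding n2 by simp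
  qed
  show "\<exists>!M. set_mset M \<subseteq> hw_generators m n \<and> (\<exists>bs c. mset bs = M \<and> c \<noteq> 0 \<and> f = const c * prod_list bs)"
  proof (rule ex1I)
    show "set_mset (mset (generator_word m n A B)) \<subseteq> hw_generators m n
        \<and> (\<exists>bs c. mset bs = mset (generator_word m n A B) \<and> c \<noteq> 0 \<and> f = const c * prod_list bs)"
      using set_generator_word c by auto
  next
    fix M assume M: "set_mset M \<subseteq> hw_generators m n \<and> (\<exists>bs c. mset bs = M \<and> c \<noteq> 0 \<and> f = const c * prod_list bs)"
    then obtain bs c' where bs: "mset bs = M" "c' \<noteq> 0" "f = const c' * prod_list bs" by blast
    have lift: "\<exists>rs. xs = map Delta rs \<and> set rs \<subseteq> {1..m}" if "set xs \<subseteq> hw_generators m n" for xs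
      using that unfolding gen
    proof (induction xs)
      case (Cons x xs)
      then obtain rs r where "xs = map Delta rs" "set rs \<subseteq> {1..m}" "x = Delta r" "r \<in> {1..m}" by auto
      then show ?case by (intro exI[of _ "r # rs"]) simp
    qed simp
    obtain rs where rs: "bs = map Delta rs" "set rs \<subseteq> {1..m}" using lift[of bs] M bs(1) by auto
    obtain rs' where rs': "generator_word m n A B = map Delta rs'" "set rs' \<subseteq> {1..m}"
      using lift[OF set_generator_word] by blast
    have "mset rs = mset rs'"
      by (rule Delta_list_unique[OF rs(2) rs'(2) bs(2) c(1)]) (use c(2) bs(3) rs rs' in simp)
    then show "M = mset (generator_word m n A B)" using bs(1) rs(1) rs'(1) by simp
  qed
qed

lemma HW_prod_list_mset:
  assumes "mset xs = mset ys" "set xs \<subseteq> HW m n"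
  shows "\<exists>c. c \<noteq> 0 \<and> prod_list xs = const c * prod_list ys"
proof -
  have "\<forall>x. \<exists>W. x \<in> HW m n \<longrightarrow> hwv m n W x" unfolding HW_iff by blast
  from choice[OF this] obtain w where "\<forall>x. x \<in> HW m n \<longrightarrow> hwv m n (w x) x" ..
  then have w: "hwv m n (w x) x" if "x \<in> HW m n" for x using that by blast
  have "set ys \<subseteq> HW m n" using assms by (metis set_mset_mset)
  then have y: "hwv m n (\<lambda>b. \<Sum>x\<leftarrow>ys. w x b) (prod_list (map (\<lambda>x. x) ys))"
    by (intro hwv_prod_list w) auto
  have "hwv m n (\<lambda>b. \<Sum>x\<leftarrow>xs. w x b) (prod_list (map (\<lambda>x. x) xs))"
    using assms(2) by (intro hwv_prod_list w) auto
  moreover have "(\<Sum>x\<leftarrow>xs. w x b) = (\<Sum>x\<leftarrow>ys. w x b)" for b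
    using assms(1) by (metis mset_map sum_mset_sum_list)
  ultimately have "hwv m n (\<lambda>b. \<Sum>x\<leftarrow>ys. w x b) (prod_list (map (\<lambda>x. x) xs))" by simp
  from hwv_proportional[OF this y] show ?thesis by simp metis
qed

lemma Gamma_2: "Gamma m 2 = Delta_xi m 1 2"
proof -
  have "p = id" if p: "p \<in> pairings 1" for p
  proof (rule pairing_eq_id[OF p])
    fix k assume k: "k \<in> {1..1::nat}"
    then have "k = 1" by auto
    then show "\<exists>j\<in>{1..1}. p (2 * k - 1) = 2 * j - 1 \<and> p (2 * k) = 2 * j"
      using pairings_in_range[OF p k] pairings_pos(1)[OF p k] by auto
  qed
  then have "pairings 1 = {id}" using id_pairing by blast
  then show ?thesis using Gamma_even[of m 1] by (simp add: sign_id)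
qed

text \<open>
  The coefficient of \<open>\<eta>\<^sub>1\<^sub>m \<eta>\<^sub>2\<^sub>m\<close> in \<open>\<Gamma>(2)\<close> is the cofactor \<open>\<Delta>\<^sub>m\<^sub>-\<^sub>1\<close>.  If it were a multiple of \<open>det X\<close>, the quotient would have negative
  weight in \<open>x\<^sub>m\<close>.
\<close>

lemma Gamma_2_not_divisible:
  assumes m: "1 \<le> m"
  shows "Gamma m 2 \<noteq> emb (detX m) * w"
proof
  assume eq: "Gamma m 2 = emb (detX m) * w"
  obtain r where r: "m = Suc r" using m by (cases m) auto
  let ?S = "{(1, m), (2, m)} :: ovar set"
  have o: "ext_coeff (odd_var 1 q * odd_var 2 i) ?S = (if i = m then if q = m then 1 else 0 else 0)" for i q
  proof -
    have e: "{s \<in> ?S. s < (1, m)} = {}" by auto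
    have d: "?S - {(1, m)} = {(2, m)}" by auto
    have 1: "ext_coeff (odd_var 1 q * odd_var 2 i) ?S = (if (1, q) \<in> ?S
        then (- 1) ^ card {s \<in> ?S. s < (1, q)} * ext_coeff (odd_var 2 i) (?S - {(1, q)}) else 0)"
      unfolding odd_var_def by (rule ext_coeff_odd_mult)
    show ?thesis
    proof (cases "q = m")
      case True
      show ?thesis unfolding 1 unfolding True e d by (simp add: odd_var_def ext_coeff_monom)
    next
      case False
      then show ?thesis unfolding 1 by simp
    qed
  qed
  have "ext_coeff (Delta_xi m 1 2) ?S
      = (\<Sum>i = 1..m. \<Sum>q = 1..m. cofX m i q * (if i = m then if q = m then 1 else 0 else 0))"
    unfolding Delta_xi_eq
    by (simp add: ext_coeff_scalar_mult o[unfolded One_nat_def] yvar_def even_var_def ext_coeff_monom)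
  also have "\<dots> = (\<Sum>i = 1..m. if i = m then cofX m i m else 0)"
    by (intro sum.cong refl) (use m in \<open>auto simp: if_distrib[of "\<lambda>x. _ * x"] sum.delta cong: if_cong\<close>)
  also have "\<dots> = detX r" using m by (simp add: r cofactor_last sum.delta del: sum.cl_ivl_Suc)
  finally have "detX r = detX m * ext_coeff w ?S"
    using arg_cong[OF eq, of "\<lambda>f. ext_coeff f ?S"] by (simp only: Gamma_2 ext_coeff_scalar_mult)
  then have "emb (detX r) = emb (detX m) * emb (ext_coeff w ?S)" by (simp only: emb_mult[symmetric])
  then have "hwv m 0 (weight_Delta r) (emb (detX m) * emb (ext_coeff w ?S))"
    using hwv_Delta[of r m 0] r by (simp add: Delta_eq_emb)
  then have "hwv m 0 (\<lambda>b. weight_Delta r b - weight_Delta m b) (emb (ext_coeff w ?S))"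
    using hwv_Delta[of m m 0] by (intro hwv_cancel) (simp_all add: Delta_eq_emb)
  note hw = this
  obtain \<alpha> :: "evar \<Rightarrow>\<^sub>0 nat" where
    "\<And>b. b \<in> bvecs m 0 \<Longrightarrow> weight_Delta r b - weight_Delta m b
       = (case b of Bx i \<Rightarrow> 2 | Bxi j \<Rightarrow> 1) * of_nat (lookup \<alpha> (diag_var b))"
    by (rule hwv_diag_monomial[OF hw]) (rule that, assumption)
  from this[of "Bx m"] have "of_nat (lookup \<alpha> (XX m m) + 1) = (0 :: complex)" using m r by simp
  then show False by (simp only: of_nat_eq_0_iff)
qed

text \<open>
  For \<open>n \<ge> 2\<close> the quotients \<open>\<Gamma>(2)\<^sup>k / (det X)\<^sup>k\<^sup>-\<^sup>1\<close> are highest weight vectors for all \<open>k\<close>.  In a free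
  semigroup this would force \<open>det X\<close> to divide \<open>\<Gamma>(2)\<close>.
\<close>

theorem not_free:
  assumes m: "1 \<le> m" and n: "2 \<le> n"
  shows "\<not> free_semigroup (HW m n)"
proof
  assume "free_semigroup (HW m n)"
  then obtain B where fb: "free_basis (HW m n) B" unfolding free_semigroup_def ..
  define fact_of where "fact_of f M \<longleftrightarrow> set_mset M \<subseteq> B \<and> (\<exists>bs c. mset bs = M \<and> c \<noteq> 0 \<and> f = const c * prod_list bs)" for f M
  have B: "B \<subseteq> HW m n" using fb unfolding free_basis_def by (rule conjunct1)
  have ex1: "\<exists>!M. fact_of f M" if "f \<in> HW m n" for f
    using bspec[OF conjunct2[OF fb[unfolded free_basis_def]] that] unfolding fact_of_def .
  have ex: "\<exists>M. fact_of f M" if "f \<in> HW m n" for f using ex1[OF that] by blast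
  have uniq: "M = N" if "f \<in> HW m n" "fact_of f M" "fact_of f N" for f M N
    using ex1[OF that(1)] that(2,3) by blast
  have mult: "fact_of (f * g) (M + N)" if fg: "fact_of f M" "fact_of g N" for f g M N
  proof -
    obtain bs c where 1: "mset bs = M" "c \<noteq> 0" "f = const c * prod_list bs"
      using conjunct2[OF fg(1)[unfolded fact_of_def]] by (elim exE conjE)
    obtain cs d where 2: "mset cs = N" "d \<noteq> 0" "g = const d * prod_list cs"
      using conjunct2[OF fg(2)[unfolded fact_of_def]] by (elim exE conjE)
    have "f * g = const (c * d) * prod_list (bs @ cs)"
      unfolding 1 2 by (simp only: const_mult prod_list.append mult.assoc const_left_commute[of "prod_list bs"])
    moreover have "mset (bs @ cs) = M + N" "c * d \<noteq> 0" using 1 2 by auto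
    moreover have "set_mset M \<subseteq> B" "set_mset N \<subseteq> B"
      using fg[unfolded fact_of_def] by (blast dest: conjunct1)+
    ultimately show ?thesis unfolding fact_of_def
      by (intro conjI exI[of _ "bs @ cs"] exI[of _ "c * d"]) simp_all
  qed
  have one: "fact_of 1 {#}" unfolding fact_of_def by (intro conjI exI[of _ "[]"] exI[of _ 1]) auto
  have pow: "fact_of (f ^ k) (repeat_mset k M)" if "fact_of f M" for f k M
    by (induction k) (use one mult[OF that] in auto)
  let ?d = "Delta m" and ?g = "Gamma m 2"
  have d: "?d \<in> HW m n" by (rule Delta_HW) simp
  have g: "?g \<in> HW m n" using Gamma_HW[of 1 n m] n by simp
  obtain Md where Md: "fact_of ?d Md" using ex[OF d] ..
  obtain Mg where Mg: "fact_of ?g Mg" using ex[OF g] ..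
  \<comment> \<open>the relation \<open>\<Gamma>(2)\<^sup>k\<^sup>+\<^sup>1 = (det X)\<^sup>k h\<close> bounds multiplicities for every \<open>k\<close>\<close>
  have cnt: "k * count Md b \<le> Suc k * count Mg b" for k b
  proof -
    have "\<exists>h. (\<Prod>x\<leftarrow>replicate (Suc k) 2. Gamma m x)
        = emb (detX m) ^ (sum_list (replicate (Suc k) 2) div 2 - 2 div 2) * h"
      by (rule Gamma_product_divisible) auto
    then obtain h where h: "?g ^ Suc k = ?d ^ k * h"
      by (auto simp: sum_list_replicate Delta_eq_emb)
    have gk: "?g ^ Suc k \<in> HW m n" by (rule HW_power[OF g])
    then have "h \<in> HW m n" unfolding h by (rule HW_divide_Delta)
    then obtain Mh where Mh: "fact_of h Mh" using ex by blast
    have "fact_of (?g ^ Suc k) (repeat_mset k Md + Mh)" unfolding h by (rule mult[OF pow[OF Md] Mh])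
    then have "repeat_mset (Suc k) Mg = repeat_mset k Md + Mh" using uniq[OF gk pow[OF Mg]] by blast
    then have "count (repeat_mset (Suc k) Mg) b = count (repeat_mset k Md + Mh) b" by simp
    then have "Suc k * count Mg b = k * count Md b + count Mh b" by (simp only: count_repeat_mset count_union)
    then show ?thesis by simp
  qed
  have "Md \<subseteq># Mg"
  proof (rule mset_subset_eqI, rule ccontr)
    fix b assume "\<not> count Md b \<le> count Mg b"
    then obtain e where e: "count Md b = Suc e" "count Mg b \<le> e" by (cases "count Md b") auto
    \<comment> \<open>\<open>k = e + 1\<close> is large enough for a contradiction, since \<open>e (e + 2) < (e + 1)\<^sup>2\<close>\<close>
    have "Suc e * Suc e \<le> Suc (Suc e) * count Mg b" using cnt[of "Suc e" b] e by simp
    also have "\<dots> \<le> Suc (Suc e) * e" using e(2) by (rule mult_le_mono2)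
    finally show False by simp
  qed
  then obtain R where R: "Mg = Md + R" by (metis subset_mset.le_iff_add)
  obtain bs c where bs: "mset bs = Md" "c \<noteq> 0" "?d = const c * prod_list bs" "set bs \<subseteq> B"
    using Md unfolding fact_of_def by (metis set_mset_mset)
  obtain cs c' where cs: "mset cs = Mg" "c' \<noteq> 0" "?g = const c' * prod_list cs" "set cs \<subseteq> B"
    using Mg unfolding fact_of_def by (metis set_mset_mset)
  obtain rs where rs: "mset rs = R" using ex_mset by blast
  have "set cs \<subseteq> HW m n" using cs(4) B by blast
  moreover have "mset cs = mset (bs @ rs)" using cs(1) R bs(1) rs by simp
  ultimately obtain e where e: "e \<noteq> 0" "prod_list cs = const e * prod_list (bs @ rs)"
    using HW_prod_list_mset by blast
  have "prod_list bs = const (1 / c) * ?d"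
    unfolding bs(3) using bs(2) by (simp flip: mult.assoc const_mult)
  then have "?g = const c' * (const e * (const (1 / c) * ?d * prod_list rs))"
    unfolding cs(3) e(2) by simp
  also have "\<dots> = ?d * (const c' * (const e * (const (1 / c) * prod_list rs)))"
    by (simp only: mult.assoc const_left_commute[of ?d])
  finally show False using Gamma_2_not_divisible[OF m] by (simp add: Delta_eq_emb)
qed

section \<open>Partitions\<close>

lemma part_antimono:
  assumes "is_partition la" "1 \<le> i" "i \<le> j"
  shows "part la j \<le> part la i"
proof (cases "j \<le> length la \<and> i < j")
  case True
  then have "la ! (j - 1) \<le> la ! (i - 1)"
    using assms sorted_wrt_nth_less[of "(\<ge>)" la "i - 1" "j - 1"] by (auto simp: is_partition_def)
  then show ?thesis using True assms by (simp add: part_def)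
qed (use assms in \<open>auto simp: part_def\<close>)

text \<open>
  Rows are counted from the top: the rows of length at least \<open>j\<close> are the first ones.
\<close>

lemma conj_part_iff:
  assumes la: "is_partition la" and ij: "1 \<le> i" "1 \<le> j"
  shows "j \<le> part la i \<longleftrightarrow> i \<le> conj_part la j"
proof -
  let ?A = "{i \<in> {1..length la}. j \<le> part la i}"
  have A: "i \<in> ?A \<longleftrightarrow> 1 \<le> i \<and> j \<le> part la i" for i using ij(2) by (auto simp: part_def split: if_splits)
  have "?A = {1..card ?A}"
  proof -
    have down: "i' \<in> ?A" if "i \<in> ?A" "1 \<le> i'" "i' \<le> i" for i i'
      using that part_antimono[OF la that(2,3)] unfolding A by auto
    show ?thesis
    proof (cases "?A = {}")
      case False
      have fin: "finite ?A" by simp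
      have "?A = {1..Max ?A}"
      proof
        show "?A \<subseteq> {1..Max ?A}"
        proof
          fix x assume x: "x \<in> ?A"
          then have "1 \<le> x" by simp
          moreover have "x \<le> Max ?A" by (rule Max_ge[OF fin x])
          ultimately show "x \<in> {1..Max ?A}" by simp
        qed
        show "{1..Max ?A} \<subseteq> ?A"
        proof
          fix x assume "x \<in> {1..Max ?A}"
          then have "1 \<le> x" "x \<le> Max ?A" by simp_all
          then show "x \<in> ?A" by (rule down[OF Max_in[OF fin False]])
        qed
      qed
      then show ?thesis by (metis card_atLeastAtMost diff_Suc_1)
    qed (simp only: card.empty, simp)
  qed
  then have "i \<in> ?A \<longleftrightarrow> i \<in> {1..card ?A}" by simp
  then show ?thesis using ij(1) unfolding A conj_part_def by simp
qed

lemma conj_part_le_length: "conj_part la j \<le> length la"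
proof -
  have "conj_part la j \<le> card {1..length la}" unfolding conj_part_def by (rule card_mono) auto
  then show ?thesis by simp
qed

lemma even_part: "\<forall>i\<in>set la. even i \<Longrightarrow> even (part la i)"
  by (auto simp: part_def)

text \<open>
  Divisibility of the product of the \<open>\<Gamma>\<close>'s is \<open>Gamma_product_divisible\<close>, with \<open>N = r = \<lambda>\<^sub>m\<^sub>+\<^sub>1\<close> as the common bound for the parts.
  For the weight, only \<open>\<lambda>\<^sub>m\<^sub>+\<^sub>1\<close> out of \<open>\<Sum> \<lambda>\<^sub>i\<close> (\<open>i > m\<close>) survives the division in the weight of each \<open>x\<^sub>p\<close>, and the
  minors add twice the number of \<open>i > r/2\<close> with \<open>2i \<le> \<lambda>\<^sub>p\<close>, that is \<open>\<lambda>\<^sub>p - r\<close>.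
\<close>

theorem HW_formula:
  assumes la: "is_partition la" "\<forall>i\<in>set la. even i" and n: "part la (m + 1) \<le> n"
    and r: "r = 0 \<or> m < conj_part la r" "conj_part la (r + 1) \<le> m"
  shows "\<exists>v. is_hw_formula m la r v \<and>
    hwv m n (case_bvec (\<lambda>i. of_nat (part la i)) (\<lambda>j. of_nat (conj_part la j - m))) v"
proof -
  let ?len = "length la"
  note conj = conj_part_iff[OF la(1)]
  have rp: "r = part la (m + 1)"
  proof (rule antisym)
    show "r \<le> part la (m + 1)" using r(1) conj[of "m + 1" r] by (cases "r = 0") auto
    show "part la (m + 1) \<le> r" using r(2) conj[of "m + 1" "r + 1"] by auto
  qed
  have ev: "even (part la i)" for i using even_part[OF la(2)] .
  have er: "even r" using rp ev by simp
  let ?k = "(\<Sum>i = m + 2..?len. part la i) div 2"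
  let ?xs = "map (part la) [m + 1..<?len + 1]"
  let ?is = "[r div 2 + 1..<part la 1 div 2 + 1]"
  have eS: "even (\<Sum>i = m + 2..?len. part la i)" by (simp add: ev dvd_sum)
  have sumxs: "sum_list ?xs = r + 2 * ?k"
  proof (cases "m + 1 \<le> ?len")
    case True
    have "sum_list ?xs = (\<Sum>i = m + 1..?len. part la i)"
      unfolding interv_sum_list_conv_sum_set_nat by (rule sum.cong) auto
    also have "\<dots> = part la (m + 1) + (\<Sum>i = m + 2..?len. part la i)"
      using True by (subst sum.atLeast_Suc_atMost) auto
    finally show ?thesis using eS rp by simp
  next
    case False
    then show ?thesis using rp by (simp add: part_def)
  qed
  have xr: "even x \<and> x \<le> r" if "x \<in> set ?xs" for x
    using that ev part_antimono[OF la(1), of "m + 1"] unfolding rp by auto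
  obtain h where h: "(\<Prod>x\<leftarrow>?xs. Gamma m x) = emb (detX m) ^ (sum_list ?xs div 2 - r div 2) * h"
    using Gamma_product_divisible[of ?xs r m] xr by blast
  have "sum_list ?xs div 2 - r div 2 = ?k" unfolding sumxs using er by simp
  with h have h: "(\<Prod>x\<leftarrow>?xs. Gamma m x) = emb (detX m ^ ?k) * h" by (simp add: emb_power)
  have hG: "hwv m n (\<lambda>b. \<Sum>x\<leftarrow>?xs. weight_Gamma (x div 2) b) (\<Prod>x\<leftarrow>?xs. Gamma m x)"
  proof (rule hwv_prod_list)
    fix x assume x: "x \<in> set ?xs"
    then obtain L where L: "x = 2 * L" "x \<le> n" using xr[OF x] n rp by (auto elim: evenE)
    then have L2: "x div 2 = L" by simp
    show "hwv m n (weight_Gamma (x div 2)) (Gamma m x)"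
      unfolding L2 unfolding L(1) using L by (intro hwv_Gamma) simp
  qed
  have hd: "hwv m n (\<lambda>b. of_nat ?k * weight_Delta m b) (emb (detX m ^ ?k))"
    unfolding Delta_power_eq_emb[symmetric] by (intro hwv_power hwv_Delta) simp
  have cm: "conj_part la (2 * i) \<le> m" if "r div 2 + 1 \<le> i" for i
  proof (rule ccontr)
    assume "\<not> conj_part la (2 * i) \<le> m"
    then have "2 * i \<le> r" using conj[of "m + 1" "2 * i"] that rp by auto
    then show False using that by auto
  qed
  have hD: "hwv m n (\<lambda>b. \<Sum>i\<leftarrow>?is. weight_Delta (conj_part la (2 * i)) b) (\<Prod>i\<leftarrow>?is. Delta (conj_part la (2 * i)))"
    by (intro hwv_prod_list hwv_Delta cm) auto
  let ?v = "h * (\<Prod>i\<leftarrow>?is. Delta (conj_part la (2 * i)))"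
  have form: "is_hw_formula m la r ?v"
    unfolding is_hw_formula_def Delta_power_eq_emb mult.assoc[symmetric] h[symmetric]
    by (simp add: o_def del: upt_Suc)
  let ?W = "\<lambda>b. ((\<Sum>x\<leftarrow>?xs. weight_Gamma (x div 2) b) - of_nat ?k * weight_Delta m b)
      + (\<Sum>i\<leftarrow>?is. weight_Delta (conj_part la (2 * i)) b)"
  have "hwv m n ?W ?v" by (rule hwv_mult[OF hwv_cancel[OF hd hG[unfolded h]] hD])
  then have "hwv m n (case_bvec (\<lambda>i. of_nat (part la i)) (\<lambda>j. of_nat (conj_part la j - m))) ?v"
  proof (rule hwv_cong)
    fix b assume b: "b \<in> bvecs m n"
    show "?W b = case_bvec (\<lambda>i. of_nat (part la i)) (\<lambda>j. of_nat (conj_part la j - m)) b"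
    proof (cases b)
      case (Bx p)
      then have p: "1 \<le> p" "p \<le> m" using b by auto
      have "(\<Sum>x\<leftarrow>xs. weight_Gamma (x div 2) (Bx p)) = of_nat (sum_list xs)" if "\<And>x. x \<in> set xs \<Longrightarrow> even x" for xs
      proof -
        have half: "2 * of_nat (a div 2) = (of_nat a :: complex)" if "even a" for a :: nat
          using that by (auto elim!: evenE)
        show ?thesis using that by (induction xs) (auto simp: half)
      qed
      then have 1: "(\<Sum>x\<leftarrow>?xs. weight_Gamma (x div 2) b) = of_nat (r + 2 * ?k)"
        unfolding Bx sumxs[symmetric] using xr by blast
      have pr: "r \<le> part la p" "part la p \<le> part la 1" using part_antimono[OF la(1)] p rp by auto
      have "(\<Sum>i\<leftarrow>?is. weight_Delta (conj_part la (2 * i)) b) = (\<Sum>i\<in>set ?is. if 2 * i \<le> part la p then 2 else 0)"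
        unfolding interv_sum_list_conv_sum_set_nat Bx
        by (intro sum.cong refl) (use conj[OF p(1)] in auto)
      also have "\<dots> = (\<Sum>i = r div 2 + 1..part la p div 2. 2)"
        by (rule sum.mono_neutral_cong_right) (use pr in auto)
      also have "\<dots> = of_nat (part la p - r)"
      proof -
        have "2 * (part la p div 2 - r div 2) = part la p - r" using ev[of p] er pr by (auto elim!: evenE)
        then have "of_nat (part la p - r) = (of_nat (2 * (part la p div 2 - r div 2)) :: complex)" by simp
        then show ?thesis by simp
      qed
      finally have 2: "(\<Sum>i\<leftarrow>?is. weight_Delta (conj_part la (2 * i)) b) = of_nat (part la p - r)" .
      have "of_nat ?k * weight_Delta m b = of_nat (2 * ?k)" using Bx p by simp
      then have "?W b = of_nat (r + 2 * ?k) - of_nat (2 * ?k) + of_nat (part la p - r)" unfolding 1 2 by simp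
      also have "\<dots> = of_nat (part la p)" using pr by (simp add: of_nat_diff)
      finally show ?thesis using Bx by simp
    next
      case (Bxi q)
      then have q: "1 \<le> q" "q \<le> n" using b by auto
      have "(\<Sum>x\<leftarrow>?xs. weight_Gamma (x div 2) b) = (\<Sum>i\<leftarrow>[m + 1..<?len + 1]. weight_Gamma (part la i div 2) b)"
        by (simp add: o_def del: upt_Suc)
      also have "\<dots> = (\<Sum>i\<in>set [m + 1..<?len + 1]. if i \<le> conj_part la q then 1 else 0)"
        unfolding interv_sum_list_conv_sum_set_nat Bxi
      proof (intro sum.cong refl)
        fix i assume "i \<in> set [m + 1..<?len + 1]"
        then have "1 \<le> i" by auto
        from conj[OF this q(1)] show "weight_Gamma (part la i div 2) (Bxi q) = (if i \<le> conj_part la q then 1 else 0)"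
          using ev[of i] by auto
      qed
      also have "\<dots> = (\<Sum>i = m + 1..conj_part la q. 1)"
        by (rule sum.mono_neutral_cong_right) (use conj_part_le_length[of la q] in auto)
      also have "\<dots> = of_nat (conj_part la q - m)" by simp
      finally show ?thesis using Bxi by simp
    qed
  qed
  with form show ?thesis by blast
qed

lemma hw_formula_unique: "is_hw_formula m la r v \<Longrightarrow> is_hw_formula m la r w \<Longrightarrow> v = w"
  unfolding is_hw_formula_def by (metis Delta_power_cancel)

lemma HW_assoc_eq:
  assumes v: "hwv m n (case_bvec (\<lambda>i. of_nat (part la i)) (\<lambda>j. of_nat (conj_part la j - m))) v"
  shows "HW_assoc m n la = {const c * v | c. c \<noteq> 0}"
proof (intro equalityI subsetI)
  fix f assume "f \<in> HW_assoc m n la"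
  then have "hwv m n (case_bvec (\<lambda>i. of_nat (part la i)) (\<lambda>j. of_nat (conj_part la j - m))) f"
    by (auto simp: HW_assoc_def has_weight_iff HW_def hwv_def)
  from hwv_proportional[OF this v] show "f \<in> {const c * v | c. c \<noteq> 0}" by blast
next
  fix f assume "f \<in> {const c * v | c. c \<noteq> 0}"
  then obtain c where "c \<noteq> 0" "f = const c * v" by blast
  then have "hwv m n (case_bvec (\<lambda>i. of_nat (part la i)) (\<lambda>j. of_nat (conj_part la j - m))) f"
    using hwv_const_mult[OF v] by simp
  then show "f \<in> HW_assoc m n la"
    unfolding HW_assoc_def has_weight_iff using HW_iff hwvD(4) by blast
qed

theorem theorem5p1:
  fixes m n :: nat
  shows "(\<forall>f\<in>HW m n. \<forall>g\<in>HW m n. f * g \<in> HW m n \<and> f * g = g * f)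
    \<and> HW m n = generated_semigroup m n (hw_generators m n)
    \<and> (1 \<le> m \<longrightarrow> (free_semigroup (HW m n) \<longleftrightarrow> n = 0 \<or> n = 1))
    \<and> (n = 0 \<or> n = 1 \<longrightarrow> free_basis (HW m n) (hw_generators m n))
    \<and> (\<forall>la r. is_partition la \<and> (\<forall>i\<in>set la. even i) \<and> part la (m + 1) \<le> n
          \<and> (r = 0 \<or> m < conj_part la r) \<and> conj_part la (r + 1) \<le> m \<longrightarrow>
         (\<exists>!v. v \<in> SS m n \<and> is_hw_formula m la r v)
         \<and> (\<forall>v\<in>SS m n. is_hw_formula m la r v \<longrightarrow>
              HW_assoc m n la = {const c * v | c. c \<noteq> 0}))"
proof (intro conjI)
  show "\<forall>f\<in>HW m n. \<forall>g\<in>HW m n. f * g \<in> HW m n \<and> f * g = g * f"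
    using HW_mult hwv_commute HW_iff by metis
  show "HW m n = generated_semigroup m n (hw_generators m n)" by (rule HW_eq_generated_semigroup)
  show "n = 0 \<or> n = 1 \<longrightarrow> free_basis (HW m n) (hw_generators m n)" using free_basis_small by blast
  show "1 \<le> m \<longrightarrow> (free_semigroup (HW m n) \<longleftrightarrow> n = 0 \<or> n = 1)"
  proof
    assume m: "1 \<le> m"
    show "free_semigroup (HW m n) \<longleftrightarrow> n = 0 \<or> n = 1"
    proof
      assume "free_semigroup (HW m n)"
      then have "\<not> 2 \<le> n" using not_free[OF m] by blast
      then show "n = 0 \<or> n = 1" by linarith
    next
      assume "n = 0 \<or> n = 1"
      then show "free_semigroup (HW m n)" using free_basis_small unfolding free_semigroup_def by blast
    qed
  qed
  show "\<forall>la r. is_partition la \<and> (\<forall>i\<in>set la. even i) \<and> part la (m + 1) \<le> n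
          \<and> (r = 0 \<or> m < conj_part la r) \<and> conj_part la (r + 1) \<le> m \<longrightarrow>
         (\<exists>!v. v \<in> SS m n \<and> is_hw_formula m la r v)
         \<and> (\<forall>v\<in>SS m n. is_hw_formula m la r v \<longrightarrow>
              HW_assoc m n la = {const c * v | c. c \<noteq> 0})"
  proof (intro allI impI)
    fix la r
    assume "is_partition la \<and> (\<forall>i\<in>set la. even i) \<and> part la (m + 1) \<le> n
          \<and> (r = 0 \<or> m < conj_part la r) \<and> conj_part la (r + 1) \<le> m"
    then obtain v where v: "is_hw_formula m la r v"
      "hwv m n (case_bvec (\<lambda>i. of_nat (part la i)) (\<lambda>j. of_nat (conj_part la j - m))) v"
      using HW_formula[of la m n r] by blast
    have "\<exists>!v. v \<in> SS m n \<and> is_hw_formula m la r v"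
      using v(1) hwvD(1)[OF v(2)] hw_formula_unique by blast
    moreover have "\<forall>w\<in>SS m n. is_hw_formula m la r w \<longrightarrow> HW_assoc m n la = {const c * w | c. c \<noteq> 0}"
      using HW_assoc_eq[OF v(2)] hw_formula_unique[OF v(1)] by blast
    ultimately show "(\<exists>!v. v \<in> SS m n \<and> is_hw_formula m la r v)
         \<and> (\<forall>v\<in>SS m n. is_hw_formula m la r v \<longrightarrow> HW_assoc m n la = {const c * v | c. c \<noteq> 0})" ..
  qed
qed

end
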